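(* Let $\alpha,s\in\mathbb{N}$ and let $\boldsymbol{\gamma}=(\gamma_u)_{u\subseteq 1:s}$ be weights with $\gamma_u\ge 0$. Then the space $\mathcal{H}(K_{\alpha,\boldsymbol{\gamma},s}^{\mathrm{kor}+\mathrm{cos}})$ (the sum of the weighted Korobov space and the weighted half-period cosine space) and the space $\mathcal{H}(K_{\alpha,\boldsymbol{\gamma},s}^{\mathrm{sob(odd)}})$ are norm equivalent.
   Context: $\mathbb{N}$ is the set of positive integers and $1:s=\{1,\ldots,s\}$. For a reproducing kernel $K:[0,1]^s\times[0,1]^s\to\mathbb{R}$, $\mathcal{H}(K)$ is the reproducing kernel Hilbert space (RKHS) of real-valued functions on $[0,1]^s$ with kernel $K$, and $\|\cdot\|_K$ is its norm. $\mathcal{H}(K_1)$ is continuously embedded in $\mathcal{H}(K_2)$ if $\mathcal{H}(K_1)\subseteq\mathcal{H}(K_2)$ as sets and there is a constant $C>0$ with $\|f\|_{K_2}\le C\|f\|_{K_1}$ for all $f\in\mathcal{H}(K_1)$; they are norm equivalent if each is continuously embedded in the other. The Korobov plus cosine kernel is $$K_{\alpha,\boldsymbol{\gamma},s}^{\mathrm{kor}+\mathrm{cos}}(\boldsymbol{x},\boldsymbol{y})=1+\sum_{\emptyset\ne u\subseteq 1:s}\gamma_u\prod_{j\in u}\left[-1+K_{\alpha,1,1}^{\mathrm{kor}+\mathrm{cos}}(x_j,y_j)\right],$$ $$K_{\alpha,1,1}^{\mathrm{kor}+\mathrm{cos}}(x,y)=1+\sum_{k=1}^{\infty}\frac{\cos(2\pi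 k(x-y))+\cos(\pi kx)\cos(\pi ky)}{k^{2\alpha}}.$$ With $B_\tau$ the Bernoulli polynomial of degree $\tau$, $$K_{\alpha,1,1}^{\mathrm{sob(odd)}}(x,y)=1+\sum_{\substack{\tau=1\\ \tau\text{ odd}}}^{\alpha}\frac{B_\tau(x)B_\tau(y)}{(\tau!)^2}+(-1)^{\alpha+1}\frac{B_{2\alpha}(|x-y|)}{(2\alpha)!},$$ $$K_{\alpha,\boldsymbol{\gamma},s}^{\mathrm{sob(odd)}}(\boldsymbol{x},\boldsymbol{y})=1+\sum_{\emptyset\ne u\subseteq 1:s}\gamma_u\prod_{j\in u}\left[-1+K_{\alpha,1,1}^{\mathrm{sob(odd)}}(x_j,y_j)\right].$$ Equivalently, $\mathcal{H}(K_{\alpha,1,1}^{\mathrm{sob(odd)}})$ is the set of $f:[0,1]\to\mathbb{R}$ with $f^{(\tau)}$ absolutely continuous for $\tau=0,\ldots,\alpha-1$, $f^{(\alpha)}\in L^2[0,1]$, and $f^{(\tau)}(0)=f^{(\tau)}(1)$ for all odd $\tau\le\alpha-1$, with squared norm $\left(\int_0^1 f\right)^2+\sum_{\tau=1}^{\alpha-1}\left(\int_0^1 f^{(\tau)}\right)^2+\int_0^1 (f^{(\alpha)})^2$. *)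

theory Defs
  imports "HOL-Analysis.Analysis"
begin

text \<open>
  Real-valued functions on a set \<open>X\<close> are represented by the functions in
  \<^term>\<open>extensional X\<close>, so that equality of functions is equality on \<open>X\<close>.
  The pointwise operations are restricted to \<open>X\<close> accordingly. The values of the
  inner product \<open>ip\<close> outside the carrier \<open>H\<close> are irrelevant.
\<close>

locale rkhs =
  fixes X :: "'a set"
    and K :: "'a \<Rightarrow> 'a \<Rightarrow> real"
    and H :: "('a \<Rightarrow> real) set"
    and ip :: "('a \<Rightarrow> real) \<Rightarrow> ('a \<Rightarrow> real) \<Rightarrow> real"
  assumes carrier: "H \<subseteq> extensional X"
    and zero_mem: "(\<lambda>x\<in>X. 0) \<in> H"
    and add_mem: "f \<in> H \<Longrightarrow> g \<in> H \<Longrightarrow> (\<lambda>x\<in>X. f x + g x) \<in> H"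
    and scale_mem: "f \<in> H \<Longrightarrow> (\<lambda>x\<in>X. c * f x) \<in> H"
    and ip_commute: "f \<in> H \<Longrightarrow> g \<in> H \<Longrightarrow> ip f g = ip g f"
    and ip_add: "f \<in> H \<Longrightarrow> g \<in> H \<Longrightarrow> h \<in> H \<Longrightarrow>
                   ip (\<lambda>x\<in>X. f x + g x) h = ip f h + ip g h"
    and ip_scale: "f \<in> H \<Longrightarrow> g \<in> H \<Longrightarrow> ip (\<lambda>x\<in>X. c * f x) g = c * ip f g"
    and ip_nonneg: "f \<in> H \<Longrightarrow> 0 \<le> ip f f"
    and ip_definite: "f \<in> H \<Longrightarrow> ip f f = 0 \<Longrightarrow> f = (\<lambda>x\<in>X. 0)"
    and complete:
      "\<lbrakk>\<And>n. F n \<in> H;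
        \<forall>e>0. \<exists>N::nat. \<forall>m\<ge>N. \<forall>n\<ge>N.
          sqrt (ip (\<lambda>x\<in>X. F m x - F n x) (\<lambda>x\<in>X. F m x - F n x)) < e\<rbrakk>
       \<Longrightarrow> \<exists>f\<in>H. (\<lambda>n. sqrt (ip (\<lambda>x\<in>X. F n x - f x) (\<lambda>x\<in>X. F n x - f x)))
                    \<longlonglongrightarrow> 0"
    and kernel_mem: "y \<in> X \<Longrightarrow> (\<lambda>x\<in>X. K x y) \<in> H"
    and reproducing: "f \<in> H \<Longrightarrow> y \<in> X \<Longrightarrow> ip f (\<lambda>x\<in>X. K x y) = f y"

definition reproducing_kernel :: "'a set \<Rightarrow> ('a \<Rightarrow> 'a \<Rightarrow> real) \<Rightarrow> bool" where
  "reproducing_kernel X K \<longleftrightarrow> (\<exists>H ip. rkhs X K H ip)"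

text \<open>
  By the Moore--Aronszajn theorem a reproducing kernel determines the carrier, and
  determines the inner product on the carrier, so that the following descriptions
  denote the space \<open>\<H>(K)\<close> and its norm.
\<close>

definition rkhs_space :: "'a set \<Rightarrow> ('a \<Rightarrow> 'a \<Rightarrow> real) \<Rightarrow> ('a \<Rightarrow> real) set" where
  "rkhs_space X K = (THE H. \<exists>ip. rkhs X K H ip)"

definition rkhs_norm :: "'a set \<Rightarrow> ('a \<Rightarrow> 'a \<Rightarrow> real) \<Rightarrow> ('a \<Rightarrow> real) \<Rightarrow> real" where
  "rkhs_norm X K f = (THE r. \<exists>H ip. rkhs X K H ip \<and> f \<in> H \<and> r = sqrt (ip f f))"

text \<open>
  The first two conjuncts make explicit that both spaces exist; without them the
  descriptions above would carry no information.
\<close>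

definition continuously_embedded ::
  "'a set \<Rightarrow> ('a \<Rightarrow> 'a \<Rightarrow> real) \<Rightarrow> ('a \<Rightarrow> 'a \<Rightarrow> real) \<Rightarrow> bool" where
  "continuously_embedded X K1 K2 \<longleftrightarrow>
     reproducing_kernel X K1 \<and> reproducing_kernel X K2 \<and>
     rkhs_space X K1 \<subseteq> rkhs_space X K2 \<and>
     (\<exists>C>0. \<forall>f\<in>rkhs_space X K1. rkhs_norm X K2 f \<le> C * rkhs_norm X K1 f)"

definition norm_equivalent ::
  "'a set \<Rightarrow> ('a \<Rightarrow> 'a \<Rightarrow> real) \<Rightarrow> ('a \<Rightarrow> 'a \<Rightarrow> real) \<Rightarrow> bool" where
  "norm_equivalent X K1 K2 \<longleftrightarrow>
     continuously_embedded X K1 K2 \<and> continuously_embedded X K2 K1"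

text \<open>
  Points of \<open>[0,1]\<^sup>s\<close> are functions on the index set \<open>{1..s}\<close>.
\<close>

definition unit_cube :: "nat \<Rightarrow> (nat \<Rightarrow> real) set" where
  "unit_cube s = (\<Pi>\<^sub>E j\<in>{1..s}. {0..1})"

definition weighted_kernel ::
  "(real \<Rightarrow> real \<Rightarrow> real) \<Rightarrow> (nat set \<Rightarrow> real) \<Rightarrow> nat \<Rightarrow> (nat \<Rightarrow> real) \<Rightarrow> (nat \<Rightarrow> real) \<Rightarrow> real"
where
  "weighted_kernel k \<gamma> s x y =
     1 + (\<Sum>u\<in>Pow {1..s} - {{}}. \<gamma> u * (\<Prod>j\<in>u. - 1 + k (x j) (y j)))"

definition K_kor_cos_1 :: "nat \<Rightarrow> real \<Rightarrow> real \<Rightarrow> real" where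
  "K_kor_cos_1 \<alpha> x y =
     1 + (\<Sum>n. let k = real (Suc n) in
            (cos (2 * pi * k * (x - y)) + cos (pi * k * x) * cos (pi * k * y)) / k ^ (2 * \<alpha>))"

definition K_kor_cos ::
  "nat \<Rightarrow> (nat set \<Rightarrow> real) \<Rightarrow> nat \<Rightarrow> (nat \<Rightarrow> real) \<Rightarrow> (nat \<Rightarrow> real) \<Rightarrow> real" where
  "K_kor_cos \<alpha> \<gamma> s = weighted_kernel (K_kor_cos_1 \<alpha>) \<gamma> s"

text \<open>
  Bernoulli numbers with \<open>B\<^sub>1 = - 1/2\<close>, from
  \<open>(\<Sum>k\<le>n. (Suc n choose k) * B\<^sub>k) = 0\<close> for \<open>n \<ge> 1\<close>.
\<close>

fun bernoulli_number :: "nat \<Rightarrow> real" where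
  "bernoulli_number n =
     (if n = 0 then 1
      else - (\<Sum>k<n. real (Suc n choose k) * bernoulli_number k) / real (Suc n))"

declare bernoulli_number.simps [simp del]

definition bernoulli_poly :: "nat \<Rightarrow> real \<Rightarrow> real" where
  "bernoulli_poly n x = (\<Sum>k\<le>n. real (n choose k) * bernoulli_number k * x ^ (n - k))"

definition K_sob_odd_1 :: "nat \<Rightarrow> real \<Rightarrow> real \<Rightarrow> real" where
  "K_sob_odd_1 \<alpha> x y =
     1 + (\<Sum>\<tau>\<in>{\<tau>\<in>{1..\<alpha>}. odd \<tau>}. bernoulli_poly \<tau> x * bernoulli_poly \<tau> y / (fact \<tau>)\<^sup>2)
       + (- 1) ^ (\<alpha> + 1) * bernoulli_poly (2 * \<alpha>) \<bar>x - y\<bar> / fact (2 * \<alpha>)"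

definition K_sob_odd ::
  "nat \<Rightarrow> (nat set \<Rightarrow> real) \<Rightarrow> nat \<Rightarrow> (nat \<Rightarrow> real) \<Rightarrow> (nat \<Rightarrow> real) \<Rightarrow> real" where
  "K_sob_odd \<alpha> \<gamma> s = weighted_kernel (K_sob_odd_1 \<alpha>) \<gamma> s"

end

theory Submission
  imports Defs
begin

text \<open>
  Inclusion with a norm bound between reproducing kernel spaces follows from domination of the kernels
  as quadratic forms on finitely supported measures, and by Schur's product theorem domination passes
  from the one-dimensional kernels to the weighted ones. It remains to compare, for a finite signed
  measure \<open>\<mu>\<close> on \<open>[0,1]\<close>, the forms
  \<open>\<Sum>\<^sub>k k\<^sup>-\<^sup>2\<^sup>\<alpha> (|\<mu>(exp(2\<pi>ikx))|\<^sup>2 + \<mu>(cos(\<pi>kx))\<^sup>2)\<close> and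
  \<open>\<Sum>\<^sub>\<tau> \<mu>(B\<^sub>\<tau>/\<tau>!)\<^sup>2 + c \<Sum>\<^sub>k k\<^sup>-\<^sup>2\<^sup>\<alpha> |\<mu>(exp(2\<pi>ikx))|\<^sup>2\<close>.
  The cosines with even \<open>k\<close> belong to the periodic part. Those with odd \<open>k\<close> give the squared
  \<open>L\<^sup>2\<close> norm in \<open>t\<close> of an antiperiodic (Euler) spline in \<open>x - t\<close>, just as the sines give that of the
  periodic Bernoulli spline. Suitably scaled, the two splines have the same jump at \<open>x = t\<close>, so they
  differ by a polynomial, whose part odd about \<open>x = 1/2\<close> is
  \<open>\<Sum>\<^sub>\<tau> B\<^sub>\<tau>(x) e\<^sub>\<alpha>\<^sub>-\<^sub>\<tau>(1 - t)\<close>, \<open>\<tau>\<close> odd, with Euler polynomials \<open>e\<close> of distinct degrees. Hence the odd moments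
  \<open>\<mu>(B\<^sub>\<tau>)\<close> bound, and are bounded by, the difference of the two splines.
\<close>

section \<open>Reproducing kernel Hilbert spaces\<close>

text \<open>The space and the norm are descriptions over all realisations of a kernel, so existence
  and uniqueness come before any comparison. Both rest on one criterion: a function f on X lies in
  the space of K iff mu(f)^2 <= C K(mu,mu) for all finitely supported mu, and the least such C is
  the squared norm. Domination of forms by a factor C thus gives an embedding with constant sqrt C.
  The obstacle in dimension one is that cos(pi k x) with odd k is not 1-periodic and not orthogonal
  to the sines sin(2 pi k x): both are odd about 1/2, as are the odd Bernoulli polynomials. The
  cosines cos(2 pi k x), even about 1/2, occur in both forms and only affect constants. On the odd
  part there are three squared norms, of the periodic spline, the antiperiodic spline and their
  polynomial difference, and each is bounded by the other two. The polynomial norm is equivalent to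
  the sum of squared odd moments because Euler polynomials of distinct degrees are independent, so
  that their Gram matrix is positive definite. The lower bound for it comes from compactness, so the
  final constant is not explicit.\<close>

text \<open>A list of pairs \<open>(c, x)\<close> stands for the measure with mass \<open>c\<close> at \<open>x\<close>, repetitions allowed; addition of
  measures is concatenation.\<close>

definition pair :: "(real \<times> 'a) list \<Rightarrow> ('a \<Rightarrow> real) \<Rightarrow> real" where
  "pair l f = (\<Sum>(c, x)\<leftarrow>l. c * f x)"

definition points :: "(real \<times> 'a) list \<Rightarrow> 'a set" where
  "points l = snd ` set l"

definition scale :: "real \<Rightarrow> (real \<times> 'a) list \<Rightarrow> (real \<times> 'a) list" where
  "scale a l = map (\<lambda>(c, x). (a * c, x)) l"

definition qf :: "('a \<Rightarrow> 'a \<Rightarrow> real) \<Rightarrow> (real \<times> 'a) list \<Rightarrow> (real \<times> 'a) list \<Rightarrow> real" where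
  "qf K l m = pair l (\<lambda>x. pair m (K x))"

text \<open>Symmetry is kept apart, in \<open>psd_kernel\<close>, so that differences and products
  of kernels can be handled by the form alone.\<close>

definition psd :: "'a set \<Rightarrow> ('a \<Rightarrow> 'a \<Rightarrow> real) \<Rightarrow> bool" where
  "psd X K \<longleftrightarrow> (\<forall>l. points l \<subseteq> X \<longrightarrow> 0 \<le> qf K l l)"

lemma pair_Nil [simp]: "pair [] f = 0"
  and pair_Cons [simp]: "pair ((c, x) # l) f = c * f x + pair l f"
  and pair_append [simp]: "pair (l @ m) f = pair l f + pair m f"
  by (simp_all add: pair_def)

lemma points_simps [simp]:
  "points [] = {}" "points ((c, x) # l) = insert x (points l)"
  "points (l @ m) = points l \<union> points m" "points (scale a l) = points l"
  by (force simp: points_def scale_def image_iff)+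

lemma pair_scale [simp]: "pair (scale a l) f = a * pair l f"
  by (induction l) (auto simp: scale_def algebra_simps)

lemma pair_add: "pair l (\<lambda>x. f x + g x) = pair l f + pair l g"
  by (induction l) (auto simp: algebra_simps)

lemma pair_diff: "pair l (\<lambda>x. f x - g x) = pair l f - pair l g"
  by (induction l) (auto simp: algebra_simps)

lemma pair_cmult: "pair l (\<lambda>x. a * f x) = a * pair l f"
  by (induction l) (auto simp: algebra_simps)

lemma pair_multc: "pair l (\<lambda>x. f x * a) = pair l f * a"
  by (induction l) (auto simp: algebra_simps)

lemma pair_sum: "pair l (\<lambda>x. \<Sum>i\<in>I. f i x) = (\<Sum>i\<in>I. pair l (f i))"
  by (induction l) (auto simp: sum.distrib sum_distrib_left)

lemma pair_cong:
  assumes "\<And>x. x \<in> points l \<Longrightarrow> f x = g x"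
  shows "pair l f = pair l g"
  using assms by (induction l) auto

lemma pair_swap: "pair l (\<lambda>x. pair m (\<lambda>y. K x y)) = pair m (\<lambda>y. pair l (\<lambda>x. K x y))"
proof (induction l)
  case Nil
  show ?case by (induction m) auto
next
  case (Cons p l)
  then show ?case by (cases p) (simp add: pair_add pair_cmult)
qed

lemma tendsto_pair:
  assumes "\<And>x. x \<in> points l \<Longrightarrow> ((\<lambda>n. f n x) \<longlongrightarrow> g x) F"
  shows "((\<lambda>n. pair l (f n)) \<longlongrightarrow> pair l g) F"
  using assms by (induction l) (auto intro!: tendsto_intros)

lemma qf_append: "qf K (l @ l') m = qf K l m + qf K l' m" "qf K m (l @ l') = qf K m l + qf K m l'"
  by (simp_all add: qf_def pair_add)

lemma qf_scale: "qf K (scale a l) m = a * qf K l m" "qf K m (scale a l) = a * qf K m l"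
  by (simp_all add: qf_def pair_cmult)

lemma qf_single: "qf K [(1, x)] m = pair m (K x)"
  by (simp add: qf_def)

lemma abs_less_if_square_less:
  fixes x e :: real
  assumes "x\<^sup>2 < e\<^sup>2" "0 < e"
  shows "\<bar>x\<bar> < e"
  using power2_less_imp_less[of "\<bar>x\<bar>" e] assms by simp

lemma discriminant_le:
  fixes a d e :: real
  assumes "\<And>s. 0 \<le> a * s\<^sup>2 + 2 * d * s + e" and "0 \<le> a"
  shows "d\<^sup>2 \<le> a * e"
proof (cases "a = 0")
  case True
  have "d = 0"
  proof (rule ccontr)
    assume "d \<noteq> 0"
    \<comment> \<open>At this s the linear function 2 d s + e takes the value -1.\<close>
    then show False using assms(1)[of "- (e + 1) / (2 * d)"] True by (simp add: field_simps)
  qed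
  then show ?thesis using True by simp
next
  case False
  then show ?thesis
    using assms(1)[of "- d / a"] assms(2) by (simp add: field_simps power2_eq_square)
qed

section \<open>Existence: the Hilbert space of a positive semidefinite kernel\<close>

locale psd_kernel =
  fixes X :: "'a set" and K :: "'a \<Rightarrow> 'a \<Rightarrow> real"
  assumes sym: "\<And>x y. x \<in> X \<Longrightarrow> y \<in> X \<Longrightarrow> K x y = K y x"
    and psd: "psd X K"
begin

lemma qf_nonneg: "points l \<subseteq> X \<Longrightarrow> 0 \<le> qf K l l"
  using psd by (simp add: psd_def)

lemma qf_commute:
  assumes "points l \<subseteq> X" "points m \<subseteq> X"
  shows "qf K l m = qf K m l"
  unfolding qf_def
  by (subst pair_swap) (intro pair_cong, use assms sym in blast)

lemma qf_sum_square:
  assumes "points l \<subseteq> X" "points m \<subseteq> X"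
  shows "qf K (l @ scale s m) (l @ scale s m) = qf K m m * s\<^sup>2 + 2 * qf K l m * s + qf K l l"
  using qf_commute[OF assms] by (simp add: qf_append qf_scale power2_eq_square algebra_simps)

lemma cauchy_schwarz:
  assumes "points l \<subseteq> X" "points m \<subseteq> X"
  shows "(qf K l m)\<^sup>2 \<le> qf K l l * qf K m m"
proof -
  have "0 \<le> qf K m m * s\<^sup>2 + 2 * qf K l m * s + qf K l l" for s
    using qf_nonneg[of "l @ scale s m"] assms by (simp add: qf_sum_square)
  then show ?thesis
    using discriminant_le qf_nonneg assms by (metis mult.commute)
qed

text \<open>The functional mu -> mu(f) is bounded in the seminorm of \<open>K\<close> on measures.
  By \<open>bounded_by_inner\<close> and \<open>inner_le\<close> the least \<open>C\<close> is the
  squared norm of \<open>f\<close>.\<close>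

definition bounded_by :: "('a \<Rightarrow> real) \<Rightarrow> real \<Rightarrow> bool" where
  "bounded_by f C \<longleftrightarrow> 0 \<le> C \<and> (\<forall>l. points l \<subseteq> X \<longrightarrow> (pair l f)\<^sup>2 \<le> C * qf K l l)"

text \<open>Represents \<open>f\<close> as a limit of finite combinations of kernel sections.
  Keeping the limit as a function, through its values on \<open>X\<close>, avoids forming a quotient
  of Cauchy sequences.\<close>

definition approx :: "(nat \<Rightarrow> (real \<times> 'a) list) \<Rightarrow> ('a \<Rightarrow> real) \<Rightarrow> bool" where
  "approx L f \<longleftrightarrow> (\<forall>n. points (L n) \<subseteq> X) \<and>
     (\<forall>e>0. \<exists>N. \<forall>m\<ge>N. \<forall>n\<ge>N. qf K (L m @ scale (-1) (L n)) (L m @ scale (-1) (L n)) < e) \<and>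
     (\<forall>x\<in>X. (\<lambda>n. pair (L n) (K x)) \<longlonglongrightarrow> f x)"

text \<open>Riesz representation: a minimising sequence of \<open>l \<mapsto> qf K l l - 2 * pair l f\<close> is Cauchy by
  the parallelogram law.\<close>

lemma bounded_by_imp_approx:
  assumes "bounded_by f C"
  shows "\<exists>L. approx L f"
proof -
  define \<phi> where "\<phi> l = qf K l l - 2 * pair l f" for l
  define S where "S = \<phi> ` {l. points l \<subseteq> X}"
  \<comment> \<open>From 2 mu(f) <= 2 sqrt C q <= q^2 + C, where q is the seminorm of mu.\<close>
  have lower: "- C \<le> \<phi> l" if l: "points l \<subseteq> X" for l
  proof -
    define q where "q = sqrt (qf K l l)"
    have q: "q\<^sup>2 = qf K l l" "0 \<le> q" using qf_nonneg[OF l] by (auto simp: q_def)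
    have C: "(sqrt C)\<^sup>2 = C" "0 \<le> sqrt C" using assms by (auto simp: bounded_by_def)
    have "(pair l f)\<^sup>2 \<le> (sqrt C * q)\<^sup>2"
      using assms l q C by (simp add: bounded_by_def power_mult_distrib)
    then have "pair l f \<le> sqrt C * q"
      using q C by (meson abs_le_square_iff abs_ge_self mult_nonneg_nonneg order_trans power2_le_imp_le)
    moreover have "2 * (sqrt C * q) \<le> q\<^sup>2 + (sqrt C)\<^sup>2"
      using zero_le_power2[of "q - sqrt C"] by (simp add: power2_diff algebra_simps)
    ultimately show ?thesis using q C unfolding \<phi>_def by linarith
  qed
  have bdd: "bdd_below S" using lower by (auto simp: S_def intro!: bdd_belowI)
  have "\<phi> [] \<in> S" by (simp add: S_def)
  then have ne: "S \<noteq> {}" by auto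
  define I where "I = Inf S"
  have I: "I \<le> \<phi> l" if "points l \<subseteq> X" for l
    unfolding I_def using that bdd by (auto simp: S_def intro!: cInf_lower)
  define u where "u n = inverse (real (Suc n))" for n
  have u0: "u n > 0" for n by (simp add: u_def)
  have "\<exists>l. points l \<subseteq> X \<and> \<phi> l < I + u n" for n
  proof -
    have "Inf S < I + u n" using u0[of n] by (simp add: I_def)
    then show ?thesis using cInf_less_iff[OF ne bdd] by (auto simp: S_def)
  qed
  then obtain L where L: "\<And>n. points (L n) \<subseteq> X" "\<And>n. \<phi> (L n) < I + u n"
    by metis
  have near: "qf K (L m @ scale (-1) (L n)) (L m @ scale (-1) (L n))
      \<le> 2 * u m + 2 * u n" for m n
  proof -
    define c where "c = scale (1/2) (L m @ L n)"
    have "I \<le> \<phi> c" using L by (intro I) (simp add: c_def)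
    moreover have "4 * \<phi> c + qf K (L m @ scale (-1) (L n)) (L m @ scale (-1) (L n))
       = 2 * \<phi> (L m) + 2 * \<phi> (L n)"
      by (simp add: c_def \<phi>_def qf_append qf_scale field_simps)
    ultimately show ?thesis using L(2)[of m] L(2)[of n] by linarith
  qed
  have "\<exists>N. \<forall>m\<ge>N. \<forall>n\<ge>N. qf K (L m @ scale (-1) (L n)) (L m @ scale (-1) (L n)) < e"
    if e: "e > 0" for e
  proof -
    obtain N where N: "u N < e / 4"
      using reals_Archimedean[of "e / 4"] e by (auto simp: u_def)
    have *: "u m < e / 4" if "m \<ge> N" for m
    proof -
      have "u m \<le> u N" using that unfolding u_def by (intro le_imp_inverse_le) auto
      then show ?thesis using N by linarith
    qed
    show ?thesis
    proof (intro exI allI impI)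
      fix m n assume "m \<ge> N" "n \<ge> N"
      then show "qf K (L m @ scale (-1) (L n)) (L m @ scale (-1) (L n)) < e"
        using near[of m n] *[of m] *[of n] by simp
    qed
  qed
  moreover have "(\<lambda>n. pair (L n) (K x)) \<longlonglongrightarrow> f x" if x: "x \<in> X" for x
  proof -
    let ?d = "\<lambda>n. pair (L n) (K x) - f x"
    \<comment> \<open>\<open>L n\<close> minimises up to \<open>u n\<close>, so adding mass s at x
      yields a quadratic in s that is at least -\<open>u n\<close>; its discriminant bounds the
      first variation.\<close>
    have "(?d n)\<^sup>2 \<le> K x x * u n" for n
    proof (rule discriminant_le)
      have Kx: "qf K (L n) [(1, x)] = pair (L n) (K x)"
        using qf_commute[of "L n" "[(1, x)]"] L x by (simp add: qf_single)
      show "0 \<le> K x x" using qf_nonneg[of "[(1, x)]"] x by (simp add: qf_def)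
      fix s
      have "I \<le> \<phi> (L n @ scale s [(1, x)])" using L x by (intro I) simp
      also have "\<phi> (L n @ scale s [(1, x)]) = \<phi> (L n) + K x x * s\<^sup>2 + 2 * ?d n * s"
      proof -
        have "qf K [(1, x)] [(1, x)] = K x x" by (simp add: qf_def)
        then show ?thesis
          using qf_sum_square[of "L n" "[(1, x)]" s] L x
          by (simp add: \<phi>_def Kx algebra_simps)
      qed
      finally show "0 \<le> K x x * s\<^sup>2 + 2 * ?d n * s + u n"
        using L(2)[of n] by linarith
    qed
    moreover have "(\<lambda>n. K x x * u n) \<longlonglongrightarrow> 0"
      unfolding u_def by (intro tendsto_mult_right_zero LIMSEQ_inverse_real_of_nat)
    ultimately have "(\<lambda>n. (?d n)\<^sup>2) \<longlonglongrightarrow> 0"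
      using tendsto_sandwich[of "\<lambda>n. 0" "\<lambda>n. (?d n)\<^sup>2" sequentially "\<lambda>n. K x x * u n" 0] by simp
    then have "?d \<longlonglongrightarrow> 0" by simp
    then show ?thesis by (simp add: LIM_zero_iff)
  qed
  ultimately have "approx L f" using L by (simp add: approx_def)
  then show ?thesis by (rule exI[of _ L])
qed

lemma approx_pair:
  assumes "approx L f" "points l \<subseteq> X"
  shows "(\<lambda>n. qf K l (L n)) \<longlonglongrightarrow> pair l f"
  unfolding qf_def by (rule tendsto_pair) (use assms in \<open>auto simp: approx_def\<close>)

lemma approx_points: "approx L f \<Longrightarrow> points (L n) \<subseteq> X"
  by (auto simp: approx_def)

lemma approx_cauchy:
  assumes "approx L f" "e > 0"
  shows "\<exists>N. \<forall>m\<ge>N. \<forall>n\<ge>N. qf K (L m @ scale (-1) (L n)) (L m @ scale (-1) (L n)) < e"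
  using assms by (simp add: approx_def)

lemma approx_bdd:
  assumes "approx L f"
  shows "\<exists>B>0. \<forall>n. qf K (L n) (L n) \<le> B"
proof -
  obtain N where N: "\<And>n. n \<ge> N \<Longrightarrow> qf K (L N @ scale (-1) (L n)) (L N @ scale (-1) (L n)) < 1"
    using approx_cauchy[OF assms zero_less_one] by blast
  have "qf K (L n) (L n) \<le> 2 * qf K (L N) (L N) + 2" if "n \<ge> N" for n
  proof -
    note p = approx_points[OF assms]
    \<comment> \<open>With \<open>N\<close>, this is |b|^2 <= 2 |a|^2 + 2 |a - b|^2, the slack being
      |2a - b|^2, for a from \<open>L N\<close> and b from \<open>L n\<close>.\<close>
    have "0 \<le> qf K (scale 2 (L N) @ scale (-1) (L n)) (scale 2 (L N) @ scale (-1) (L n))"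
      by (rule qf_nonneg) (simp add: p)
    then show ?thesis using N[OF that] qf_commute[OF p p, of N n]
      by (simp add: qf_append qf_scale)
  qed
  moreover have "qf K (L n) (L n) \<le> (\<Sum>i<N. qf K (L i) (L i))" if "n < N" for n
    by (rule member_le_sum) (use that in \<open>auto intro!: qf_nonneg approx_points[OF assms]\<close>)
  moreover have "0 \<le> (\<Sum>i<N. qf K (L i) (L i))" "0 \<le> qf K (L N) (L N)"
    by (auto intro!: sum_nonneg qf_nonneg approx_points[OF assms])
  ultimately show ?thesis
    by (intro exI[of _ "2 * qf K (L N) (L N) + 2 + (\<Sum>i<N. qf K (L i) (L i))"])
       (smt (verit, best) not_less)
qed

text \<open>Cauchy-Schwarz for \<open>L n\<close> - \<open>L m\<close>, with m sent to infinity. The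
  rate depends on \<open>l\<close> only through its energy, so \<open>l\<close> may later vary with
  n.\<close>

lemma approx_uniform:
  assumes f: "approx L f" and e: "e > 0"
  shows "\<exists>N. \<forall>n\<ge>N. \<forall>l. points l \<subseteq> X \<longrightarrow> (qf K l (L n) - pair l f)\<^sup>2 \<le> qf K l l * e"
proof -
  obtain N where N: "\<And>m n. m \<ge> N \<Longrightarrow> n \<ge> N \<Longrightarrow> qf K (L m @ scale (-1) (L n)) (L m @ scale (-1) (L n)) < e"
    using approx_cauchy[OF f e] by meson
  show ?thesis
  proof (intro exI allI impI)
    fix n l assume n: "n \<ge> N" and l: "points l \<subseteq> X"
    have "(\<lambda>m. (qf K l (L n) - qf K l (L m))\<^sup>2) \<longlonglongrightarrow> (qf K l (L n) - pair l f)\<^sup>2"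
      using approx_pair[OF f l] by (intro tendsto_intros)
    moreover have "(qf K l (L n) - qf K l (L m))\<^sup>2 \<le> qf K l l * e" if m: "m \<ge> N" for m
    proof -
      have "(qf K l (L n @ scale (-1) (L m)))\<^sup>2
          \<le> qf K l l * qf K (L n @ scale (-1) (L m)) (L n @ scale (-1) (L m))"
        using l by (intro cauchy_schwarz) (auto simp: approx_points[OF f])
      also have "\<dots> \<le> qf K l l * e"
        using N[OF n m] qf_nonneg[OF l] by (intro mult_left_mono) auto
      finally show ?thesis by (simp add: qf_append qf_scale)
    qed
    ultimately show "(qf K l (L n) - pair l f)\<^sup>2 \<le> qf K l l * e"
      using LIMSEQ_le_const2 by blast
  qed
qed

text \<open>\<open>L n\<close> moves with n, so the pointwise limits in \<open>approx\<close> are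
  too weak; the uniform estimate is combined with the bound on the energies of
  \<open>L n\<close>.\<close>

lemma approx_difference:
  assumes "approx L f" "approx M g"
  shows "(\<lambda>n. qf K (L n) (M n) - pair (L n) g) \<longlonglongrightarrow> 0"
proof -
  obtain B where B: "B > 0" "\<And>n. qf K (L n) (L n) \<le> B" using approx_bdd[OF assms(1)] by blast
  have "(\<lambda>n. (qf K (L n) (M n) - pair (L n) g)\<^sup>2) \<longlonglongrightarrow> 0"
  proof (rule LIMSEQ_I)
    fix r :: real assume r: "r > 0"
    obtain N where N: "\<And>n l. n \<ge> N \<Longrightarrow> points l \<subseteq> X \<Longrightarrow> (qf K l (M n) - pair l g)\<^sup>2 \<le> qf K l l * (r / (2 * B))"
      using approx_uniform[OF assms(2), of "r / (2 * B)"] r B by (metis divide_pos_pos mult_pos_pos zero_less_numeral)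
    show "\<exists>no. \<forall>n\<ge>no. norm ((qf K (L n) (M n) - pair (L n) g)\<^sup>2 - 0) < r"
    proof (intro exI allI impI)
      fix n assume "n \<ge> N"
      then have "(qf K (L n) (M n) - pair (L n) g)\<^sup>2 \<le> qf K (L n) (L n) * (r / (2 * B))"
        by (intro N approx_points[OF assms(1)])
      also have "\<dots> \<le> B * (r / (2 * B))" using B r by (intro mult_right_mono) auto
      also have "\<dots> < r" using B r by simp
      finally show "norm ((qf K (L n) (M n) - pair (L n) g)\<^sup>2 - 0) < r" by simp
    qed
  qed
  then show ?thesis by simp
qed

lemma approx_convergent:
  assumes f: "approx L f" and g: "approx M g"
  shows "convergent (\<lambda>n. pair (L n) g)"
proof -
  obtain B where B: "B > 0" "\<And>n. qf K (M n) (M n) \<le> B" using approx_bdd[OF g] by blast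
  have bd: "(pair l g)\<^sup>2 \<le> qf K l l * B" if l: "points l \<subseteq> X" for l
  proof (rule LIMSEQ_le_const2[OF tendsto_power[OF approx_pair[OF g l], of 2]])
    have "(qf K l (M n))\<^sup>2 \<le> qf K l l * B" for n
      using cauchy_schwarz[OF l approx_points[OF g, of n]] mult_left_mono[OF B(2)[of n] qf_nonneg[OF l]]
      by linarith
    then show "\<exists>N. \<forall>n\<ge>N. (qf K l (M n))\<^sup>2 \<le> qf K l l * B" by blast
  qed
  have "Cauchy (\<lambda>n. pair (L n) g)"
  proof (rule metric_CauchyI)
    fix e :: real assume e: "e > 0"
    have "e\<^sup>2 / B > 0" using e B by simp
    from approx_cauchy[OF f this] obtain N where
      N: "\<forall>m\<ge>N. \<forall>n\<ge>N. qf K (L m @ scale (-1) (L n)) (L m @ scale (-1) (L n)) < e\<^sup>2 / B" ..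
    show "\<exists>N. \<forall>m\<ge>N. \<forall>n\<ge>N. dist (pair (L m) g) (pair (L n) g) < e"
    proof (intro exI allI impI)
      fix m n assume mn: "m \<ge> N" "n \<ge> N"
      have "(pair (L m @ scale (-1) (L n)) g)\<^sup>2
         \<le> qf K (L m @ scale (-1) (L n)) (L m @ scale (-1) (L n)) * B"
        by (rule bd) (simp add: approx_points[OF f])
      also have "\<dots> < e\<^sup>2" using N mn B by (simp add: pos_less_divide_eq)
      finally have "\<bar>pair (L m @ scale (-1) (L n)) g\<bar> < e"
        using e by (rule abs_less_if_square_less)
      then show "dist (pair (L m) g) (pair (L n) g) < e" by (simp add: dist_real_def)
    qed
  qed
  then show ?thesis by (simp add: Cauchy_convergent_iff)
qed

lemma approx_imp_bounded_by:
  assumes f: "approx L f"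
  shows "\<exists>C. bounded_by f C"
proof -
  obtain B where B: "B > 0" "\<And>n. qf K (L n) (L n) \<le> B" using approx_bdd[OF f] by blast
  have "(pair l f)\<^sup>2 \<le> B * qf K l l" if l: "points l \<subseteq> X" for l
  proof (rule LIMSEQ_le_const2[OF tendsto_power[OF approx_pair[OF f l], of 2]])
    have "(qf K l (L n))\<^sup>2 \<le> B * qf K l l" for n
      using cauchy_schwarz[OF l approx_points[OF f, of n]] mult_left_mono[OF B(2)[of n] qf_nonneg[OF l]]
      by (simp add: mult.commute)
    then show "\<exists>N. \<forall>n\<ge>N. (qf K l (L n))\<^sup>2 \<le> B * qf K l l" by blast
  qed
  then show ?thesis using B by (intro exI[of _ B]) (auto simp: bounded_by_def)
qed

definition space :: "('a \<Rightarrow> real) set" where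
  "space = {f \<in> extensional X. \<exists>C. bounded_by f C}"

definition inner :: "('a \<Rightarrow> real) \<Rightarrow> ('a \<Rightarrow> real) \<Rightarrow> real" where
  "inner f g = lim (\<lambda>n. pair ((SOME L. approx L f) n) g)"

lemma space_approx: "f \<in> space \<Longrightarrow> \<exists>L. approx L f"
  using bounded_by_imp_approx by (auto simp: space_def)

text \<open>The three limits agree, so \<open>inner\<close> is independent of the chosen sequence,
  and symmetry, linearity and positivity can each be read off the most convenient one.\<close>

lemma
  assumes "approx L f" "approx M g"
  shows inner_left: "(\<lambda>n. pair (L n) g) \<longlonglongrightarrow> inner f g"
    and inner_right: "(\<lambda>n. pair (M n) f) \<longlonglongrightarrow> inner f g"
    and inner_both: "(\<lambda>n. qf K (L n) (M n)) \<longlonglongrightarrow> inner f g"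
proof -
  let ?L = "SOME L. approx L f"
  have L0: "approx ?L f" using someI[of "\<lambda>L. approx L f", OF assms(1)] .
  have *: "(\<lambda>n. pair (M n) f) \<longlonglongrightarrow> c \<and> (\<lambda>n. qf K (L n) (M n)) \<longlonglongrightarrow> c"
    if "approx L f" "(\<lambda>n. pair (L n) g) \<longlonglongrightarrow> c" for L c
  proof -
    have 1: "(\<lambda>n. qf K (L n) (M n)) \<longlonglongrightarrow> c"
      using tendsto_add[OF approx_difference[OF that(1) assms(2)] that(2)] by simp
    have "(\<lambda>n. qf K (L n) (M n) - pair (M n) f) \<longlonglongrightarrow> 0"
      using approx_difference[OF assms(2) that(1)]
      by (subst qf_commute) (auto simp: approx_points[OF that(1)] approx_points[OF assms(2)])
    from tendsto_diff[OF 1 this] have "(\<lambda>n. pair (M n) f) \<longlonglongrightarrow> c" by simp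
    with 1 show ?thesis by simp
  qed
  have "(\<lambda>n. pair (?L n) g) \<longlonglongrightarrow> inner f g"
    using approx_convergent[OF L0 assms(2)] by (simp add: inner_def convergent_LIMSEQ_iff)
  with *[OF L0] show r: "(\<lambda>n. pair (M n) f) \<longlonglongrightarrow> inner f g" by blast
  obtain c where c: "(\<lambda>n. pair (L n) g) \<longlonglongrightarrow> c"
    using approx_convergent[OF assms] by (auto simp: convergent_def)
  then have "c = inner f g" using *[OF assms(1) c] r LIMSEQ_unique by blast
  then show "(\<lambda>n. pair (L n) g) \<longlonglongrightarrow> inner f g" "(\<lambda>n. qf K (L n) (M n)) \<longlonglongrightarrow> inner f g"
    using c *[OF assms(1) c] by auto
qed

lemma inner_commute:
  assumes "f \<in> space" "g \<in> space"
  shows "inner f g = inner g f"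
proof -
  obtain L M where "approx L f" "approx M g" using assms space_approx by blast
  then show ?thesis using inner_left inner_right LIMSEQ_unique by blast
qed

lemma bounded_by_inner:
  assumes "f \<in> space"
  shows "bounded_by f (inner f f)"
proof -
  obtain L where L: "approx L f" using assms space_approx by blast
  note lim = inner_both[OF L L]
  have "0 \<le> inner f f"
    by (rule LIMSEQ_le_const[OF lim]) (auto intro!: qf_nonneg approx_points[OF L])
  moreover have "(pair l f)\<^sup>2 \<le> inner f f * qf K l l" if l: "points l \<subseteq> X" for l
    by (rule LIMSEQ_le[OF tendsto_power[OF approx_pair[OF L l]] tendsto_mult_right[OF lim]])
       (use cauchy_schwarz[OF l approx_points[OF L]] in \<open>auto simp: mult.commute\<close>)
  ultimately show ?thesis by (simp add: bounded_by_def)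
qed

text \<open>Testing the bound on the approximating measures of \<open>f\<close> itself gives r^2 <=
  C r for r = \<open>inner f f\<close>.\<close>

lemma inner_le:
  assumes "f \<in> space" "bounded_by f C"
  shows "inner f f \<le> C"
proof -
  obtain L where L: "approx L f" using assms space_approx by blast
  have "(inner f f)\<^sup>2 \<le> C * inner f f"
    by (rule LIMSEQ_le[OF tendsto_power[OF inner_left[OF L L]] tendsto_mult_left[OF inner_both[OF L L]]])
       (use assms(2) approx_points[OF L] in \<open>auto simp: bounded_by_def\<close>)
  moreover have "0 \<le> inner f f" "0 \<le> C" using bounded_by_inner[OF assms(1)] assms(2) by (auto simp: bounded_by_def)
  ultimately show ?thesis by (cases "inner f f = 0") (auto simp: power2_eq_square)
qed

lemma pair_restrict: "points l \<subseteq> X \<Longrightarrow> pair l (restrict f X) = pair l f"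
  by (rule pair_cong) auto

lemma restrict_mem_space:
  assumes "bounded_by f C"
  shows "restrict f X \<in> space"
  using assms by (auto simp: space_def bounded_by_def pair_restrict cong: conj_cong intro!: exI[of _ C])

lemma space_add:
  assumes "f \<in> space" "g \<in> space"
  shows "(\<lambda>x\<in>X. f x + g x) \<in> space"
proof -
  obtain C D where "bounded_by f C" "bounded_by g D" using assms by (auto simp: space_def)
  moreover have "(a + b)\<^sup>2 \<le> 2 * a\<^sup>2 + 2 * b\<^sup>2" for a b :: real
    using zero_le_power2[of "a - b"] unfolding power2_diff power2_sum by linarith
  ultimately have "bounded_by (\<lambda>x. f x + g x) (2 * C + 2 * D)"
    unfolding bounded_by_def pair_add by (smt (verit, ccfv_SIG) distrib_right mult.assoc)
  then show ?thesis by (rule restrict_mem_space)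
qed

lemma space_scale:
  assumes "f \<in> space"
  shows "(\<lambda>x\<in>X. c * f x) \<in> space"
proof -
  obtain C where "bounded_by f C" using assms by (auto simp: space_def)
  then have "bounded_by (\<lambda>x. c * f x) (c\<^sup>2 * C)"
    unfolding bounded_by_def pair_cmult power_mult_distrib by (auto simp: mult.assoc intro!: mult_left_mono)
  then show ?thesis by (rule restrict_mem_space)
qed

lemma space_diff:
  assumes "f \<in> space" "g \<in> space"
  shows "(\<lambda>x\<in>X. f x - g x) \<in> space"
proof -
  have "(\<lambda>x\<in>X. f x + (\<lambda>x\<in>X. (-1) * g x) x) = (\<lambda>x\<in>X. f x - g x)"
    by (simp add: restrict_def fun_eq_iff)
  then show ?thesis using space_add[OF assms(1) space_scale[OF assms(2), of "-1"]] by metis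
qed

lemma kernel_approx:
  assumes "y \<in> X"
  shows "approx (\<lambda>n. [(1, y)]) (\<lambda>x\<in>X. K x y)"
  using assms by (auto simp: approx_def qf_def)

lemma point_eval_bound:
  assumes "f \<in> space" "x \<in> X"
  shows "(f x)\<^sup>2 \<le> inner f f * K x x"
  using bounded_by_inner[OF assms(1)] assms(2) unfolding bounded_by_def
  by (elim conjE allE[of _ "[(1, x)]"]) (simp add: qf_def)

text \<open>Point evaluation is the measure \<open>[(1, x)]\<close>, so a Cauchy sequence converges
  pointwise; each bound on mu(F n - F m) survives m -> infinity because mu is fixed and has finite
  support.\<close>

lemma space_complete:
  assumes F: "\<And>n. F n \<in> space"
    and cauchy: "\<forall>e>0. \<exists>N::nat. \<forall>m\<ge>N. \<forall>n\<ge>N.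
          sqrt (inner (\<lambda>x\<in>X. F m x - F n x) (\<lambda>x\<in>X. F m x - F n x)) < e"
  shows "\<exists>f\<in>space. (\<lambda>n. sqrt (inner (\<lambda>x\<in>X. F n x - f x) (\<lambda>x\<in>X. F n x - f x))) \<longlonglongrightarrow> 0"
proof -
  have near: "\<exists>N. \<forall>m\<ge>N. \<forall>n\<ge>N. \<forall>l. points l \<subseteq> X \<longrightarrow> (pair l (F m) - pair l (F n))\<^sup>2 \<le> e * qf K l l"
    if e: "e > 0" for e
  proof -
    obtain N where N: "\<And>m n. m \<ge> N \<Longrightarrow> n \<ge> N \<Longrightarrow>
        sqrt (inner (\<lambda>x\<in>X. F m x - F n x) (\<lambda>x\<in>X. F m x - F n x)) < sqrt e"
      using cauchy e by (meson real_sqrt_gt_zero)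
    show ?thesis
    proof (intro exI allI impI)
      fix m n l assume mn: "m \<ge> N" "n \<ge> N" and l: "points l \<subseteq> X"
      let ?g = "\<lambda>x\<in>X. F m x - F n x"
      have "(pair l ?g)\<^sup>2 \<le> inner ?g ?g * qf K l l"
        using bounded_by_inner[OF space_diff[OF F F]] l by (auto simp: bounded_by_def)
      also have "\<dots> \<le> e * qf K l l"
        using N[OF mn] qf_nonneg[OF l] by (intro mult_right_mono) auto
      finally show "(pair l (F m) - pair l (F n))\<^sup>2 \<le> e * qf K l l"
        by (simp add: pair_restrict[OF l] pair_diff)
    qed
  qed
  define f where "f = (\<lambda>x\<in>X. lim (\<lambda>n. F n x))"
  have lim: "(\<lambda>n. F n x) \<longlonglongrightarrow> f x" if x: "x \<in> X" for x
  proof -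
    have "Cauchy (\<lambda>n. F n x)"
    proof (rule metric_CauchyI)
      fix e :: real assume e: "e > 0"
      have K: "K x x \<ge> 0" using qf_nonneg[of "[(1, x)]"] x by (simp add: qf_def)
      \<comment> \<open>The summand 1 keeps the quotient defined when \<open>K x x\<close> =
        0.\<close>
      define d where "d = e\<^sup>2 / (K x x + 1)"
      have d: "d > 0" using e K by (simp add: d_def)
      obtain N where N: "\<And>m n l. m \<ge> N \<Longrightarrow> n \<ge> N \<Longrightarrow> points l \<subseteq> X \<Longrightarrow> (pair l (F m) - pair l (F n))\<^sup>2 \<le> d * qf K l l"
        using near[OF d] by blast
      show "\<exists>N. \<forall>m\<ge>N. \<forall>n\<ge>N. dist (F m x) (F n x) < e"
      proof (intro exI allI impI)
        fix m n assume "m \<ge> N" "n \<ge> N"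
        then have "(F m x - F n x)\<^sup>2 \<le> d * K x x"
          using N[of m n "[(1, x)]"] x by (simp add: qf_def)
        also have "\<dots> < d * (K x x + 1)" using d by simp
        also have "\<dots> = e\<^sup>2" using K by (simp add: d_def)
        finally have "\<bar>F m x - F n x\<bar> < e"
          using e by (rule abs_less_if_square_less)
        then show "dist (F m x) (F n x) < e" by (simp add: dist_real_def)
      qed
    qed
    then show ?thesis using x by (simp add: f_def Cauchy_convergent_iff convergent_LIMSEQ_iff)
  qed
  have limit: "\<exists>N. \<forall>n\<ge>N. bounded_by (\<lambda>x\<in>X. F n x - f x) e" if e: "e > 0" for e
  proof -
    obtain N where N: "\<And>m n l. m \<ge> N \<Longrightarrow> n \<ge> N \<Longrightarrow> points l \<subseteq> X \<Longrightarrow> (pair l (F m) - pair l (F n))\<^sup>2 \<le> e * qf K l l"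
      using near[OF e] by blast
    have "(pair l (F n) - pair l f)\<^sup>2 \<le> e * qf K l l" if n: "n \<ge> N" and l: "points l \<subseteq> X" for n l
    proof (rule LIMSEQ_le_const2)
      show "(\<lambda>m. (pair l (F n) - pair l (F m))\<^sup>2) \<longlonglongrightarrow> (pair l (F n) - pair l f)\<^sup>2"
        using l by (intro tendsto_intros tendsto_pair lim) auto
      show "\<exists>M. \<forall>m\<ge>M. (pair l (F n) - pair l (F m))\<^sup>2 \<le> e * qf K l l"
        using N n l by blast
    qed
    then show ?thesis using e by (auto simp: bounded_by_def pair_restrict pair_diff)
  qed
  have f: "f \<in> space"
  proof -
    obtain N where "bounded_by (\<lambda>x\<in>X. F N x - f x) 1" using limit[of 1] by auto
    then have "(\<lambda>x\<in>X. F N x - f x) \<in> space" by (auto simp: space_def)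
    from space_diff[OF F[of N] this] have "(\<lambda>x\<in>X. F N x - (\<lambda>x\<in>X. F N x - f x) x) \<in> space" .
    also have "(\<lambda>x\<in>X. F N x - (\<lambda>x\<in>X. F N x - f x) x) = f"
      by (auto simp: f_def fun_eq_iff)
    finally show ?thesis .
  qed
  have "(\<lambda>n. sqrt (inner (\<lambda>x\<in>X. F n x - f x) (\<lambda>x\<in>X. F n x - f x))) \<longlonglongrightarrow> 0"
  proof (rule LIMSEQ_I)
    fix r :: real assume r: "r > 0"
    obtain N where N: "\<And>n. n \<ge> N \<Longrightarrow> bounded_by (\<lambda>x\<in>X. F n x - f x) ((r/2)\<^sup>2)"
      using limit[of "(r/2)\<^sup>2"] r by auto
    show "\<exists>no. \<forall>n\<ge>no. norm (sqrt (inner (\<lambda>x\<in>X. F n x - f x) (\<lambda>x\<in>X. F n x - f x)) - 0) < r"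
    proof (intro exI allI impI)
      fix n assume n: "n \<ge> N"
      let ?g = "\<lambda>x\<in>X. F n x - f x"
      have "inner ?g ?g \<le> (r/2)\<^sup>2" by (rule inner_le[OF space_diff[OF F f] N[OF n]])
      then have "sqrt (inner ?g ?g) \<le> r/2" using r by (metis less_imp_le half_gt_zero real_sqrt_le_iff real_sqrt_unique)
      moreover have "0 \<le> inner ?g ?g"
        using bounded_by_inner[OF space_diff[OF F f]] by (auto simp: bounded_by_def)
      ultimately show "norm (sqrt (inner ?g ?g) - 0) < r" using r by simp
    qed
  qed
  then show ?thesis using f by blast
qed

theorem moore_aronszajn: "rkhs X K space inner"
proof
  show "space \<subseteq> extensional X" by (auto simp: space_def)
  have "pair l (\<lambda>x. 0) = 0" for l :: "(real \<times> 'a) list" using pair_cmult[of l 0] by simp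
  then have "bounded_by (\<lambda>x. 0) 0" by (simp add: bounded_by_def)
  then show "(\<lambda>x\<in>X. 0) \<in> space" by (rule restrict_mem_space)
  show "(\<lambda>x\<in>X. f x + g x) \<in> space" if "f \<in> space" "g \<in> space" for f g
    using that by (rule space_add)
  show "(\<lambda>x\<in>X. c * f x) \<in> space" if "f \<in> space" for f c
    using that by (rule space_scale)
  show "inner f g = inner g f" if "f \<in> space" "g \<in> space" for f g
    using that by (rule inner_commute)
  show "inner (\<lambda>x\<in>X. f x + g x) h = inner f h + inner g h"
    if fgh: "f \<in> space" "g \<in> space" "h \<in> space" for f g h
  proof -
    obtain L M N P where L: "approx L f" "approx M g" "approx N h" "approx P (\<lambda>x\<in>X. f x + g x)"
      using space_approx[OF fgh(1)] space_approx[OF fgh(2)] space_approx[OF fgh(3)]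
        space_approx[OF space_add[OF fgh(1,2)]] by auto
    have "(\<lambda>n. pair (N n) (\<lambda>x\<in>X. f x + g x)) \<longlonglongrightarrow> inner f h + inner g h"
      using tendsto_add[OF inner_right[OF L(1,3)] inner_right[OF L(2,3)]]
      by (simp add: pair_restrict approx_points[OF L(3)] pair_add)
    then show ?thesis using inner_right[OF L(4,3)] LIMSEQ_unique by blast
  qed
  show "inner (\<lambda>x\<in>X. c * f x) g = c * inner f g" if fg: "f \<in> space" "g \<in> space" for f g c
  proof -
    obtain L M P where L: "approx L f" "approx M g" "approx P (\<lambda>x\<in>X. c * f x)"
      using space_approx[OF fg(1)] space_approx[OF fg(2)] space_approx[OF space_scale[OF fg(1), of c]] by auto
    have "(\<lambda>n. pair (M n) (\<lambda>x\<in>X. c * f x)) \<longlonglongrightarrow> c * inner f g"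
      using tendsto_mult_left[OF inner_right[OF L(1,2)]]
      by (simp add: pair_restrict approx_points[OF L(2)] pair_cmult)
    then show ?thesis using inner_right[OF L(3,2)] LIMSEQ_unique by blast
  qed
  show "0 \<le> inner f f" if "f \<in> space" for f
    using bounded_by_inner[OF that] by (simp add: bounded_by_def)
  show "f = (\<lambda>x\<in>X. 0)" if f: "f \<in> space" "inner f f = 0" for f
  proof -
    have "f x = 0" if "x \<in> X" for x using point_eval_bound[OF f(1) that] f(2) by simp
    then show ?thesis using f(1) by (auto simp: space_def extensional_def fun_eq_iff)
  qed
  show "(\<lambda>x\<in>X. K x y) \<in> space" if "y \<in> X" for y
    using approx_imp_bounded_by[OF kernel_approx[OF that]] by (simp add: space_def)
  show "inner f (\<lambda>x\<in>X. K x y) = f y" if f: "f \<in> space" and y: "y \<in> X" for f y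
  proof -
    obtain L where "approx L f" using f space_approx by blast
    from inner_right[OF this kernel_approx[OF y]] show ?thesis by (simp add: LIMSEQ_const_iff)
  qed
qed (rule space_complete)

end

section \<open>Uniqueness: every realisation of a kernel is the space constructed above\<close>

context rkhs
begin

definition span :: "(real \<times> 'a) list \<Rightarrow> 'a \<Rightarrow> real" where
  "span l = (\<lambda>x\<in>X. pair l (K x))"

lemma span_Cons: "span ((c, y) # l) = (\<lambda>x\<in>X. (\<lambda>x\<in>X. c * (\<lambda>x\<in>X. K x y) x) x + span l x)"
  by (simp add: span_def restrict_def fun_eq_iff)

lemma span_mem: "points l \<subseteq> X \<Longrightarrow> span l \<in> H"
proof (induction l)
  case Nil
  have "span [] = (\<lambda>x\<in>X. 0)" by (simp add: span_def)
  then show ?case using zero_mem by metis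
next
  case (Cons p l)
  then show ?case
    by (cases p) (auto simp: span_Cons simp del: restrict_apply intro!: add_mem scale_mem kernel_mem)
qed

lemma ip_span: "f \<in> H \<Longrightarrow> points l \<subseteq> X \<Longrightarrow> ip (span l) f = pair l f"
proof (induction l)
  case Nil
  have "(\<lambda>x\<in>X. 0 * f x) = span []" by (simp add: span_def)
  then show ?case using ip_scale[OF Nil(1) Nil(1), of 0] by simp
next
  case (Cons p l)
  obtain c y where p: "p = (c, y)" by (cases p)
  have y: "y \<in> X" and l: "points l \<subseteq> X" using Cons p by auto
  note k = kernel_mem[OF y]
  have "ip (span (p # l)) f = ip (\<lambda>x\<in>X. c * (\<lambda>x\<in>X. K x y) x) f + ip (span l) f"
    unfolding p span_Cons by (rule ip_add[OF scale_mem[OF k] span_mem[OF l] Cons(2)])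
  also have "ip (\<lambda>x\<in>X. c * (\<lambda>x\<in>X. K x y) x) f = c * f y"
    using ip_scale[OF k Cons(2)] ip_commute[OF k Cons(2)] reproducing[OF Cons(2) y] by simp
  finally show ?case using Cons.IH[OF Cons(2) l] p by simp
qed

lemma ip_span_span:
  assumes "points l \<subseteq> X" "points m \<subseteq> X"
  shows "ip (span l) (span m) = qf K l m"
  unfolding ip_span[OF span_mem[OF assms(2)] assms(1)] qf_def
  by (rule pair_cong) (use assms in \<open>auto simp: span_def\<close>)

lemma ip_line:
  assumes "f \<in> H" "g \<in> H"
  shows "ip (\<lambda>x\<in>X. f x + s * g x) (\<lambda>x\<in>X. f x + s * g x) = ip g g * s\<^sup>2 + 2 * ip f g * s + ip f f"
proof -
  let ?g = "\<lambda>x\<in>X. s * g x"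
  note sg = scale_mem[OF assms(2), of s]
  have sum: "(\<lambda>x\<in>X. f x + s * g x) = (\<lambda>x\<in>X. f x + ?g x)" by (simp add: restrict_def fun_eq_iff)
  have "ip (\<lambda>x\<in>X. f x + ?g x) h = ip f h + s * ip g h" if h: "h \<in> H" for h
    using ip_add[OF assms(1) sg h] ip_scale[OF assms(2) h, of s] by simp
  note step = this
  define c where "c = (\<lambda>x\<in>X. f x + ?g x)"
  have c: "c \<in> H" unfolding c_def by (rule add_mem[OF assms(1) sg])
  have "ip c c = ip c f + s * ip c g"
    using step[OF c, folded c_def] ip_commute[OF assms(1) c] ip_commute[OF assms(2) c] by simp
  also have "\<dots> = ip g g * s\<^sup>2 + 2 * ip f g * s + ip f f"
    using step[OF assms(1), folded c_def] step[OF assms(2), folded c_def] ip_commute[OF assms]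
    by (simp add: power2_eq_square algebra_simps)
  finally show ?thesis unfolding sum c_def .
qed

lemma diff_mem:
  assumes "f \<in> H" "g \<in> H"
  shows "(\<lambda>x\<in>X. f x - g x) \<in> H"
proof -
  have "(\<lambda>x\<in>X. f x + (\<lambda>x\<in>X. (-1) * g x) x) = (\<lambda>x\<in>X. f x - g x)"
    by (simp add: restrict_def fun_eq_iff)
  then show ?thesis using add_mem[OF assms(1) scale_mem[OF assms(2), of "-1"]] by metis
qed

lemma ip_cauchy_schwarz:
  assumes "f \<in> H" "g \<in> H"
  shows "(ip f g)\<^sup>2 \<le> ip g g * ip f f"
proof (rule discriminant_le)
  fix s
  have "(\<lambda>x\<in>X. f x + s * g x) = (\<lambda>x\<in>X. f x + (\<lambda>x\<in>X. s * g x) x)"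
    by (simp add: restrict_def fun_eq_iff)
  then have "(\<lambda>x\<in>X. f x + s * g x) \<in> H" using add_mem[OF assms(1) scale_mem[OF assms(2)]] by simp
  from ip_nonneg[OF this] show "0 \<le> ip g g * s\<^sup>2 + 2 * ip f g * s + ip f f"
    by (simp add: ip_line assms)
qed (rule ip_nonneg[OF assms(2)])

lemma kernel_psd: "psd_kernel X K"
proof
  show "K x y = K y x" if "x \<in> X" "y \<in> X" for x y
    using reproducing[OF kernel_mem that(2), OF that(1)] reproducing[OF kernel_mem that(1), OF that(2)]
      ip_commute[OF kernel_mem kernel_mem, OF that] that by simp
  show "psd X K"
    unfolding psd_def using ip_span_span ip_nonneg span_mem by metis
qed

sublocale psd_kernel X K by (rule kernel_psd)

lemma mem_bounded_by:
  assumes "f \<in> H"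
  shows "bounded_by f (ip f f)"
  unfolding bounded_by_def
proof (intro conjI allI impI)
  fix l :: "(real \<times> 'a) list" assume l: "points l \<subseteq> X"
  show "(pair l f)\<^sup>2 \<le> ip f f * qf K l l"
    using ip_cauchy_schwarz[OF span_mem[OF l] assms] by (simp add: ip_span ip_span_span assms l)
qed (rule ip_nonneg[OF assms])

text \<open>The spans of \<open>L n\<close> are Cauchy in \<open>H\<close>, so completeness yields a
  limit in \<open>H\<close>; the reproducing property turns norm convergence into pointwise
  convergence, which identifies that limit with \<open>f\<close>.\<close>

lemma approx_mem:
  assumes L: "approx L f" and f: "f \<in> extensional X"
  shows "f \<in> H" and "ip f f = inner f f"
proof -
  note p = approx_points[OF L]
  define N where "N f = sqrt (ip f f)" for f
  have "ip (\<lambda>x\<in>X. span (L m) x - span (L n) x) (\<lambda>x\<in>X. span (L m) x - span (L n) x)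
      = qf K (L m @ scale (-1) (L n)) (L m @ scale (-1) (L n))" for m n
  proof -
    have "(\<lambda>x\<in>X. span (L m) x - span (L n) x) = span (L m @ scale (-1) (L n))"
      by (simp add: span_def restrict_def fun_eq_iff)
    then show ?thesis by (simp add: ip_span_span p)
  qed
  then have "\<forall>e>0. \<exists>N::nat. \<forall>m\<ge>N. \<forall>n\<ge>N.
          sqrt (ip (\<lambda>x\<in>X. span (L m) x - span (L n) x) (\<lambda>x\<in>X. span (L m) x - span (L n) x)) < e"
    using approx_cauchy[OF L, of "e\<^sup>2" for e] by (metis real_sqrt_less_iff real_sqrt_abs zero_less_power abs_of_pos)
  from complete[OF span_mem[OF p] this] obtain g where g: "g \<in> H"
    and lim: "(\<lambda>n. sqrt (ip (\<lambda>x\<in>X. span (L n) x - g x) (\<lambda>x\<in>X. span (L n) x - g x))) \<longlonglongrightarrow> 0"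
    by blast
  define d where "d n = (\<lambda>x\<in>X. span (L n) x - g x)" for n
  have d: "d n \<in> H" for n unfolding d_def by (rule diff_mem[OF span_mem[OF p] g])
  from tendsto_power[OF lim[folded d_def], of 2]
  have lim: "(\<lambda>n. ip (d n) (d n)) \<longlonglongrightarrow> 0" using ip_nonneg[OF d] by simp
  have weak: "(\<lambda>n. ip (d n) h) \<longlonglongrightarrow> 0" if h: "h \<in> H" for h
  proof -
    have "(\<lambda>n. (ip (d n) h)\<^sup>2) \<longlonglongrightarrow> 0"
    proof (rule tendsto_sandwich[OF _ _ tendsto_const tendsto_mult_right_zero[OF lim, of "ip h h"]])
      show "\<forall>\<^sub>F n in sequentially. (ip (d n) h)\<^sup>2 \<le> ip h h * ip (d n) (d n)"
        using ip_cauchy_schwarz[OF d h] by simp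
    qed simp
    then show ?thesis by simp
  qed
  have "f x = g x" if x: "x \<in> X" for x
  proof -
    have "(\<lambda>n. span (L n) x - g x) \<longlonglongrightarrow> 0"
      using weak[OF kernel_mem[OF x]] reproducing[OF d x] x by (simp add: d_def)
    then have "(\<lambda>n. span (L n) x) \<longlonglongrightarrow> g x" by (simp add: LIM_zero_iff)
    moreover have "(\<lambda>n. span (L n) x) \<longlonglongrightarrow> f x" using L x by (simp add: approx_def span_def)
    ultimately show ?thesis using LIMSEQ_unique by blast
  qed
  then have fg: "f = g" using f carrier g by (intro extensionalityI[of f X g]) auto
  then show fH: "f \<in> H" using g by simp
  have "ip (d n) f = pair (L n) f - ip f f" for n
  proof -
    have "d n = (\<lambda>x\<in>X. span (L n) x + (\<lambda>x\<in>X. (-1) * f x) x)"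
      using fg by (simp add: d_def restrict_def fun_eq_iff)
    then have "ip (d n) f = ip (span (L n)) f + ip (\<lambda>x\<in>X. (-1) * f x) f"
      using ip_add[OF span_mem[OF p] scale_mem[OF fH] fH] by metis
    also have "\<dots> = pair (L n) f - ip f f"
      unfolding ip_scale[OF fH fH] ip_span[OF fH p] by simp
    finally show ?thesis .
  qed
  with weak[OF fH] have "(\<lambda>n. pair (L n) f) \<longlonglongrightarrow> ip f f" by (simp add: LIM_zero_iff)
  then show "ip f f = inner f f" using inner_left[OF L L] LIMSEQ_unique by blast
qed

lemma carrier_eq_space: "H = space"
proof
  show "H \<subseteq> space" using mem_bounded_by carrier by (auto simp: space_def)
  show "space \<subseteq> H" using space_approx approx_mem(1) by (auto simp: space_def)
qed

lemma ip_eq_inner: "f \<in> H \<Longrightarrow> ip f f = inner f f"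
  using space_approx approx_mem(2) carrier by (metis carrier_eq_space subsetD)

end

context psd_kernel
begin

lemma rkhs_space_eq: "rkhs_space X K = space"
  unfolding rkhs_space_def
proof (rule the_equality)
  show "\<exists>ip. rkhs X K space ip" using moore_aronszajn by (rule exI[of _ inner])
  show "H = space" if "\<exists>ip. rkhs X K H ip" for H
    using that by (elim exE) (rule rkhs.carrier_eq_space)
qed

lemma rkhs_norm_eq:
  assumes "f \<in> space"
  shows "rkhs_norm X K f = sqrt (inner f f)"
  unfolding rkhs_norm_def
proof (rule the_equality)
  show "\<exists>H ip. rkhs X K H ip \<and> f \<in> H \<and> sqrt (inner f f) = sqrt (ip f f)"
    using moore_aronszajn assms by (intro exI[of _ space] exI[of _ inner] conjI refl)
  show "r = sqrt (inner f f)" if "\<exists>H ip. rkhs X K H ip \<and> f \<in> H \<and> r = sqrt (ip f f)" for r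
    using that by (elim exE conjE) (simp add: rkhs.ip_eq_inner)
qed

end

section \<open>Domination of kernels gives embedding of spaces\<close>

lemma psd_cmult_diff_iff:
  "psd X (\<lambda>x y. C * K2 x y - K1 x y) \<longleftrightarrow> (\<forall>l. points l \<subseteq> X \<longrightarrow> qf K1 l l \<le> C * qf K2 l l)"
  by (simp add: psd_def qf_def pair_diff pair_cmult)

text \<open>A bound D for \<open>f\<close> against \<open>K1\<close> is the bound D C against
  \<open>K2\<close>. This gives the inclusion, and since squared norms are least bounds, the norms
  compare with factor sqrt C.\<close>

lemma continuously_embeddedI:
  assumes "psd_kernel X K1" "psd_kernel X K2"
    and C: "0 < C" "psd X (\<lambda>x y. C * K2 x y - K1 x y)"
  shows "continuously_embedded X K1 K2"
proof -
  interpret A: psd_kernel X K1 by fact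
  interpret B: psd_kernel X K2 by fact
  have le: "qf K1 l l \<le> C * qf K2 l l" if "points l \<subseteq> X" for l
    using C(2) that by (simp add: psd_cmult_diff_iff)
  have bd: "B.bounded_by f (D * C)" if "A.bounded_by f D" for f D
    unfolding B.bounded_by_def
  proof (intro conjI allI impI)
    show "0 \<le> D * C" using that C by (simp add: A.bounded_by_def)
    fix l :: "(real \<times> 'a) list" assume l: "points l \<subseteq> X"
    have "(pair l f)\<^sup>2 \<le> D * qf K1 l l" "0 \<le> D" using that l by (auto simp: A.bounded_by_def)
    with mult_left_mono[OF le[OF l], of D] show "(pair l f)\<^sup>2 \<le> D * C * qf K2 l l"
      by (simp add: mult.assoc)
  qed
  have sub: "A.space \<subseteq> B.space" using bd by (auto simp: A.space_def B.space_def)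
  have "rkhs_norm X K2 f \<le> sqrt C * rkhs_norm X K1 f" if f: "f \<in> A.space" for f
  proof -
    have "B.inner f f \<le> A.inner f f * C"
      using f sub by (intro B.inner_le bd A.bounded_by_inner) auto
    then have "sqrt (B.inner f f) \<le> sqrt (A.inner f f * C)" by (rule real_sqrt_le_mono)
    then show ?thesis
      using f sub by (simp add: A.rkhs_norm_eq B.rkhs_norm_eq subset_iff real_sqrt_mult mult.commute)
  qed
  then show ?thesis
    unfolding continuously_embedded_def reproducing_kernel_def A.rkhs_space_eq B.rkhs_space_eq
    using A.moore_aronszajn B.moore_aronszajn sub C(1) by (meson real_sqrt_gt_zero)
qed

section \<open>Schur multipliers and weighted product kernels\<close>

text \<open>Schur's product theorem turned into a property. For the kernels at hand it is read off
  an expansion into rank one kernels, for which it only reweights the measure.\<close>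

definition schur :: "'a set \<Rightarrow> ('a \<Rightarrow> 'a \<Rightarrow> real) \<Rightarrow> bool" where
  "schur X k \<longleftrightarrow> (\<forall>P. psd X P \<longrightarrow> psd X (\<lambda>x y. P x y * k x y))"

lemma qf_add: "qf (\<lambda>x y. P x y + Q x y) l m = qf P l m + qf Q l m"
  and qf_cmult: "qf (\<lambda>x y. c * P x y) l m = c * qf P l m"
  by (simp_all add: qf_def pair_add pair_cmult)

lemma qf_sum: "qf (\<lambda>x y. \<Sum>i\<in>I. P i x y) l m = (\<Sum>i\<in>I. qf (P i) l m)"
  by (simp add: qf_def pair_sum)

lemma qf_rank_one: "qf (\<lambda>x y. f x * f y) l l = (pair l f)\<^sup>2"
  by (simp add: qf_def pair_cmult pair_multc power2_eq_square)

lemma psd_add: "psd X P \<Longrightarrow> psd X Q \<Longrightarrow> psd X (\<lambda>x y. P x y + Q x y)"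
  by (simp add: psd_def qf_add)

lemma psd_cmult: "psd X P \<Longrightarrow> 0 \<le> c \<Longrightarrow> psd X (\<lambda>x y. c * P x y)"
  by (simp add: psd_def qf_cmult)

lemma psd_sum: "(\<And>i. i \<in> I \<Longrightarrow> psd X (P i)) \<Longrightarrow> psd X (\<lambda>x y. \<Sum>i\<in>I. P i x y)"
  by (auto simp: psd_def qf_sum intro: sum_nonneg)

lemma psd_rank_one: "psd X (\<lambda>x y. f x * f y)"
  by (simp add: psd_def qf_rank_one)

lemma psd_one: "psd X (\<lambda>x y. 1)"
  using psd_rank_one[of X "\<lambda>x. 1"] by simp

lemma qf_cong:
  assumes "points l \<subseteq> X" "points m \<subseteq> X" "\<And>x y. x \<in> X \<Longrightarrow> y \<in> X \<Longrightarrow> P x y = Q x y"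
  shows "qf P l m = qf Q l m"
  unfolding qf_def using assms by (intro pair_cong) auto

lemma psd_cong:
  assumes "\<And>x y. x \<in> X \<Longrightarrow> y \<in> X \<Longrightarrow> P x y = Q x y" "psd X P"
  shows "psd X Q"
  unfolding psd_def
proof (intro allI impI)
  fix l :: "(real \<times> 'a) list" assume l: "points l \<subseteq> X"
  have "qf P l l = qf Q l l" using l l assms(1) by (rule qf_cong)
  then show "0 \<le> qf Q l l" using assms(2) l unfolding psd_def by metis
qed

lemma psd_LIMSEQ:
  assumes "\<And>n. psd X (P n)" "\<And>x y. x \<in> X \<Longrightarrow> y \<in> X \<Longrightarrow> (\<lambda>n. P n x y) \<longlonglongrightarrow> Q x y"
  shows "psd X Q"
  unfolding psd_def
proof (intro allI impI)
  fix l :: "(real \<times> 'a) list" assume l: "points l \<subseteq> X"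
  have "(\<lambda>n. qf (P n) l l) \<longlonglongrightarrow> qf Q l l"
    unfolding qf_def using l assms(2) by (intro tendsto_pair) auto
  then show "0 \<le> qf Q l l"
    by (rule LIMSEQ_le_const) (use assms(1) l in \<open>auto simp: psd_def\<close>)
qed

lemma psd_pullback:
  assumes "psd X k" "p ` Y \<subseteq> X"
  shows "psd Y (\<lambda>x y. k (p x) (p y))"
  unfolding psd_def
proof (intro allI impI)
  fix l assume l: "points l \<subseteq> Y"
  define push where "push l = map (\<lambda>(c :: real, x). (c, p x)) l" for l
  have push: "pair (push l) f = pair l (\<lambda>x. f (p x))" for l f
    by (induction l) (auto simp: push_def)
  have "points (push l) = p ` points l" for l by (induction l) (auto simp: push_def)
  then have "points (push l) \<subseteq> X" using l assms(2) by blast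
  then have "0 \<le> qf k (push l) (push l)" using assms(1) by (simp add: psd_def)
  then show "0 \<le> qf (\<lambda>x y. k (p x) (p y)) l l" by (simp add: qf_def push)
qed

text \<open>The factors f x and f y are absorbed into the masses, replacing c at x by c
  f(x).\<close>

lemma psd_mult_rank_one:
  assumes "psd X P"
  shows "psd X (\<lambda>x y. P x y * (f x * f y))"
  unfolding psd_def
proof (intro allI impI)
  fix l assume l: "points l \<subseteq> X"
  define tilt where "tilt l = map (\<lambda>(c, x). (c * f x, x)) l" for l
  have tilt: "pair (tilt l) g = pair l (\<lambda>x. f x * g x)" for l g
    by (induction l) (auto simp: tilt_def)
  have "points (tilt l) \<subseteq> X" using l by (force simp: points_def tilt_def)
  then have "0 \<le> qf P (tilt l) (tilt l)" using assms by (simp add: psd_def)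
  then show "0 \<le> qf (\<lambda>x y. P x y * (f x * f y)) l l"
    by (simp add: qf_def tilt flip: pair_cmult) (simp add: algebra_simps)
qed

lemma schur_imp_psd: "schur X k \<Longrightarrow> psd X k"
  using psd_one[of X] unfolding schur_def by fastforce

lemma schur_add: "schur X k \<Longrightarrow> schur X k' \<Longrightarrow> schur X (\<lambda>x y. k x y + k' x y)"
  by (simp add: schur_def distrib_left psd_add)

lemma schur_cmult: "schur X k \<Longrightarrow> 0 \<le> c \<Longrightarrow> schur X (\<lambda>x y. c * k x y)"
  by (simp add: schur_def mult.left_commute[of _ c] psd_cmult)

lemma schur_mult: "schur X k \<Longrightarrow> schur X k' \<Longrightarrow> schur X (\<lambda>x y. k x y * k' x y)"
  by (simp add: schur_def flip: mult.assoc)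

lemma schur_one: "schur X (\<lambda>x y. 1)"
  by (simp add: schur_def)

lemma schur_prod:
  assumes "finite u" "\<And>j. j \<in> u \<Longrightarrow> schur X (k j)"
  shows "schur X (\<lambda>x y. \<Prod>j\<in>u. k j x y)"
  using assms by (induction u rule: finite_induct) (simp_all add: schur_one schur_mult)

lemma schur_sum_rank_one:
  "schur X (\<lambda>x y. \<Sum>i\<in>I. f i x * f i y)"
  unfolding schur_def sum_distrib_left by (auto intro!: psd_sum psd_mult_rank_one)

text \<open>Pointwise convergence suffices, since each test of positivity involves finitely many
  points.\<close>

lemma schur_sums:
  assumes "\<And>x y. x \<in> X \<Longrightarrow> y \<in> X \<Longrightarrow> (\<lambda>n. f n x * f n y) sums k x y"
  shows "schur X k"
  unfolding schur_def
proof (intro allI impI)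
  fix P :: "'a \<Rightarrow> 'a \<Rightarrow> real" assume P: "psd X P"
  show "psd X (\<lambda>x y. P x y * k x y)"
  proof (rule psd_LIMSEQ)
    show "psd X (\<lambda>x y. P x y * (\<Sum>i<n. f i x * f i y))" for n
      using schur_sum_rank_one[where I = "{..<n}" and X = X and f = f] P by (simp add: schur_def)
    show "(\<lambda>n. P x y * (\<Sum>i<n. f i x * f i y)) \<longlonglongrightarrow> P x y * k x y" if "x \<in> X" "y \<in> X" for x y
      using assms[OF that] unfolding sums_def by (rule tendsto_mult_left)
  qed
qed

text \<open>Induction by C^(k+1) B b - A a = (C^k B - A) a + C^k (C b - a) B, with A and B the
  products over \<open>u\<close> and k = \<open>card u\<close>; both summands are psd because a and
  B are Schur multipliers.\<close>

lemma psd_prod_diff: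
  assumes "finite u" "0 \<le> C"
    and "\<And>j. j \<in> u \<Longrightarrow> schur X (a j)" "\<And>j. j \<in> u \<Longrightarrow> schur X (b j)"
    and "\<And>j. j \<in> u \<Longrightarrow> psd X (\<lambda>x y. C * b j x y - a j x y)"
  shows "psd X (\<lambda>x y. C ^ card u * (\<Prod>j\<in>u. b j x y) - (\<Prod>j\<in>u. a j x y))"
  using assms(1,3-)
proof (induction u rule: finite_induct)
  case empty
  then show ?case using psd_cmult[OF psd_one, of 0] by simp
next
  case (insert j u)
  have 1: "psd X (\<lambda>x y. (C ^ card u * (\<Prod>j\<in>u. b j x y) - (\<Prod>j\<in>u. a j x y)) * a j x y)"
    using insert.IH insert.prems by (simp add: schur_def)
  have "schur X (\<lambda>x y. \<Prod>j\<in>u. b j x y)" using insert by (intro schur_prod) auto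
  then have "psd X (\<lambda>x y. (C * b j x y - a j x y) * (\<Prod>j\<in>u. b j x y))"
    using insert.prems by (simp add: schur_def)
  then have 2: "psd X (\<lambda>x y. C ^ card u * ((C * b j x y - a j x y) * (\<Prod>j\<in>u. b j x y)))"
    by (rule psd_cmult) (use assms(2) in simp)
  from psd_add[OF 1 2] show ?case
    by (rule psd_cong[rotated]) (use insert.hyps in \<open>simp add: algebra_simps\<close>)
qed

lemma psd_kernel_weighted:
  assumes "\<And>j. j \<in> {1..s} \<Longrightarrow> schur (unit_cube s) (\<lambda>x y. - 1 + k (x j) (y j))"
    and "\<And>x y. k x y = k y x" "\<forall>u\<subseteq>{1..s}. \<gamma> u \<ge> 0"
  shows "psd_kernel (unit_cube s) (weighted_kernel k \<gamma> s)"
proof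
  show "weighted_kernel k \<gamma> s x y = weighted_kernel k \<gamma> s y x" for x y
    unfolding weighted_kernel_def using assms(2) by simp
  show "psd (unit_cube s) (weighted_kernel k \<gamma> s)"
    unfolding weighted_kernel_def[abs_def]
  proof (intro psd_add psd_one psd_sum psd_cmult)
    fix u assume u: "u \<in> Pow {1..s} - {{}}"
    then show "0 \<le> \<gamma> u" using assms(3) by auto
    have "finite u" using u finite_subset by blast
    then show "psd (unit_cube s) (\<lambda>x y. \<Prod>j\<in>u. - 1 + k (x j) (y j))"
      using u assms(1) by (intro schur_imp_psd schur_prod) auto
  qed
qed

text \<open>A product over \<open>u\<close> costs C^|u|. As 1 <= C, the single constant C^s serves
  all \<open>u\<close>, the surplus being a nonnegative multiple of a psd kernel. The weights are
  common nonnegative factors, so they may vanish and do not enter the constant.\<close>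

lemma weighted_continuously_embedded:
  fixes C :: real
  assumes k1: "\<And>j. j \<in> {1..s} \<Longrightarrow> schur (unit_cube s) (\<lambda>x y. - 1 + k1 (x j) (y j))" "\<And>x y. k1 x y = k1 y x"
    and k2: "\<And>j. j \<in> {1..s} \<Longrightarrow> schur (unit_cube s) (\<lambda>x y. - 1 + k2 (x j) (y j))" "\<And>x y. k2 x y = k2 y x"
    and \<gamma>: "\<forall>u\<subseteq>{1..s}. \<gamma> u \<ge> 0"
    and C: "1 \<le> C" "psd {0..1} (\<lambda>x y. C * (- 1 + k2 x y) - (- 1 + k1 x y))"
  shows "continuously_embedded (unit_cube s) (weighted_kernel k1 \<gamma> s) (weighted_kernel k2 \<gamma> s)"
proof (rule continuously_embeddedI)
  show "psd_kernel (unit_cube s) (weighted_kernel k1 \<gamma> s)" "psd_kernel (unit_cube s) (weighted_kernel k2 \<gamma> s)"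
    using psd_kernel_weighted[OF k1 \<gamma>] psd_kernel_weighted[OF k2 \<gamma>] by simp_all
  show "0 < C ^ s" using C by simp
  define p where "p k u x y = (\<Prod>j\<in>u. - 1 + k (x j) (y j) :: real)"
    for k :: "real \<Rightarrow> real \<Rightarrow> real" and u and x y :: "nat \<Rightarrow> real"
  have 1: "psd (unit_cube s) (\<lambda>x y. (C ^ s - 1) * 1)"
    using C by (intro psd_cmult psd_one) simp
  have 2: "psd (unit_cube s) (\<lambda>x y. \<Sum>u\<in>Pow {1..s} - {{}}. \<gamma> u * (C ^ s * p k2 u x y - p k1 u x y))"
  proof (intro psd_sum psd_cmult)
    fix u assume u: "u \<in> Pow {1..s} - {{}}"
    then show "0 \<le> \<gamma> u" using \<gamma> by auto
    have fin: "finite u" and card: "card u \<le> s"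
      using u finite_subset card_mono[of "{1..s}" u] by auto
    have "psd (unit_cube s) (\<lambda>x y. C ^ card u * p k2 u x y - p k1 u x y)"
      unfolding p_def
    proof (rule psd_prod_diff[OF fin])
      fix j assume "j \<in> u"
      then have j: "j \<in> {1..s}" using u by auto
      then show "schur (unit_cube s) (\<lambda>x y. - 1 + k1 (x j) (y j))"
        "schur (unit_cube s) (\<lambda>x y. - 1 + k2 (x j) (y j))" using k1 k2 by auto
      have "(\<lambda>x. x j) ` unit_cube s \<subseteq> {0..1}" using j by (force simp: unit_cube_def PiE_def)
      from psd_pullback[OF C(2) this]
      show "psd (unit_cube s) (\<lambda>x y. C * (- 1 + k2 (x j) (y j)) - (- 1 + k1 (x j) (y j)))" .
    qed (use C in simp)
    moreover have "psd (unit_cube s) (\<lambda>x y. (C ^ s - C ^ card u) * p k2 u x y)"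
      unfolding p_def using fin u k2 C card
      by (intro psd_cmult schur_imp_psd schur_prod) (auto intro: power_increasing)
    ultimately have "psd (unit_cube s) (\<lambda>x y. (C ^ card u * p k2 u x y - p k1 u x y) + (C ^ s - C ^ card u) * p k2 u x y)"
      by (rule psd_add)
    then show "psd (unit_cube s) (\<lambda>x y. C ^ s * p k2 u x y - p k1 u x y)"
      by (rule psd_cong[rotated]) (simp only: left_diff_distrib)
  qed
  have w: "weighted_kernel k \<gamma> s x y = 1 + (\<Sum>u\<in>Pow {1..s} - {{}}. \<gamma> u * p k u x y)" for k x y
    by (simp add: weighted_kernel_def p_def)
  from psd_add[OF 1 2]
  show "psd (unit_cube s) (\<lambda>x y. C ^ s * weighted_kernel k2 \<gamma> s x y - weighted_kernel k1 \<gamma> s x y)"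
    by (rule psd_cong[rotated]) (simp add: w algebra_simps sum_subtractf sum_distrib_left)
qed

section \<open>Bernoulli and Euler polynomials\<close>

text \<open>Division by the factorial makes differentiation an index shift and gives the ordinary
  generating function z e^(xz) / (e^z - 1).\<close>

definition bern :: "nat \<Rightarrow> real \<Rightarrow> real" where
  "bern n x = bernoulli_poly n x / fact n"

text \<open>\<open>euler n\<close> is the Euler polynomial of degree \<open>n\<close> divided by \<open>2 * fact n\<close>; its generating function is
  \<open>exp (x z) / (exp z + 1)\<close>.\<close>

definition euler :: "nat \<Rightarrow> real \<Rightarrow> real" where
  "euler n x = 2 ^ n * (bern (Suc n) ((x + 1) / 2) - bern (Suc n) (x / 2))"

lemma bernoulli_number_sum:
  "(\<Sum>k\<le>n. real (Suc n choose k) * bernoulli_number k) = (if n = 0 then 1 else 0)"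
proof (cases "n = 0")
  case True
  then show ?thesis by (simp add: bernoulli_number.simps)
next
  case False
  then have "{..n} = insert n {..<n}" by auto
  then show ?thesis using False by (subst \<open>{..n} = _\<close>) (subst sum.insert, auto simp: bernoulli_number.simps[of n] field_simps)
qed

lemma bern_sum: "bern n x = (\<Sum>k\<le>n. bernoulli_number k / fact k * (x ^ (n - k) / fact (n - k)))"
  unfolding bern_def bernoulli_poly_def sum_divide_distrib
  by (intro sum.cong refl) (simp add: binomial_fact)

definition bern_fps :: "real \<Rightarrow> real fps" where
  "bern_fps x = Abs_fps (\<lambda>n. bern n x)"

lemma fps_exp_1_neq: "fps_exp (1::real) - 1 \<noteq> 0" "fps_exp (1::real) + 1 \<noteq> 0"
proof -
  have "fps_nth (fps_exp (1::real) - 1) 1 \<noteq> 0" "fps_nth (fps_exp (1::real) + 1) 0 \<noteq> 0" by simp_all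
  then show "fps_exp (1::real) - 1 \<noteq> 0" "fps_exp (1::real) + 1 \<noteq> 0" by force+
qed

lemma bern_fps_eq: "bern_fps x = Abs_fps (\<lambda>n. bernoulli_number n / fact n) * fps_exp x"
  by (rule fps_ext) (simp add: bern_fps_def fps_mult_nth bern_sum atMost_atLeast0)

text \<open>The generating function cleared of its denominator; the identities below are proved in
  this multiplied form and then cancelled.\<close>

lemma bern_fps_mult_exp: "bern_fps x * (fps_exp 1 - 1) = fps_X * fps_exp x"
proof -
  have "Abs_fps (\<lambda>n. bernoulli_number n / fact n) * (fps_exp 1 - 1) = fps_X" (is "?B * _ = _")
  proof (rule fps_ext)
    fix n
    show "fps_nth (?B * (fps_exp 1 - 1)) n = fps_nth fps_X n"
    proof (cases n)
      case (Suc m)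
      have "fps_nth (?B * (fps_exp 1 - 1)) n = (\<Sum>k\<le>n. bernoulli_number k / fact k * fps_nth (fps_exp 1 - 1) (n - k))"
        by (simp add: fps_mult_nth atMost_atLeast0)
      also have "\<dots> = (\<Sum>k\<le>m. bernoulli_number k / fact k * (1 / fact (n - k)))"
        unfolding Suc sum.atMost_Suc by (auto intro!: sum.cong simp del: fact_Suc)
      also have "\<dots> = (\<Sum>k\<le>m. real (n choose k) * bernoulli_number k) / fact n"
        unfolding sum_divide_distrib using Suc by (intro sum.cong refl) (simp add: binomial_fact del: fact_Suc)
      also have "\<dots> = fps_nth fps_X n"
        unfolding Suc bernoulli_number_sum by simp
      finally show ?thesis .
    qed simp
  qed
  then show ?thesis unfolding bern_fps_eq by (metis mult.assoc mult.commute)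
qed

lemma bern_0: "bern 0 x = 1"
  by (simp add: bern_sum bernoulli_number.simps)

lemma bern_1: "bern (Suc 0) x = x - 1 / 2"
  by (simp add: bern_sum bernoulli_number.simps)

lemma bern_fps_mult_exp_shift: "bern_fps (x + y) = bern_fps x * fps_exp y"
  by (simp add: bern_fps_eq fps_exp_add_mult mult.assoc)

lemma bern_plus_1: "bern (Suc n) (x + 1) = bern (Suc n) x + x ^ n / fact n"
proof -
  have "bern_fps (x + 1) = bern_fps x + fps_X * fps_exp x"
    using bern_fps_mult_exp[of x] unfolding bern_fps_mult_exp_shift by (simp add: algebra_simps)
  from arg_cong[OF this, of "\<lambda>f. fps_nth f (Suc n)"] show ?thesis by (simp add: bern_fps_def)
qed

text \<open>Replacing z by -z in z e^(xz) / (e^z - 1) gives the generating function at 1 -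
  x.\<close>

lemma bern_reflect: "bern n (1 - x) = (- 1) ^ n * bern n x"
proof -
  define R where "R = fps_compose (bern_fps x) (fps_const (- 1) * fps_X)"
  have "R * (fps_exp (- 1) - 1) = - fps_X * fps_exp (- x)"
  proof -
    have "fps_compose (bern_fps x * (fps_exp 1 - 1)) (fps_const (- 1) * fps_X)
       = R * (fps_exp (- 1) - 1)"
      by (simp add: R_def fps_compose_mult_distrib fps_compose_sub_distrib)
    then show ?thesis
      unfolding bern_fps_mult_exp
      by (simp add: fps_compose_mult_distrib) (metis fps_const_1_eq_1 fps_const_neg mult_minus1 mult_minus_left)
  qed
  then have "R * (fps_exp (- 1) - 1) * fps_exp 1 = - fps_X * fps_exp (- x) * fps_exp 1" by simp
  moreover have "(fps_exp (- 1) - 1) * fps_exp 1 = 1 - (fps_exp 1 :: real fps)"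
    by (simp add: algebra_simps flip: fps_exp_add_mult)
  moreover have "fps_exp (- x) * fps_exp 1 = fps_exp (1 - x)"
    by (simp flip: fps_exp_add_mult)
  ultimately have "R * (1 - fps_exp 1) = - fps_X * fps_exp (1 - x)"
    by (simp add: mult.assoc)
  then have "R * (fps_exp 1 - 1) = fps_X * fps_exp (1 - x)"
    by (simp add: algebra_simps)
  then have "R * (fps_exp 1 - 1) = bern_fps (1 - x) * (fps_exp 1 - 1)"
    by (simp only: bern_fps_mult_exp)
  then have "R = bern_fps (1 - x)" using fps_exp_1_neq by simp
  from arg_cong[OF this, of "\<lambda>f. fps_nth f n"] show ?thesis
    by (simp add: R_def bern_fps_def fps_compose_linear)
qed

lemma bern_fps_compose_2:
  "fps_compose (bern_fps x) (fps_const 2 * fps_X) * (fps_exp 2 - 1) = fps_const 2 * fps_X * fps_exp (2 * x)"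
proof -
  have "fps_compose (bern_fps x * (fps_exp 1 - 1)) (fps_const 2 * fps_X)
     = fps_compose (bern_fps x) (fps_const 2 * fps_X) * (fps_exp 2 - 1)"
    by (simp add: fps_compose_mult_distrib fps_compose_sub_distrib)
  then show ?thesis
    unfolding bern_fps_mult_exp by (simp add: fps_compose_mult_distrib)
qed

lemma fps_exp_2_minus_1: "fps_exp 2 - 1 = (fps_exp 1 - 1) * (fps_exp (1::real) + 1)"
  using fps_exp_add_mult[of "1::real" 1] by (simp add: algebra_simps)

text \<open>Raabe's multiplication formula for factor 2, from e^(2z) - 1 = (e^z - 1)(e^z + 1). It
  fixes constants of integration in the Fourier expansion.\<close>

lemma bern_halves: "bern n (x / 2) + bern n ((x + 1) / 2) = 2 / 2 ^ n * bern n x"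
proof -
  define S where "S = fps_compose (bern_fps (x / 2) + bern_fps ((x + 1) / 2)) (fps_const 2 * fps_X)"
  have "S * (fps_exp 2 - 1) = fps_const 2 * fps_X * (fps_exp x + fps_exp (x + 1))"
    using bern_fps_compose_2[of "x / 2"] bern_fps_compose_2[of "(x + 1) / 2"]
    by (simp add: S_def fps_compose_add_distrib distrib_left distrib_right)
  also have "\<dots> = fps_const 2 * (bern_fps x * (fps_exp 1 - 1)) * (fps_exp 1 + 1)"
    unfolding bern_fps_mult_exp fps_exp_add_mult by (simp add: algebra_simps)
  finally have "S = fps_const 2 * bern_fps x"
    using fps_exp_1_neq by (simp add: fps_exp_2_minus_1 flip: mult.assoc)
  moreover have "fps_nth S n = 2 ^ n * (bern n (x / 2) + bern n ((x + 1) / 2))"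
    unfolding S_def fps_compose_linear by (simp add: bern_fps_def)
  ultimately show ?thesis by (simp add: bern_fps_def field_simps)
qed

definition euler_fps :: "real \<Rightarrow> real fps" where
  "euler_fps x = Abs_fps (\<lambda>n. euler n x)"

lemma euler_fps_mult_exp: "euler_fps x * (fps_exp 1 + 1) = fps_exp x"
proof -
  define G where "G = fps_compose (bern_fps ((x + 1) / 2) - bern_fps (x / 2)) (fps_const 2 * fps_X)"
  \<comment> \<open>The coefficient at 0 vanishes since \<open>bern 0\<close> is constant; the one
    at n + 1 carries 2^(n+1), twice the 2^n in \<open>euler\<close>.\<close>
  have "G = fps_const 2 * fps_X * euler_fps x"
  proof (rule fps_ext)
    fix n show "fps_nth G n = fps_nth (fps_const 2 * fps_X * euler_fps x) n"
      by (cases n) (simp_all add: G_def euler_fps_def euler_def bern_fps_def fps_compose_linear bern_0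
          mult.assoc)
  qed
  moreover have "G * (fps_exp 2 - 1) = fps_const 2 * fps_X * (fps_exp (x + 1) - fps_exp x)"
  proof -
    have "G * (fps_exp 2 - 1) = fps_compose (bern_fps ((x + 1) / 2)) (fps_const 2 * fps_X) * (fps_exp 2 - 1)
        - fps_compose (bern_fps (x / 2)) (fps_const 2 * fps_X) * (fps_exp 2 - 1)"
      unfolding G_def fps_compose_sub_distrib left_diff_distrib ..
    also have "\<dots> = fps_const 2 * fps_X * fps_exp (2 * ((x + 1) / 2)) - fps_const 2 * fps_X * fps_exp (2 * (x / 2))"
      unfolding bern_fps_compose_2 ..
    also have "\<dots> = fps_const 2 * fps_X * (fps_exp (x + 1) - fps_exp x)"
      by (simp add: right_diff_distrib)
    finally show ?thesis .
  qed
  ultimately have "(fps_const 2 * fps_X * (fps_exp 1 - 1)) * (euler_fps x * (fps_exp 1 + 1))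
     = (fps_const 2 * fps_X * (fps_exp 1 - 1)) * fps_exp x"
    unfolding fps_exp_2_minus_1 fps_exp_add_mult by (simp add: algebra_simps)
  moreover have "fps_const 2 * fps_X * (fps_exp 1 - 1) \<noteq> (0 :: real fps)"
    using fps_exp_1_neq by simp
  ultimately show ?thesis using mult_left_cancel by blast
qed

lemma euler_0: "euler 0 x = 1 / 2"
  by (simp add: euler_def bern_1 field_simps)

text \<open>From z/(e^z - 1) + z/(e^z + 1) = 2 z e^z / ((e^z - 1)(e^z + 1)): the sum of the
  generating functions at u + v factors into one in u and one in v + 1, which separates the
  variables.\<close>

lemma bern_plus_euler:
  "bern (Suc n) (u + v) + euler n (u + v) = (\<Sum>i\<le>Suc n. bern i u * (2 * euler (Suc n - i) (v + 1)))"
proof -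
  let ?e = "fps_exp (1::real)"
  have "(bern_fps (u + v) + fps_X * euler_fps (u + v)) * ((?e - 1) * (?e + 1))
      = (bern_fps (u + v) * (?e - 1)) * (?e + 1) + fps_X * (euler_fps (u + v) * (?e + 1)) * (?e - 1)"
    by (simp add: algebra_simps)
  also have "\<dots> = fps_const 2 * fps_X * fps_exp (u + v) * ?e"
    unfolding bern_fps_mult_exp euler_fps_mult_exp by (simp add: algebra_simps)
  also have "\<dots> = fps_const 2 * (fps_X * fps_exp u) * fps_exp (v + 1)"
    unfolding fps_exp_add_mult by (simp add: algebra_simps)
  also have "\<dots> = fps_const 2 * (bern_fps u * (?e - 1)) * (euler_fps (v + 1) * (?e + 1))"
    by (simp only: bern_fps_mult_exp euler_fps_mult_exp)
  also have "\<dots> = (bern_fps u * (fps_const 2 * euler_fps (v + 1))) * ((?e - 1) * (?e + 1))"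
    by (simp add: algebra_simps)
  finally have "bern_fps (u + v) + fps_X * euler_fps (u + v) = bern_fps u * (fps_const 2 * euler_fps (v + 1))"
    using fps_exp_1_neq by (metis mult_right_cancel no_zero_divisors)
  from arg_cong[OF this, of "\<lambda>f. fps_nth f (Suc n)"] show ?thesis
    unfolding fps_mult_nth[of "bern_fps u"] fps_mult_left_const_nth
    by (simp add: atMost_atLeast0 bern_fps_def euler_fps_def)
qed

lemma has_field_derivative_monomial:
  "((\<lambda>x :: real. x ^ Suc m / fact (Suc m)) has_field_derivative x ^ m / fact m) (at x within S)"
  using DERIV_cdivide[OF DERIV_pow[of "Suc m" x S], of "fact (Suc m)"]
  by (simp del: power_Suc of_nat_Suc)

lemma bern_has_field_derivative:
  "(bern (Suc n) has_field_derivative bern n x) (at x within S)"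
proof -
  let ?c = "\<lambda>k. bernoulli_number k / fact k"
  have "((\<lambda>x. (\<Sum>k\<le>n. ?c k * (x ^ (Suc n - k) / fact (Suc n - k))) + ?c (Suc n))
     has_field_derivative (\<Sum>k\<le>n. ?c k * (x ^ (n - k) / fact (n - k))) + 0) (at x within S)"
  proof (intro DERIV_add DERIV_sum DERIV_cmult DERIV_const)
    fix k assume "k \<in> {..n}"
    then have "Suc n - k = Suc (n - k)" by auto
    then show "((\<lambda>x. x ^ (Suc n - k) / fact (Suc n - k)) has_field_derivative x ^ (n - k) / fact (n - k)) (at x within S)"
      by (simp only: has_field_derivative_monomial)
  qed
  moreover have "bern (Suc n) = (\<lambda>x. (\<Sum>k\<le>n. ?c k * (x ^ (Suc n - k) / fact (Suc n - k))) + ?c (Suc n))"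
    by (rule ext) (simp add: bern_sum)
  ultimately show ?thesis by (simp add: bern_sum)
qed

lemma euler_has_field_derivative:
  "(euler (Suc n) has_field_derivative euler n x) (at x within S)"
proof -
  have "((\<lambda>x. bern (Suc (Suc n)) ((x + c) / 2)) has_field_derivative bern (Suc n) ((x + c) / 2) * (1 / 2)) (at x within S)" for c
    by (rule DERIV_chain'[OF _ bern_has_field_derivative]) (auto intro!: derivative_eq_intros)
  from DERIV_cmult[OF DERIV_diff[OF this[of 1] this[of 0]], of "2 ^ Suc n"] show ?thesis
    by (simp add: euler_def[abs_def] algebra_simps)
qed

section \<open>Fourier series of even Bernoulli polynomials\<close>

definition cos_series :: "nat \<Rightarrow> real \<Rightarrow> real" where
  "cos_series p t = (\<Sum>n. cos (2 * pi * real (Suc n) * t) / real (Suc n) ^ p)"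

definition sin_series :: "nat \<Rightarrow> real \<Rightarrow> real" where
  "sin_series p t = (\<Sum>n. sin (2 * pi * real (Suc n) * t) / real (Suc n) ^ p)"

definition fourier_factor :: "nat \<Rightarrow> real" where
  "fourier_factor a = (- 1) ^ (a + 1) * (2 * pi) ^ (2 * a) / 2"

lemma summable_inverse_Suc_power: "p \<ge> 2 \<Longrightarrow> summable (\<lambda>n. 1 / real (Suc n) ^ p)"
  using inverse_power_summable[of p, where ?'a = real] summable_Suc_iff[of "\<lambda>n. inverse (real n ^ p)"]
  by (simp add: field_simps)

lemma summable_bounded_over_power:
  assumes "p \<ge> 2" "\<And>n. \<bar>f n\<bar> \<le> B"
  shows "summable (\<lambda>n. f n / real (Suc n) ^ p)"
proof (rule summable_comparison_test')
  show "summable (\<lambda>n. B * (1 / real (Suc n) ^ p))"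
    by (intro summable_mult summable_inverse_Suc_power assms)
  show "norm (f n / real (Suc n) ^ p) \<le> B * (1 / real (Suc n) ^ p)" if "n \<ge> 0" for n
    using assms(2)[of n] by (simp add: divide_right_mono del: of_nat_Suc)
qed

lemma cos_series_sums:
  assumes "p \<ge> 2"
  shows "(\<lambda>n. cos (2 * pi * real (Suc n) * t) / real (Suc n) ^ p) sums cos_series p t"
  unfolding cos_series_def
  by (intro summable_sums summable_bounded_over_power[of _ _ 1] assms abs_cos_le_one)

lemma uniformly_convergent_bounded_over_power:
  assumes "p \<ge> 2" "\<And>n x. \<bar>f n x\<bar> \<le> B"
  shows "uniformly_convergent_on S (\<lambda>n x. \<Sum>i<n. f i x / real (Suc i) ^ p)"
proof (rule Weierstrass_m_test'_ev)
  show "\<forall>\<^sub>F n in sequentially. \<forall>x\<in>S. norm (f n x / real (Suc n) ^ p) \<le> B * (1 / real (Suc n) ^ p)"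
    using assms(2) by (intro always_eventually) (auto simp: divide_right_mono simp del: of_nat_Suc)
  show "summable (\<lambda>n. B * (1 / real (Suc n) ^ p))"
    by (intro summable_mult summable_inverse_Suc_power assms)
qed

lemma DERIV_cos_series:
  assumes "p \<ge> 2"
  shows "(cos_series (Suc p) has_field_derivative - 2 * pi * sin_series p t) (at t)"
proof -
  let ?d = "\<lambda>n x. (- 2 * pi * sin (2 * pi * real (Suc n) * x)) / real (Suc n) ^ p"
  have "((\<lambda>x. \<Sum>n. cos (2 * pi * real (Suc n) * x) / real (Suc n) ^ Suc p)
      has_field_derivative (\<Sum>n. ?d n t)) (at t)"
  proof (rule has_field_derivative_series'(2)[where S = UNIV and ?x0.0 = 0 and x = t and f' = ?d
        and f = "\<lambda>n x. cos (2 * pi * real (Suc n) * x) / real (Suc n) ^ Suc p"])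
    show "((\<lambda>x. cos (2 * pi * real (Suc n) * x) / real (Suc n) ^ Suc p) has_field_derivative ?d n x) (at x within UNIV)"
      for n x by (rule derivative_eq_intros refl | simp del: of_nat_Suc)+
    show "uniformly_convergent_on UNIV (\<lambda>n x. \<Sum>i<n. ?d i x)"
      by (rule uniformly_convergent_bounded_over_power[of _ _ "2 * pi"])
        (use assms in \<open>auto simp: abs_mult intro!: mult_left_le\<close>)
    show "summable (\<lambda>n. cos (2 * pi * real (Suc n) * 0) / real (Suc n) ^ Suc p)"
      by (rule summable_bounded_over_power[of _ _ 1]) (use assms in auto)
  qed auto
  moreover have "(\<Sum>n. ?d n t) = - 2 * pi * sin_series p t"
  proof -
    have "summable (\<lambda>n. sin (2 * pi * real (Suc n) * t) / real (Suc n) ^ p)"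
      by (rule summable_bounded_over_power[of _ _ 1]) (use assms in auto)
    from suminf_mult[OF this, of "- 2 * pi"] show ?thesis
      by (simp add: sin_series_def del: of_nat_Suc)
  qed
  ultimately show ?thesis by (simp add: cos_series_def[abs_def])
qed

lemma DERIV_sin_series:
  assumes "p \<ge> 2"
  shows "(sin_series (Suc p) has_field_derivative 2 * pi * cos_series p t) (at t)"
proof -
  let ?d = "\<lambda>n x. (2 * pi * cos (2 * pi * real (Suc n) * x)) / real (Suc n) ^ p"
  have "((\<lambda>x. \<Sum>n. sin (2 * pi * real (Suc n) * x) / real (Suc n) ^ Suc p)
      has_field_derivative (\<Sum>n. ?d n t)) (at t)"
  proof (rule has_field_derivative_series'(2)[where S = UNIV and ?x0.0 = 0 and x = t and f' = ?d
        and f = "\<lambda>n x. sin (2 * pi * real (Suc n) * x) / real (Suc n) ^ Suc p"])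
    show "((\<lambda>x. sin (2 * pi * real (Suc n) * x) / real (Suc n) ^ Suc p) has_field_derivative ?d n x) (at x within UNIV)"
      for n x by (rule derivative_eq_intros refl | simp del: of_nat_Suc)+
    show "uniformly_convergent_on UNIV (\<lambda>n x. \<Sum>i<n. ?d i x)"
      by (rule uniformly_convergent_bounded_over_power[of _ _ "2 * pi"])
        (use assms in \<open>auto simp: abs_mult intro!: mult_left_le\<close>)
    show "summable (\<lambda>n. sin (2 * pi * real (Suc n) * 0) / real (Suc n) ^ Suc p)"
      by (rule summable_bounded_over_power[of _ _ 1]) (use assms in auto)
  qed auto
  moreover have "(\<Sum>n. ?d n t) = 2 * pi * cos_series p t"
  proof -
    have "summable (\<lambda>n. cos (2 * pi * real (Suc n) * t) / real (Suc n) ^ p)"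
      by (rule summable_bounded_over_power[of _ _ 1]) (use assms in auto)
    from suminf_mult[OF this, of "2 * pi"] show ?thesis
      by (simp add: cos_series_def del: of_nat_Suc)
  qed
  ultimately show ?thesis by (simp add: sin_series_def[abs_def])
qed

text \<open>Odd frequencies cancel and even ones double. This is the relation of
  \<open>bern_halves\<close>, so a constant discrepancy between the two sides must vanish.\<close>

lemma cos_series_halves:
  assumes "p \<ge> 2"
  shows "cos_series p (t / 2) + cos_series p ((t + 1) / 2) = 2 / 2 ^ p * cos_series p t"
proof -
  let ?f = "\<lambda>n. (cos (pi * real (Suc n) * t) + cos (pi * real (Suc n) * t + real (Suc n) * pi)) / real (Suc n) ^ p"
  have "(\<lambda>n. cos (2 * pi * real (Suc n) * (t / 2)) / real (Suc n) ^ p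
      + cos (2 * pi * real (Suc n) * ((t + 1) / 2)) / real (Suc n) ^ p) sums
      (cos_series p (t / 2) + cos_series p ((t + 1) / 2))"
    by (intro sums_add cos_series_sums assms)
  also have "(\<lambda>n. cos (2 * pi * real (Suc n) * (t / 2)) / real (Suc n) ^ p
      + cos (2 * pi * real (Suc n) * ((t + 1) / 2)) / real (Suc n) ^ p) = ?f"
  proof
    fix n
    have "2 * pi * real (Suc n) * (t / 2) = pi * real (Suc n) * t"
      "2 * pi * real (Suc n) * ((t + 1) / 2) = pi * real (Suc n) * t + real (Suc n) * pi"
      by (simp_all add: field_simps)
    then show "cos (2 * pi * real (Suc n) * (t / 2)) / real (Suc n) ^ p
      + cos (2 * pi * real (Suc n) * ((t + 1) / 2)) / real (Suc n) ^ p = ?f n"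
      by (simp only: add_divide_distrib)
  qed
  finally have 1: "?f sums (cos_series p (t / 2) + cos_series p ((t + 1) / 2))" .
  \<comment> \<open>Index n stands for frequency n + 1, so the odd indices 2n + 1 are the even
    frequencies 2(n + 1).\<close>
  have "(\<lambda>n. ?f (2 * n + 1)) sums (cos_series p (t / 2) + cos_series p ((t + 1) / 2))"
  proof (rule sums_mono_reindex[of "\<lambda>n. 2 * n + 1" ?f, THEN iffD2])
    show "strict_mono (\<lambda>n::nat. 2 * n + 1)" by (auto simp: strict_mono_def)
    fix n assume n: "n \<notin> range (\<lambda>n::nat. 2 * n + 1)"
    have "even n"
    proof (rule ccontr)
      assume "odd n"
      then obtain m where "n = 2 * m + 1" by (rule oddE)
      then show False using n by blast
    qed
    then have "cos (pi * real (Suc n) * t + real (Suc n) * pi) = - cos (pi * real (Suc n) * t)"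
      by (simp add: cos_add del: of_nat_Suc)
    then show "?f n = 0" by simp
  qed (rule 1)
  moreover have "?f (2 * n + 1) = 2 / 2 ^ p * (cos (2 * pi * real (Suc n) * t) / real (Suc n) ^ p)" for n
  proof -
    have k: "real (Suc (2 * n + 1)) = 2 * real (Suc n)" by simp
    have "cos (x + 2 * real (Suc n) * pi) = cos x" for x
      using cos_int_2pin[of "int (Suc n)"] sin_int_2pin[of "int (Suc n)"]
      by (simp add: cos_add mult_ac del: of_nat_Suc)
    then show ?thesis unfolding k by (simp add: power_mult_distrib mult_ac del: of_nat_Suc)
  qed
  ultimately have "(\<lambda>n. 2 / 2 ^ p * (cos (2 * pi * real (Suc n) * t) / real (Suc n) ^ p)) sums
     (cos_series p (t / 2) + cos_series p ((t + 1) / 2))" by simp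
  then show ?thesis using sums_mult[OF cos_series_sums[OF assms]] sums_unique2 by blast
qed

lemma dirichlet_kernel:
  "sin (pi * t) * (1 + 2 * (\<Sum>k<n. cos (2 * pi * real (Suc k) * t))) = sin (real (2 * n + 1) * pi * t)"
proof (induction n)
  case (Suc n)
  let ?a = "2 * pi * real (Suc n) * t"
  have "sin (real (2 * Suc n + 1) * pi * t) = sin (?a + pi * t)"
    "sin (real (2 * n + 1) * pi * t) = sin (?a - pi * t)"
    by (simp_all add: algebra_simps)
  then have "sin (real (2 * Suc n + 1) * pi * t) = sin (real (2 * n + 1) * pi * t) + 2 * sin (pi * t) * cos ?a"
    by (simp add: sin_add sin_diff)
  then show ?case using Suc.IH by (simp add: algebra_simps)
qed simp

text \<open>The second derivatives of the partial sums are Dirichlet kernels; subtracting the boundary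
  term of an integration by parts leaves a derivative of size \<open>O(1/n)\<close> away from the integers.\<close>

lemma cos_series_2_partial_derivative:
  fixes n :: nat
  defines "N \<equiv> real (2 * n + 1)"
  assumes a: "0 < a" "a \<le> 1 / 2" and t: "t \<in> {a..1 - a}"
  defines "m \<equiv> sin (pi * a)"
  shows "\<bar>(\<Sum>k<n. - 2 * pi * sin (2 * pi * real (Suc k) * t) / real (Suc k)) - 2 * pi\<^sup>2 * (t - 1 / 2)\<bar>
      \<le> (2 * pi\<^sup>2 / m\<^sup>2 + 2 * pi / m) / N"
proof -
  define u where "u x = (\<Sum>k<n. - 2 * pi * sin (2 * pi * real (Suc k) * x) / real (Suc k)) - 2 * pi\<^sup>2 * (x - 1 / 2)" for x
  define w where "w x = 2 * pi * cos (N * pi * x) / (N * sin (pi * x))" for x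
  have N: "N > 0" "N \<ge> 1" by (auto simp: N_def)
  have m: "m > 0" unfolding m_def using a by (intro sin_gt_zero) (auto simp: field_simps)
  have sin_ge: "m \<le> sin (pi * x)" if x: "x \<in> {a..1 - a}" for x
  proof (cases "x \<le> 1 / 2")
    case True
    have "pi * a \<le> pi * x" using x by simp
    moreover have "pi * x \<le> pi / 2" using True by simp
    moreover have "- (pi / 2) \<le> pi * a" using a by (smt (verit) pi_ge_zero mult_nonneg_nonneg divide_nonneg_pos)
    ultimately show ?thesis unfolding m_def by (intro sin_monotone_2pi_le)
  next
    case False
    have "pi * a \<le> pi * (1 - x)" using x by (intro mult_left_mono) auto
    moreover have "pi * (1 - x) \<le> pi / 2" using False by (simp add: field_simps)
    moreover have "- (pi / 2) \<le> pi * a" using a by (smt (verit) pi_ge_zero mult_nonneg_nonneg divide_nonneg_pos)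
    ultimately have "m \<le> sin (pi * (1 - x))" unfolding m_def by (intro sin_monotone_2pi_le)
    also have "sin (pi * (1 - x)) = sin (pi * x)"
      by (simp add: right_diff_distrib sin_diff)
    finally show ?thesis .
  qed
  have du: "(u has_field_derivative - 2 * pi\<^sup>2 * sin (N * pi * x) / sin (pi * x)) (at x within {a..1 - a})"
    if x: "x \<in> {a..1 - a}" for x
  proof -
    have s: "sin (pi * x) \<noteq> 0" using sin_ge[OF x] m by simp
    have "(u has_field_derivative (\<Sum>k<n. - 4 * pi\<^sup>2 * cos (2 * pi * real (Suc k) * x)) - 2 * pi\<^sup>2) (at x within {a..1 - a})"
    proof -
      have "((\<lambda>x. 2 * pi\<^sup>2 * (x - 1 / 2)) has_field_derivative 2 * pi\<^sup>2) (at x within {a..1 - a})"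
        by (rule derivative_eq_intros refl | simp)+
      then show ?thesis
        unfolding u_def[abs_def]
        by (intro DERIV_diff DERIV_sum) (rule derivative_eq_intros refl | simp add: power2_eq_square del: of_nat_Suc)+
    qed
    also have "(\<Sum>k<n. - 4 * pi\<^sup>2 * cos (2 * pi * real (Suc k) * x)) - 2 * pi\<^sup>2
       = - 2 * pi\<^sup>2 * (1 + 2 * (\<Sum>k<n. cos (2 * pi * real (Suc k) * x)))"
      by (simp add: sum_distrib_left sum_negf algebra_simps del: of_nat_Suc)
    also have "\<dots> = - 2 * pi\<^sup>2 * sin (N * pi * x) / sin (pi * x)"
    proof -
      have "1 + 2 * (\<Sum>k<n. cos (2 * pi * real (Suc k) * x)) = sin (N * pi * x) / sin (pi * x)"
        using dirichlet_kernel[of x n] s unfolding N_def by (metis nonzero_mult_div_cancel_left)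
      then show ?thesis by simp
    qed
    finally show ?thesis .
  qed
  have dw: "(w has_field_derivative - 2 * pi\<^sup>2 * sin (N * pi * x) / sin (pi * x)
      - 2 * pi\<^sup>2 * cos (N * pi * x) * cos (pi * x) / (N * (sin (pi * x))\<^sup>2)) (at x within {a..1 - a})"
    if x: "x \<in> {a..1 - a}" for x
  proof -
    have s: "sin (pi * x) \<noteq> 0" using sin_ge[OF x] m by simp
    have 1: "((\<lambda>x. 2 * pi * cos (N * pi * x)) has_field_derivative - 2 * pi\<^sup>2 * N * sin (N * pi * x)) (at x within {a..1 - a})"
      and 2: "((\<lambda>x. N * sin (pi * x)) has_field_derivative N * pi * cos (pi * x)) (at x within {a..1 - a})"
      by (rule derivative_eq_intros refl | simp add: power2_eq_square)+
    have "(- 2 * pi\<^sup>2 * N * p * (N * q) - 2 * pi * c * (N * pi * r)) / (N * q * (N * q))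
       = - 2 * pi\<^sup>2 * p / q - 2 * pi\<^sup>2 * c * r / (N * q\<^sup>2)" if "q \<noteq> 0" for p q c r :: real
      using that N(1) by (simp add: field_simps power2_eq_square)
    then show ?thesis
      using DERIV_divide[OF 1 2] s N unfolding w_def[abs_def] by simp
  qed
  \<comment> \<open>The base point 1/2 is chosen because \<open>u\<close> and \<open>w\<close> both
    vanish there, \<open>w\<close> because 2n + 1 is odd.\<close>
  have half: "1 / 2 \<in> {a..1 - a}" using a by auto
  have "norm ((u t - w t) - (u (1 / 2) - w (1 / 2))) \<le> 2 * pi\<^sup>2 / (N * m\<^sup>2) * norm (t - 1 / 2)"
  proof (rule field_differentiable_bound[OF _ _ _ t half])
    fix x assume x: "x \<in> {a..1 - a}"
    show "((\<lambda>x. u x - w x) has_field_derivative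
        2 * pi\<^sup>2 * cos (N * pi * x) * cos (pi * x) / (N * (sin (pi * x))\<^sup>2)) (at x within {a..1 - a})"
      using DERIV_diff[OF du[OF x] dw[OF x]] by simp
    have "\<bar>cos (N * pi * x) * cos (pi * x)\<bar> \<le> 1"
      unfolding abs_mult by (intro mult_le_one) auto
    then have "\<bar>2 * pi\<^sup>2 * (cos (N * pi * x) * cos (pi * x))\<bar> \<le> 2 * pi\<^sup>2"
      unfolding abs_mult[of "2 * pi\<^sup>2"] by (simp add: mult_left_le)
    moreover have "m\<^sup>2 \<le> (sin (pi * x))\<^sup>2" using sin_ge[OF x] m by (intro power_mono) auto
    ultimately show "norm (2 * pi\<^sup>2 * cos (N * pi * x) * cos (pi * x) / (N * (sin (pi * x))\<^sup>2)) \<le> 2 * pi\<^sup>2 / (N * m\<^sup>2)"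
      unfolding real_norm_def abs_divide using N m
      by (intro frac_le) (auto simp: abs_mult mult_ac)
  qed (rule convex_real_interval)
  moreover have "u (1 / 2) = 0"
  proof -
    have "sin (2 * pi * real (Suc k) * (1 / 2)) = 0" for k
      using sin_npi[of "Suc k"] by (simp add: mult_ac del: sin_npi of_nat_Suc)
    then show ?thesis unfolding u_def by simp
  qed
  moreover have "w (1 / 2) = 0"
  proof -
    have "cos (N * pi * (1 / 2)) = cos (real n * pi + pi / 2)" unfolding N_def by (simp add: algebra_simps)
    also have "\<dots> = 0" by (simp add: cos_add)
    finally show ?thesis by (simp add: w_def)
  qed
  moreover have "2 * pi\<^sup>2 / (N * m\<^sup>2) * norm (t - 1 / 2) \<le> 2 * pi\<^sup>2 / (N * m\<^sup>2) * 1"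
    using t a N m by (intro mult_left_mono) auto
  moreover have "\<bar>w t\<bar> \<le> 2 * pi / (N * m)"
    unfolding w_def abs_divide using sin_ge[OF t] m N
    by (intro frac_le) (auto simp: abs_mult)
  ultimately have "\<bar>u t\<bar> \<le> 2 * pi\<^sup>2 / (N * m\<^sup>2) + 2 * pi / (N * m)" by (simp add: abs_if split: if_splits)
  also have "\<dots> = (2 * pi\<^sup>2 / m\<^sup>2 + 2 * pi / m) / N" using N m by (simp add: field_simps)
  finally show ?thesis by (simp add: u_def)
qed

text \<open>Termwise differentiation would leave sin/k, beyond the reach of
  \<open>DERIV_cos_series\<close>. Instead the partial sums minus the parabola have derivative at
  most B/(2n + 1) on a compact interval containing t and 1/2, so the limit takes the same value at
  both.\<close>

lemma cos_series_2_interior: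
  assumes t: "0 < t" "t < 1"
  shows "cos_series 2 t - pi\<^sup>2 * (t - 1 / 2)\<^sup>2 = cos_series 2 (1 / 2)"
proof -
  define a where "a = min t (1 - t)"
  have a: "0 < a" "a \<le> 1 / 2" "t \<in> {a..1 - a}" using t by (auto simp: a_def min_def)
  define B where "B = 2 * pi\<^sup>2 / (sin (pi * a))\<^sup>2 + 2 * pi / sin (pi * a)"
  define s where "s n x = (\<Sum>k<n. cos (2 * pi * real (Suc k) * x) / real (Suc k) ^ 2)" for n x
  define d where "d n x = s n x - pi\<^sup>2 * (x - 1 / 2)\<^sup>2" for n x
  have half: "1 / 2 \<in> {a..1 - a}" using a by auto
  have bound: "norm (d n t - d n (1 / 2)) \<le> B / real (2 * n + 1) * norm (t - 1 / 2)" for n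
  proof (rule field_differentiable_bound[OF _ _ _ a(3) half])
    fix x assume x: "x \<in> {a..1 - a}"
    have "((\<lambda>x. pi\<^sup>2 * (x - 1 / 2)\<^sup>2) has_field_derivative 2 * pi\<^sup>2 * (x - 1 / 2)) (at x within {a..1 - a})"
      by (rule derivative_eq_intros refl | simp)+
    then show "(d n has_field_derivative (\<Sum>k<n. - 2 * pi * sin (2 * pi * real (Suc k) * x) / real (Suc k)) - 2 * pi\<^sup>2 * (x - 1 / 2))
       (at x within {a..1 - a})"
      unfolding d_def[abs_def] s_def[abs_def]
      by (intro DERIV_diff DERIV_sum) (rule derivative_eq_intros refl | simp add: power2_eq_square del: of_nat_Suc)+
    show "norm ((\<Sum>k<n. - 2 * pi * sin (2 * pi * real (Suc k) * x) / real (Suc k)) - 2 * pi\<^sup>2 * (x - 1 / 2))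
       \<le> B / real (2 * n + 1)"
      unfolding B_def real_norm_def by (rule cos_series_2_partial_derivative[OF a(1,2) x])
  qed (rule convex_real_interval)
  have s: "(\<lambda>n. s n x) \<longlonglongrightarrow> cos_series 2 x" for x
    using cos_series_sums[of 2 x] by (simp add: sums_def s_def)
  have "(\<lambda>n. d n t - d n (1 / 2)) \<longlonglongrightarrow> (cos_series 2 t - pi\<^sup>2 * (t - 1 / 2)\<^sup>2) - (cos_series 2 (1 / 2) - pi\<^sup>2 * (1 / 2 - 1 / 2)\<^sup>2)"
    unfolding d_def by (intro tendsto_intros s)
  moreover have "(\<lambda>n. d n t - d n (1 / 2)) \<longlonglongrightarrow> 0"
  proof (rule Lim_null_comparison)
    show "\<forall>\<^sub>F n in sequentially. norm (d n t - d n (1 / 2)) \<le> B / real (2 * n + 1) * norm (t - 1 / 2)"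
      using bound by simp
    have "(\<lambda>n. B * norm (t - 1 / 2) * (1 / real (2 * n + 1))) \<longlonglongrightarrow> B * norm (t - 1 / 2) * 0"
    proof (intro tendsto_mult_left)
      have "strict_mono (\<lambda>n::nat. 2 * n)" by (auto simp: strict_mono_def)
      from LIMSEQ_subseq_LIMSEQ[OF LIMSEQ_inverse_real_of_nat this]
      show "(\<lambda>n. 1 / real (2 * n + 1)) \<longlonglongrightarrow> 0" by (simp add: o_def inverse_eq_divide add.commute)
    qed
    then show "(\<lambda>n. B / real (2 * n + 1) * norm (t - 1 / 2)) \<longlonglongrightarrow> 0" by (simp add: mult_ac)
  qed
  ultimately show ?thesis using LIMSEQ_unique by fastforce
qed

lemma bern_2: "bern 2 x = (x - 1 / 2)\<^sup>2 / 2 - 1 / 24"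
  by (simp add: bern_sum numeral_2_eq_2 bernoulli_number.simps field_simps power2_eq_square)

lemma bern_odd_0:
  assumes "a \<ge> 1"
  shows "bern (Suc (2 * a)) 0 = 0"
  using bern_plus_1[of "2 * a" 0] bern_reflect[of "Suc (2 * a)" 0] assms by (simp add: power_0_left)

text \<open>Two derivatives lead from 2a + 2 to 2a. The first constant of integration vanishes
  because the sine series and the odd Bernoulli polynomial are 0 at 0; the second, c, because the
  halving relations give 2 c = r c with r < 2.\<close>

lemma cos_series_eq_bern:
  assumes "a \<ge> 1" "0 \<le> t" "t \<le> 1"
  shows "cos_series (2 * a) t = fourier_factor a * bern (2 * a) t"
  using assms
proof (induction a arbitrary: t rule: nat_induct_at_least)
  case base
  define d where "d t = cos_series 2 t - fourier_factor 1 * bern 2 t" for t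
  have halves: "d (t / 2) + d ((t + 1) / 2) = d t / 2" for t
    using cos_series_halves[of 2 t] arg_cong[OF bern_halves[of 2 t], of "\<lambda>x. fourier_factor 1 * x"]
    by (simp add: d_def algebra_simps)
  have f: "fourier_factor 1 = 2 * pi\<^sup>2" by (simp add: fourier_factor_def power2_eq_square)
  have const: "d t = cos_series 2 (1 / 2) + pi\<^sup>2 / 12" if "0 < t" "t < 1" for t
    using cos_series_2_interior[OF that] unfolding d_def f bern_2 by (simp add: algebra_simps)
  \<comment> \<open>The points 1/4, 3/4 and 1/2 are all interior, so the common value c satisfies 2
    c = c/2.\<close>
  have "d (1 / 2) = 0" using halves[of "1 / 2"] const[of "1 / 2"] const[of "1 / 4"] const[of "3 / 4"] by simp
  then have "d t = 0" if "0 < t" "t < 1" for t using const[of "1 / 2"] const[OF that] by simp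
  \<comment> \<open>The interior formula does not reach the end points; the halving relation at 0
    and at 1 ties them to \<open>d (1 / 2)\<close>.\<close>
  moreover have "d 0 = 0" "d 1 = 0" using halves[of 0] halves[of 1] \<open>d (1 / 2) = 0\<close> by auto
  ultimately have "d t = 0" using base by (cases "t = 0 \<or> t = 1") auto
  then show ?case by (simp add: d_def)
next
  case (Suc a)
  define F where "F = fourier_factor (Suc a)"
  have F: "F = - (4 * pi\<^sup>2) * fourier_factor a"
    by (simp add: F_def fourier_factor_def power2_eq_square)
  define d where "d t = cos_series (2 * Suc a) t - F * bern (2 * Suc a) t" for t
  define e where "e t = - 2 * pi * sin_series (2 * a + 1) t - F * bern (2 * a + 1) t" for t
  have dd: "(d has_field_derivative e t) (at t within {0..1})" for t
    using DERIV_diff[OF has_field_derivative_at_within[OF DERIV_cos_series[of "2 * a + 1" t]]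
        DERIV_cmult[OF bern_has_field_derivative[of "2 * a + 1" t "{0..1}"], of F]] Suc.hyps
    by (simp add: d_def[abs_def] e_def)
  have ee: "(e has_field_derivative 0) (at t within {0..1})" if t: "t \<in> {0..1}" for t
  proof -
    have "(e has_field_derivative - 2 * pi * (2 * pi * cos_series (2 * a) t) - F * bern (2 * a) t) (at t within {0..1})"
      unfolding e_def[abs_def] Suc_eq_plus1[symmetric] using Suc.hyps
      by (intro DERIV_diff DERIV_cmult bern_has_field_derivative has_field_derivative_at_within[OF DERIV_sin_series]) auto
    then show ?thesis using Suc.IH[of t] t F by (simp add: power2_eq_square)
  qed
  have "e 0 = 0" using bern_odd_0[OF Suc.hyps] by (simp add: e_def sin_series_def)
  have e: "e t = 0" if t: "t \<in> {0..1}" for t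
  proof -
    have "\<exists>c. \<forall>x\<in>{0..1}. e x = c"
      by (rule has_field_derivative_zero_constant) (use ee in auto)
    then show ?thesis using \<open>e 0 = 0\<close> t by (metis atLeastAtMost_iff order_refl zero_le_one)
  qed
  have "\<exists>c. \<forall>x\<in>{0..1}. d x = c"
    by (rule has_field_derivative_zero_constant) (use dd e in \<open>auto, metis atLeastAtMost_iff\<close>)
  then obtain c where c: "\<And>x. x \<in> {0..1} \<Longrightarrow> d x = c" by blast
  have "d (1 / 2) + d ((1 + 1) / 2) = 2 / 2 ^ (2 * Suc a) * d 1"
    using cos_series_halves[of "2 * Suc a" 1] arg_cong[OF bern_halves[of "2 * Suc a" 1], of "\<lambda>x. F * x"] unfolding d_def
    by (simp add: algebra_simps del: power_Suc)
  moreover define r :: real where "r = 2 / 2 ^ (2 * Suc a)"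
  ultimately have "(2 - r) * c = 0" using c[of "1 / 2"] c[of 1] by (simp add: algebra_simps)
  moreover have "r < 2"
    using one_less_power[of "2::real" "2 * Suc a"] by (simp add: r_def field_simps)
  ultimately have "c = 0" by simp
  then show ?case using c[of t] Suc.prems by (simp add: d_def F_def)
qed

section \<open>Periodic and antiperiodic splines\<close>

text \<open>For \<open>x, t \<in> [0,1]\<close> this is the 1-periodic extension of \<open>bern n\<close> at \<open>x - t\<close>, up to the value at
  \<open>x = 1, t = 0\<close> when \<open>n = 1\<close>.\<close>

definition shifted_bern :: "nat \<Rightarrow> real \<Rightarrow> real \<Rightarrow> real" where
  "shifted_bern n x t = (if t \<le> x then bern n (x - t) else bern n (x - t + 1))"

lemma bern_at_1: "n \<noteq> 1 \<Longrightarrow> bern n 1 = bern n 0"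
  using bern_plus_1[of "n - 1" 0] by (cases n) (auto simp: bern_0 power_0_left)

lemma continuous_on_bern [continuous_intros]:
  assumes "continuous_on S f"
  shows "continuous_on S (\<lambda>x. bern n (f x))"
proof (cases n)
  case 0
  then show ?thesis by (simp add: bern_0)
next
  case (Suc m)
  have "continuous_on UNIV (bern n)"
    unfolding Suc by (rule DERIV_continuous_on) (rule bern_has_field_derivative)
  from continuous_on_compose2[OF this assms] show ?thesis by simp
qed

lemma continuous_on_shifted_bern:
  assumes "n \<noteq> 1"
  shows "continuous_on S (shifted_bern n x)"
proof -
  have "continuous_on UNIV (\<lambda>t. if t \<le> x then bern n (x - t) else bern n (x - t + 1))"
    by (rule continuous_on_cases_le) (auto intro!: continuous_intros simp: bern_at_1[OF assms])
  then show ?thesis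
    unfolding shifted_bern_def[abs_def] by (rule continuous_on_subset) simp
qed

lemma shifted_bern_has_field_derivative:
  assumes "t \<noteq> x"
  shows "(shifted_bern (Suc n) x has_field_derivative - shifted_bern n x t) (at t)"
proof (cases "t < x")
  case True
  have "((\<lambda>t. bern (Suc n) (x - t)) has_field_derivative bern n (x - t) * (- 1)) (at t)"
    by (rule DERIV_chain'[OF _ bern_has_field_derivative]) (auto intro!: derivative_eq_intros)
  then show ?thesis
    by (rule has_field_derivative_transform_within_open[where S = "{..<x}", THEN DERIV_cong])
       (use True in \<open>auto simp: shifted_bern_def\<close>)
next
  case False
  have "((\<lambda>t. bern (Suc n) (x - t + 1)) has_field_derivative bern n (x - t + 1) * (- 1)) (at t)"
    by (rule DERIV_chain'[OF _ bern_has_field_derivative]) (auto intro!: derivative_eq_intros)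
  then show ?thesis
    by (rule has_field_derivative_transform_within_open[where S = "{x<..}", THEN DERIV_cong])
       (use False assms in \<open>auto simp: shifted_bern_def\<close>)
qed

lemma shifted_bern_ends:
  assumes "n \<noteq> 1" "0 \<le> x" "x \<le> 1"
  shows "shifted_bern n x 1 = shifted_bern n x 0"
  using assms bern_at_1[OF assms(1)] by (cases "x = 1") (auto simp: shifted_bern_def)

lemma has_integral_DERIV_except_two:
  fixes f :: "real \<Rightarrow> real"
  assumes "\<And>t. t \<noteq> x \<Longrightarrow> t \<noteq> y \<Longrightarrow> (f has_field_derivative f' t) (at t)" "continuous_on {0..1} f"
  shows "(f' has_integral f 1 - f 0) {0..1}"
  by (rule fundamental_theorem_of_calculus_interior_strong[where S = "{x, y}"])
     (use assms in \<open>auto simp: has_real_derivative_iff_has_vector_derivative\<close>)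

lemma shifted_bern_1_convolution:
  assumes n: "n \<ge> 1" and x: "0 \<le> x" "x \<le> 1" and y: "0 \<le> y" "y \<le> 1"
  shows "((\<lambda>t. shifted_bern 1 x t * shifted_bern n y t) has_integral shifted_bern (Suc n) y x) {0..1}"
proof -
  let ?s = "\<lambda>n. shifted_bern n y"
  \<comment> \<open>Integration by parts on each side of the jump at t = x. The extra constant in
    the second branch makes \<open>Q\<close> continuous there, and for x < 1 it is all that remains
    of \<open>Q 1 - Q 0\<close>.\<close>
  define Q where "Q t = (if t \<le> x then - (x - t - 1 / 2) * ?s (Suc n) t + ?s (Suc (Suc n)) t
     else - (x - t + 1 / 2) * ?s (Suc n) t + ?s (Suc (Suc n)) t + ?s (Suc n) x)" for t
  have "((\<lambda>t. shifted_bern 1 x t * ?s n t) has_integral Q 1 - Q 0) {0..1}"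
  proof (rule has_integral_DERIV_except_two[of x y])
    show "continuous_on {0..1} Q"
      unfolding Q_def[abs_def]
      by (rule continuous_on_cases_le)
         (use n in \<open>auto intro!: continuous_intros continuous_on_shifted_bern simp: field_simps\<close>)
    fix t assume t: "t \<noteq> x" "t \<noteq> y"
    have d: "((\<lambda>t. - (x - t + c) * ?s (Suc n) t + ?s (Suc (Suc n)) t + e)
        has_field_derivative (x - t + c) * ?s n t) (at t)" for c e
      by (rule derivative_eq_intros shifted_bern_has_field_derivative t refl)+ (simp add: algebra_simps)
    show "(Q has_field_derivative shifted_bern 1 x t * ?s n t) (at t)"
    proof (cases "t < x")
      case True
      show ?thesis
        by (rule has_field_derivative_transform_within_open[OF d[of "- 1 / 2" 0], where S = "{..<x}", THEN DERIV_cong])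
           (use True in \<open>auto simp: Q_def shifted_bern_def bern_1\<close>)
    next
      case False
      show ?thesis
        by (rule has_field_derivative_transform_within_open[OF d[of "1 / 2" "?s (Suc n) x"], where S = "{x<..}", THEN DERIV_cong])
           (use False t in \<open>auto simp: Q_def shifted_bern_def bern_1\<close>)
    qed
  qed
  moreover have "Q 1 - Q 0 = shifted_bern (Suc n) y x"
    using shifted_bern_ends[of "Suc n" y] shifted_bern_ends[of "Suc (Suc n)" y] n x y
    by (cases "x = 1") (auto simp: Q_def algebra_simps)
  ultimately show ?thesis by simp
qed

text \<open>Each integration by parts moves one index from the first factor to the second with a
  change of sign, the boundary terms cancelling by periodicity. First index 1 has a jump and forms
  the base case.\<close>

lemma shifted_bern_convolution:
  assumes "n \<ge> 1" and x: "0 \<le> x" "x \<le> 1" and y: "0 \<le> y" "y \<le> 1"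
  shows "((\<lambda>t. shifted_bern (Suc m) x t * shifted_bern n y t) has_integral
      (- 1) ^ m * shifted_bern (Suc (n + m)) y x) {0..1}"
  using assms(1)
proof (induction m arbitrary: n)
  case 0
  then show ?case using shifted_bern_1_convolution[OF 0 x y] by simp
next
  case (Suc m)
  let ?F = "\<lambda>t. shifted_bern (Suc (Suc m)) x t * shifted_bern (Suc n) y t"
  have "((\<lambda>t. - (shifted_bern (Suc m) x t * shifted_bern (Suc n) y t)
      - shifted_bern (Suc (Suc m)) x t * shifted_bern n y t) has_integral ?F 1 - ?F 0) {0..1}"
  proof (rule has_integral_DERIV_except_two[of x y])
    show "continuous_on {0..1} ?F"
      using Suc.prems by (intro continuous_intros continuous_on_shifted_bern) auto
    fix t assume t: "t \<noteq> x" "t \<noteq> y"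
    show "(?F has_field_derivative - (shifted_bern (Suc m) x t * shifted_bern (Suc n) y t)
      - shifted_bern (Suc (Suc m)) x t * shifted_bern n y t) (at t)"
      by (rule derivative_eq_intros shifted_bern_has_field_derivative t refl)+ (simp add: algebra_simps)
  qed
  moreover have "?F 1 - ?F 0 = 0"
    using shifted_bern_ends[of "Suc (Suc m)" x] shifted_bern_ends[of "Suc n" y] x y Suc.prems by simp
  ultimately have 0: "((\<lambda>t. - (shifted_bern (Suc m) x t * shifted_bern (Suc n) y t)
      - shifted_bern (Suc (Suc m)) x t * shifted_bern n y t) has_integral 0) {0..1}" by simp
  have "((\<lambda>t. shifted_bern (Suc m) x t * shifted_bern (Suc n) y t) has_integral
      (- 1) ^ m * shifted_bern (Suc (Suc n + m)) y x) {0..1}" by (rule Suc.IH) simp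
  from has_integral_neg[OF has_integral_add[OF 0 this]] show ?case by (simp add: algebra_simps)
qed

text \<open>The last term of \<open>K_sob_odd_1\<close>;
  \<open>shifted_bern_square_convolution\<close> exhibits it as the L^2 Gram kernel of the periodic
  splines.\<close>

definition conv_kernel :: "nat \<Rightarrow> real \<Rightarrow> real \<Rightarrow> real" where
  "conv_kernel a x y = (- 1) ^ (a + 1) * bern (2 * a) \<bar>x - y\<bar>"

lemma shifted_bern_square_convolution:
  assumes a: "a \<ge> 1" and x: "x \<in> {0..1}" and y: "y \<in> {0..1}"
  shows "((\<lambda>t. shifted_bern a x t * shifted_bern a y t) has_integral conv_kernel a x y) {0..1}"
proof -
  obtain n where n: "a = Suc n" using a by (cases a) auto
  have "shifted_bern (2 * a) y x = bern (2 * a) \<bar>x - y\<bar>"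
    using bern_reflect[of "2 * a" "x - y"] by (auto simp: shifted_bern_def algebra_simps)
  then have "(- 1) ^ n * shifted_bern (Suc (a + n)) y x = conv_kernel a x y"
    unfolding conv_kernel_def n by (simp add: mult_2)
  then show ?thesis
    using shifted_bern_convolution[of a x y n] a x y n by simp
qed

text \<open>In terms of the argument \<open>2 * t\<close>, this is an antiperiodic spline in \<open>x - 2 * t\<close>.\<close>

definition half_shifted_bern :: "nat \<Rightarrow> real \<Rightarrow> real \<Rightarrow> real" where
  "half_shifted_bern a x t = shifted_bern a (x / 2) t - shifted_bern a ((x + 1) / 2) t"

text \<open>A shift by 1/2 exchanges the two terms. t = 0 is excluded because for x = 1 the branch
  condition then holds with equality.\<close>

lemma half_shifted_bern_antiperiodic:
  assumes "x \<in> {0..1}" "0 < t" "t \<le> 1"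
  shows "half_shifted_bern a x ((t + 1) / 2) = - half_shifted_bern a x (t / 2)"
proof -
  have e: "x / 2 - (t + 1) / 2 + 1 = (x + 1) / 2 - t / 2" "(x + 1) / 2 - (t + 1) / 2 = x / 2 - t / 2"
    by (simp_all add: field_simps)
  have c: "\<not> (t + 1) / 2 \<le> x / 2" "t / 2 \<le> (x + 1) / 2" "(t + 1) / 2 \<le> (x + 1) / 2 \<longleftrightarrow> t / 2 \<le> x / 2"
    using assms by auto
  have "shifted_bern a (x / 2) ((t + 1) / 2) = shifted_bern a ((x + 1) / 2) (t / 2)"
    "shifted_bern a ((x + 1) / 2) ((t + 1) / 2) = shifted_bern a (x / 2) (t / 2)"
    by (simp_all only: shifted_bern_def e c if_True if_False simp_thms)
  then show ?thesis by (simp add: half_shifted_bern_def)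
qed

text \<open>By \<open>bern_plus_1\<close>, crossing t = x adds (x - t)^n / n! to both terms on the
  left; the factor 2^n undoes the halved argument. Hence one polynomial serves both sides.\<close>

lemma shifted_bern_diff_half_shifted_bern:
  assumes "x \<in> {0..1}" "t \<in> {0..1}"
  shows "shifted_bern (Suc n) x t - 2 ^ n * half_shifted_bern (Suc n) x (t / 2)
    = bern (Suc n) (x - t) + euler n (x - t)"
proof -
  have half: "(x - t) / 2 = x / 2 - t / 2" "(x - t + 1) / 2 = (x + 1) / 2 - t / 2"
    by (simp_all add: field_simps)
  have upper: "t / 2 \<le> (x + 1) / 2" using assms by auto
  show ?thesis
  proof (cases "t \<le> x")
    case True
    then show ?thesis
      using upper by (simp add: half_shifted_bern_def shifted_bern_def euler_def half right_diff_distrib)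
  next
    case False
    have "2 ^ n * bern (Suc n) (x / 2 - t / 2 + 1) = 2 ^ n * bern (Suc n) (x / 2 - t / 2) + (x - t) ^ n / fact n"
      using bern_plus_1[of n "(x - t) / 2"] unfolding half(1)[symmetric]
      by (simp add: distrib_left power_divide)
    then show ?thesis
      using False upper bern_plus_1[of n "x - t"]
      by (simp add: half_shifted_bern_def shifted_bern_def euler_def half right_diff_distrib)
  qed
qed

text \<open>\<open>bern_plus_euler\<close> with u = x, v = -t, antisymmetrised under x -> 1 - x. The
  sum runs over the Euler degree j; the term j = n + 1 drops out because \<open>bern 0\<close> is
  constant.\<close>

lemma odd_part_expansion:
  assumes "x \<in> {0..1}" "t \<in> {0..1}"
  shows "(shifted_bern (Suc n) x t - shifted_bern (Suc n) (1 - x) t)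
      - 2 ^ n * (half_shifted_bern (Suc n) x (t / 2) - half_shifted_bern (Suc n) (1 - x) (t / 2))
    = (\<Sum>j<Suc n. 2 * (bern (Suc n - j) x - bern (Suc n - j) (1 - x)) * euler j (1 - t))"
proof -
  have "bern (Suc n) (x - t) + euler n (x - t) = (\<Sum>i\<le>Suc n. bern i x * (2 * euler (Suc n - i) (1 - t)))" for x
    using bern_plus_euler[of n x "- t"] by simp
  then have "bern (Suc n) (x - t) + euler n (x - t) - (bern (Suc n) (1 - x - t) + euler n (1 - x - t))
    = (\<Sum>i\<le>Suc n. 2 * (bern i x - bern i (1 - x)) * euler (Suc n - i) (1 - t))"
    by (simp only: sum_subtractf[symmetric]) (simp add: algebra_simps)
  also have "\<dots> = (\<Sum>j\<le>Suc n. 2 * (bern (Suc n - j) x - bern (Suc n - j) (1 - x)) * euler j (1 - t))"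
    by (rule sum.reindex_bij_witness[of _ "\<lambda>i. Suc n - i" "\<lambda>i. Suc n - i"]) auto
  also have "\<dots> = (\<Sum>j<Suc n. 2 * (bern (Suc n - j) x - bern (Suc n - j) (1 - x)) * euler j (1 - t))"
    unfolding lessThan_Suc_atMost[symmetric] sum.lessThan_Suc[of _ "Suc n"] by (simp add: bern_0)
  finally show ?thesis
    using shifted_bern_diff_half_shifted_bern[OF assms, of n]
      shifted_bern_diff_half_shifted_bern[of "1 - x" t n] assms
    by (simp add: algebra_simps)
qed

section \<open>Quadratic forms of the one-dimensional kernels\<close>

lemma has_integral_pair:
  assumes "\<And>x. x \<in> points l \<Longrightarrow> (f x has_integral I x) S"
  shows "((\<lambda>t. pair l (\<lambda>x. f x t)) has_integral pair l I) S"
  using assms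
proof (induction l)
  case (Cons p l)
  then show ?case by (cases p) (auto intro!: has_integral_add has_integral_mult_right)
qed simp

lemma has_integral_pair_square:
  assumes "\<And>x y. x \<in> points l \<Longrightarrow> y \<in> points l \<Longrightarrow> ((\<lambda>t. f x t * f y t) has_integral K x y) S"
  shows "((\<lambda>t. (pair l (\<lambda>x. f x t))\<^sup>2) has_integral qf K l l) S"
proof -
  have "((\<lambda>t. pair l (\<lambda>x. pair l (\<lambda>y. f x t * f y t))) has_integral qf K l l) S"
    unfolding qf_def by (intro has_integral_pair assms)
  then show ?thesis by (simp add: pair_cmult pair_multc power2_eq_square)
qed

text \<open>Linear extension to measures of a map from points to measures, through which
  \<open>reflect_diff\<close> and \<open>half_reflect_diff\<close> act on \<open>l\<close>.\<close>

definition bind_points :: "(real \<times> 'a) list \<Rightarrow> ('a \<Rightarrow> (real \<times> 'b) list) \<Rightarrow> (real \<times> 'b) list" where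
  "bind_points l L = concat (map (\<lambda>(c, x). scale c (L x)) l)"

lemma pair_bind_points: "pair (bind_points l L) f = pair l (\<lambda>x. pair (L x) f)"
  by (induction l) (auto simp: bind_points_def)

lemma points_bind_points: "points (bind_points l L) = (\<Union>x\<in>points l. points (L x))"
  by (induction l) (auto simp: bind_points_def)

definition power_kernel :: "nat \<Rightarrow> (nat \<Rightarrow> 'a \<Rightarrow> real) \<Rightarrow> 'a \<Rightarrow> 'a \<Rightarrow> real" where
  "power_kernel a f x y = (\<Sum>n. f n x * f n y / real (Suc n) ^ (2 * a))"

lemma power_kernel_sums:
  assumes "a \<ge> 1" "\<And>n x. \<bar>f n x\<bar> \<le> 1"
  shows "(\<lambda>n. f n x * f n y / real (Suc n) ^ (2 * a)) sums power_kernel a f x y"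
  unfolding power_kernel_def
proof (intro summable_sums summable_bounded_over_power[of _ _ 1])
  show "\<bar>f n x * f n y\<bar> \<le> 1" for n
    unfolding abs_mult using assms(2) by (intro mult_le_one) auto
qed (use assms in simp)

lemma qf_power_kernel_sums:
  assumes "a \<ge> 1" "\<And>n x. \<bar>f n x\<bar> \<le> 1"
  shows "(\<lambda>n. (pair l (f n))\<^sup>2 / real (Suc n) ^ (2 * a)) sums qf (power_kernel a f) l l"
proof -
  have "(\<lambda>N. pair l (\<lambda>x. pair l (\<lambda>y. \<Sum>n<N. f n x * f n y / real (Suc n) ^ (2 * a))))
      \<longlonglongrightarrow> qf (power_kernel a f) l l"
    unfolding qf_def using power_kernel_sums[where f = f, OF assms] by (intro tendsto_pair) (simp add: sums_def)
  moreover have "pair l (\<lambda>x. pair l (\<lambda>y. f n x * f n y / r)) = (pair l (f n))\<^sup>2 / r" for n r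
    using pair_multc[of l _ "1 / r"] pair_multc[of l "f n"] pair_cmult[of l _ "f n"]
    by (simp add: power2_eq_square)
  ultimately show ?thesis by (simp add: sums_def pair_sum)
qed

lemma qf_power_kernel_nonneg:
  assumes "a \<ge> 1" "\<And>n x. \<bar>f n x\<bar> \<le> 1"
  shows "0 \<le> qf (power_kernel a f) l l"
  by (rule sums_le[OF _ sums_zero qf_power_kernel_sums[where f = f, OF assms]]) auto

lemma qf_power_kernel_scale:
  assumes "a \<ge> 1" "\<And>n x. \<bar>f n x\<bar> \<le> 1" "\<And>n x. \<bar>g n x\<bar> \<le> 1"
    and "\<And>n. pair m (f n) = r * pair l (g n)"
  shows "qf (power_kernel a f) m m = r\<^sup>2 * qf (power_kernel a g) l l"
proof -
  have "(\<lambda>n. r\<^sup>2 * ((pair l (g n))\<^sup>2 / real (Suc n) ^ (2 * a))) sums qf (power_kernel a f) m m"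
    using qf_power_kernel_sums[where f = f, OF assms(1,2), of m] by (simp add: assms(4) power_mult_distrib)
  then show ?thesis
    using sums_mult[OF qf_power_kernel_sums[where f = g, OF assms(1,3), of l], of "r\<^sup>2"] sums_unique2 by blast
qed

lemma schur_power_kernel:
  assumes "a \<ge> 1" "\<And>n x. \<bar>f n x\<bar> \<le> 1"
  shows "schur X (\<lambda>x y. power_kernel a f (p x) (p y))"
proof (rule schur_sums[where f = "\<lambda>n x. f n (p x) / real (Suc n) ^ a"])
  fix x y
  have "f n (p x) / real (Suc n) ^ a * (f n (p y) / real (Suc n) ^ a)
      = f n (p x) * f n (p y) / real (Suc n) ^ (2 * a)" for n
    by (simp add: mult_2 power_add)
  then show "(\<lambda>n. f n (p x) / real (Suc n) ^ a * (f n (p y) / real (Suc n) ^ a)) sums power_kernel a f (p x) (p y)"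
    using power_kernel_sums[where f = f, OF assms] by presburger
qed

definition cos_full :: "nat \<Rightarrow> real \<Rightarrow> real" where "cos_full n x = cos (2 * pi * real (Suc n) * x)"
definition sin_full :: "nat \<Rightarrow> real \<Rightarrow> real" where "sin_full n x = sin (2 * pi * real (Suc n) * x)"
definition cos_half :: "nat \<Rightarrow> real \<Rightarrow> real" where "cos_half n x = cos (pi * real (Suc n) * x)"

text \<open>Index \<open>n\<close> stands for the frequency \<open>Suc n\<close>, so the odd frequencies are the even indices.\<close>

definition cos_half_odd :: "nat \<Rightarrow> real \<Rightarrow> real" where
  "cos_half_odd n x = (if even n then cos_half n x else 0)"

lemma trig_bounds [simp]:
  "\<bar>cos_full n x\<bar> \<le> 1" "\<bar>sin_full n x\<bar> \<le> 1" "\<bar>cos_half n x\<bar> \<le> 1" "\<bar>cos_half_odd n x\<bar> \<le> 1"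
  by (simp_all add: cos_full_def sin_full_def cos_half_def cos_half_odd_def)

lemma K_kor_cos_1_eq:
  assumes "a \<ge> 1"
  shows "- 1 + K_kor_cos_1 a x y
    = power_kernel a cos_full x y + power_kernel a sin_full x y + power_kernel a cos_half x y"
proof -
  have "(\<lambda>n. cos_full n x * cos_full n y / real (Suc n) ^ (2 * a) + sin_full n x * sin_full n y / real (Suc n) ^ (2 * a)
      + cos_half n x * cos_half n y / real (Suc n) ^ (2 * a)) sums
    (power_kernel a cos_full x y + power_kernel a sin_full x y + power_kernel a cos_half x y)"
    by (intro sums_add power_kernel_sums assms) simp_all
  also have "(\<lambda>n. cos_full n x * cos_full n y / real (Suc n) ^ (2 * a) + sin_full n x * sin_full n y / real (Suc n) ^ (2 * a)
      + cos_half n x * cos_half n y / real (Suc n) ^ (2 * a)) =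
    (\<lambda>n. let k = real (Suc n) in
            (cos (2 * pi * k * (x - y)) + cos (pi * k * x) * cos (pi * k * y)) / k ^ (2 * a))"
    by (rule ext) (simp only: Let_def cos_full_def sin_full_def cos_half_def right_diff_distrib cos_diff add_divide_distrib)
  finally show ?thesis by (simp add: K_kor_cos_1_def sums_unique[symmetric])
qed

text \<open>The modulus of \<open>fourier_factor\<close>, whose sign is already in
  \<open>conv_kernel\<close>.\<close>

definition conv_scale :: "nat \<Rightarrow> real" where "conv_scale a = (2 * pi) ^ (2 * a) / 2"

lemma conv_scale_pos: "conv_scale a > 0"
  by (simp add: conv_scale_def)

lemma conv_kernel_eq:
  assumes "a \<ge> 1" "x \<in> {0..1}" "y \<in> {0..1}"
  shows "conv_scale a * conv_kernel a x y = power_kernel a cos_full x y + power_kernel a sin_full x y"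
proof -
  have "(\<lambda>n. cos_full n x * cos_full n y / real (Suc n) ^ (2 * a) + sin_full n x * sin_full n y / real (Suc n) ^ (2 * a))
    sums (power_kernel a cos_full x y + power_kernel a sin_full x y)"
    by (intro sums_add power_kernel_sums assms) simp_all
  also have "(\<lambda>n. cos_full n x * cos_full n y / real (Suc n) ^ (2 * a) + sin_full n x * sin_full n y / real (Suc n) ^ (2 * a))
    = (\<lambda>n. cos (2 * pi * real (Suc n) * \<bar>x - y\<bar>) / real (Suc n) ^ (2 * a))"
  proof
    fix n
    have "cos (2 * pi * real (Suc n) * \<bar>x - y\<bar>) = cos (2 * pi * real (Suc n) * (x - y))"
    proof -
      have "2 * pi * real (Suc n) * \<bar>x - y\<bar> = \<bar>2 * pi * real (Suc n) * (x - y)\<bar>" by (simp add: abs_mult)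
      then show ?thesis by (simp only: cos_abs_real)
    qed
    then show "cos_full n x * cos_full n y / real (Suc n) ^ (2 * a) + sin_full n x * sin_full n y / real (Suc n) ^ (2 * a)
      = cos (2 * pi * real (Suc n) * \<bar>x - y\<bar>) / real (Suc n) ^ (2 * a)"
      by (simp only: cos_full_def sin_full_def right_diff_distrib cos_diff add_divide_distrib)
  qed
  finally have "power_kernel a cos_full x y + power_kernel a sin_full x y = cos_series (2 * a) \<bar>x - y\<bar>"
    using cos_series_sums[of "2 * a" "\<bar>x - y\<bar>"] assms(1) sums_unique2 by fastforce
  also have "\<dots> = fourier_factor a * bern (2 * a) \<bar>x - y\<bar>"
    using assms by (intro cos_series_eq_bern) auto
  finally show ?thesis by (simp add: fourier_factor_def conv_scale_def conv_kernel_def)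
qed

lemma qf_conv_kernel:
  assumes "a \<ge> 1" "points m \<subseteq> {0..1}"
  shows "conv_scale a * qf (conv_kernel a) m m = qf (power_kernel a cos_full) m m + qf (power_kernel a sin_full) m m"
  unfolding qf_add[symmetric] qf_cmult[symmetric]
  by (rule qf_cong[OF assms(2) assms(2)]) (rule conv_kernel_eq[OF assms(1)])

text \<open>Frequency 2k of the half-period cosines is cos(2 pi k x), with weight (2k)^(-2a) =
  4^(-a) k^(-2a).\<close>

lemma power_kernel_cos_half:
  assumes "a \<ge> 1"
  shows "power_kernel a cos_half x y = power_kernel a cos_half_odd x y + 1 / 4 ^ a * power_kernel a cos_full x y"
proof -
  define f where "f n = cos_half n x * cos_half n y / real (Suc n) ^ (2 * a)" for n
  define g where "g n = cos_half_odd n x * cos_half_odd n y / real (Suc n) ^ (2 * a)" for n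
  have "f sums power_kernel a cos_half x y" "g sums power_kernel a cos_half_odd x y"
    unfolding f_def g_def by (intro power_kernel_sums assms; simp)+
  from sums_diff[OF this]
  have "(\<lambda>n. f (2 * n + 1) - g (2 * n + 1)) sums (power_kernel a cos_half x y - power_kernel a cos_half_odd x y)"
  proof (rule sums_mono_reindex[of "\<lambda>n. 2 * n + 1" "\<lambda>n. f n - g n", THEN iffD2, rotated -1])
    show "strict_mono (\<lambda>n::nat. 2 * n + 1)" by (auto simp: strict_mono_def)
    fix n assume n: "n \<notin> range (\<lambda>n::nat. 2 * n + 1)"
    have "even n"
    proof (rule ccontr)
      assume "odd n"
      then obtain m where "n = 2 * m + 1" by (rule oddE)
      then show False using n by blast
    qed
    then show "f n - g n = 0" by (simp add: f_def g_def cos_half_odd_def)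
  qed
  moreover have "f (2 * n + 1) - g (2 * n + 1) = 1 / 4 ^ a * (cos_full n x * cos_full n y / real (Suc n) ^ (2 * a))" for n
  proof -
    have k: "real (Suc (2 * n + 1)) = 2 * real (Suc n)" by simp
    have "g (2 * n + 1) = 0" by (simp add: g_def cos_half_odd_def)
    moreover have arg: "pi * (2 * real (Suc n)) = 2 * pi * real (Suc n)" by simp
    moreover have "(2 * real (Suc n)) ^ (2 * a) = 4 ^ a * real (Suc n) ^ (2 * a)"
      by (simp only: power_mult_distrib power_mult) simp
    ultimately show ?thesis unfolding f_def cos_half_def cos_full_def k arg by (simp del: of_nat_Suc)
  qed
  ultimately have "(\<lambda>n. 1 / 4 ^ a * (cos_full n x * cos_full n y / real (Suc n) ^ (2 * a)))
      sums (power_kernel a cos_half x y - power_kernel a cos_half_odd x y)" by simp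
  moreover have "(\<lambda>n. 1 / 4 ^ a * (cos_full n x * cos_full n y / real (Suc n) ^ (2 * a)))
      sums (1 / 4 ^ a * power_kernel a cos_full x y)"
    by (intro sums_mult power_kernel_sums assms) simp
  ultimately show ?thesis using sums_unique2 by fastforce
qed

lemma qf_power_kernel_cos_half:
  assumes "a \<ge> 1"
  shows "qf (power_kernel a cos_half) l l
    = qf (power_kernel a cos_half_odd) l l + 1 / 4 ^ a * qf (power_kernel a cos_full) l l"
proof -
  have "power_kernel a cos_half = (\<lambda>x y. power_kernel a cos_half_odd x y + 1 / 4 ^ a * power_kernel a cos_full x y)"
    using power_kernel_cos_half[OF assms] by (intro ext)
  then show ?thesis by (simp only: qf_add qf_cmult)
qed

text \<open>Pairing with this measure takes twice the part of a function that is odd about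
  1/2.\<close>

definition reflect_diff :: "real \<Rightarrow> (real \<times> real) list" where
  "reflect_diff x = [(1, x), (- 1, 1 - x)]"

text \<open>Antisymmetrisation under x -> 1 - x of the point difference behind
  \<open>half_shifted_bern\<close>. Halving turns frequency 2 pi k into pi k, the difference keeps
  odd k, and antisymmetry then keeps only the cosines.\<close>

definition half_reflect_diff :: "real \<Rightarrow> (real \<times> real) list" where
  "half_reflect_diff x = [(1, x / 2), (- 1, (x + 1) / 2), (- 1, (1 - x) / 2), (1, (1 - x + 1) / 2)]"

lemma pair_reflect_diff_cos: "pair (reflect_diff x) (cos_full n) = 0"
  and pair_reflect_diff_sin: "pair (reflect_diff x) (sin_full n) = 2 * sin_full n x"
proof -
  have "2 * pi * real (Suc n) * (1 - x) = real (Suc n) * (2 * pi) - 2 * pi * real (Suc n) * x"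
    by (simp add: algebra_simps)
  moreover have "cos (real (Suc n) * (2 * pi)) = 1" "sin (real (Suc n) * (2 * pi)) = 0"
    using cos_int_2pin[of "int (Suc n)"] sin_int_2pin[of "int (Suc n)"] by (simp_all add: mult_ac del: of_nat_Suc)
  ultimately show "pair (reflect_diff x) (cos_full n) = 0" "pair (reflect_diff x) (sin_full n) = 2 * sin_full n x"
    by (simp_all only: reflect_diff_def cos_full_def sin_full_def pair_Cons pair_Nil cos_diff sin_diff)
      simp_all
qed

lemma pair_half_reflect_diff_cos: "pair (half_reflect_diff x) (cos_full n) = 4 * cos_half_odd n x"
  and pair_half_reflect_diff_sin: "pair (half_reflect_diff x) (sin_full n) = 0"
proof -
  let ?k = "real (Suc n)" and ?\<theta> = "pi * real (Suc n) * x"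
  have args: "2 * pi * ?k * (x / 2) = ?\<theta>" "2 * pi * ?k * ((x + 1) / 2) = ?\<theta> + ?k * pi"
    "2 * pi * ?k * ((1 - x) / 2) = ?k * pi - ?\<theta>" "2 * pi * ?k * ((1 - x + 1) / 2) = ?k * (2 * pi) - ?\<theta>"
    by (simp_all add: field_simps)
  have "cos (?k * (2 * pi)) = 1" "sin (?k * (2 * pi)) = 0"
    using cos_int_2pin[of "int (Suc n)"] sin_int_2pin[of "int (Suc n)"] by (simp_all add: mult_ac del: of_nat_Suc)
  moreover have "cos (?k * pi) = (- 1) ^ Suc n" "sin (?k * pi) = 0"
    by (rule cos_npi, rule sin_npi)
  ultimately show "pair (half_reflect_diff x) (cos_full n) = 4 * cos_half_odd n x"
    "pair (half_reflect_diff x) (sin_full n) = 0"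
    unfolding half_reflect_diff_def cos_full_def sin_full_def pair_Cons pair_Nil args cos_diff sin_diff
      cos_add sin_add cos_half_odd_def cos_half_def
    by (auto simp del: of_nat_Suc)
qed

text \<open>Both halves of the interval contribute I/2, and the substitution doubles the first. The
  relation is assumed for t > 0 only, so the point 0 is discarded as a null set.\<close>

lemma has_integral_rescale_halves:
  fixes f :: "real \<Rightarrow> real"
  assumes "(f has_integral I) {0..1}" "\<And>t. 0 < t \<Longrightarrow> t \<le> 1 \<Longrightarrow> f ((t + 1) / 2) = f (t / 2)"
  shows "((\<lambda>t. f (t / 2)) has_integral I) {0..1}"
proof -
  have "f integrable_on {0..1}" using assms(1) by auto
  then have "f integrable_on {0..1/2}" "f integrable_on {1/2..1}"
    by (rule integrable_on_subinterval; simp)+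
  then obtain A B where AB: "(f has_integral A) {0..1/2}" "(f has_integral B) {1/2..1}"
    by (auto simp: integrable_on_def)
  have "(f has_integral A + B) {0..1}"
    by (rule has_integral_combine[OF _ _ AB]) auto
  then have I: "A + B = I" using assms(1) by (rule has_integral_unique)
  have 1: "((\<lambda>t. f (t / 2)) has_integral 2 * A) {0..1}"
    using has_integral_affinity'[of f A 0 "1/2" "1/2" 0] AB(1) by (simp add: cbox_interval mult.commute)
  have "((\<lambda>t. f (t / 2 + 1 / 2)) has_integral 2 * B) {0..1}"
    using has_integral_affinity'[of f B "1/2" 1 "1/2" "1/2"] AB(2) by (simp add: cbox_interval mult.commute)
  then have "((\<lambda>t. f (t / 2)) has_integral 2 * B) {0..1}"
    by (rule has_integral_spike_finite[of "{0}", rotated 2])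
       (use assms(2) in \<open>auto simp: add_divide_distrib\<close>)
  with 1 have "2 * A = 2 * B" by (rule has_integral_unique)
  then have "2 * A = I" using I by simp
  then show ?thesis using 1 by simp
qed

section \<open>Finite quadratic forms and the Gram matrix of the Euler polynomials\<close>

definition quad :: "nat \<Rightarrow> (nat \<Rightarrow> nat \<Rightarrow> real) \<Rightarrow> (nat \<Rightarrow> real) \<Rightarrow> real" where
  "quad a e p = (\<Sum>i<a. \<Sum>j<a. p i * p j * e i j)"

lemma quad_upper_bound: "\<exists>B>0. \<forall>p. quad a e p \<le> B * (\<Sum>j<a. (p j)\<^sup>2)"
proof (intro exI conjI allI)
  define B where "B = (\<Sum>i<a. \<Sum>j<a. \<bar>e i j\<bar>) + 1"
  have B0: "(\<Sum>i<a. \<Sum>j<a. \<bar>e i j\<bar>) \<ge> 0" by (intro sum_nonneg) simp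
  then show "B > 0" by (simp add: B_def)
  fix p :: "nat \<Rightarrow> real"
  define s where "s = (\<Sum>j<a. (p j)\<^sup>2)"
  have s: "(p j)\<^sup>2 \<le> s" if "j < a" for j
    unfolding s_def using that by (intro member_le_sum) auto
  have s0: "s \<ge> 0" unfolding s_def by (intro sum_nonneg) simp
  have "p i * p j * e i j \<le> s * \<bar>e i j\<bar>" if "i < a" "j < a" for i j
  proof -
    have "2 * \<bar>p i * p j\<bar> \<le> (p i)\<^sup>2 + (p j)\<^sup>2"
      using zero_le_power2[of "\<bar>p i\<bar> - \<bar>p j\<bar>"] by (simp add: power2_diff abs_mult)
    then have "\<bar>p i * p j\<bar> \<le> s" using s[OF that(1)] s[OF that(2)] by linarith
    then have "\<bar>p i * p j\<bar> * \<bar>e i j\<bar> \<le> s * \<bar>e i j\<bar>" by (intro mult_right_mono) auto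
    then show ?thesis using abs_ge_self[of "p i * p j * e i j"] by (simp add: abs_mult)
  qed
  then have "quad a e p \<le> (\<Sum>i<a. \<Sum>j<a. s * \<bar>e i j\<bar>)"
    unfolding quad_def by (intro sum_mono) auto
  also have "\<dots> = (\<Sum>i<a. \<Sum>j<a. \<bar>e i j\<bar>) * s"
    by (simp add: sum_distrib_left sum_distrib_right mult.commute)
  also have "\<dots> \<le> B * s" using s0 by (intro mult_right_mono) (simp_all add: B_def)
  finally show "quad a e p \<le> B * (\<Sum>j<a. (p j)\<^sup>2)" by (simp add: s_def)
qed

text \<open>The form attains a positive minimum on a compact set containing all unit vectors;
  homogeneity extends the bound, and D is the reciprocal of the minimum.\<close>

lemma quad_lower_bound:
  assumes pos: "\<And>p. \<exists>j<a. p j \<noteq> 0 \<Longrightarrow> 0 < quad a e p"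
  shows "\<exists>D>0. \<forall>p. (\<Sum>j<a. (p j)\<^sup>2) \<le> D * quad a e p"
proof (cases "a = 0")
  case True
  then show ?thesis by (intro exI[of _ 1]) (simp add: quad_def)
next
  case False
  define S where "S i = (if i < a then {- 1..1} else {0 :: real})" for i
  have coord: "continuous_on A (\<lambda>p. p i)" for A :: "(nat \<Rightarrow> real) set" and i
    by (rule continuous_on_subset[OF continuous_on_product_coordinates]) simp
  \<comment> \<open>Vectors are functions on all of nat; pinning the coordinates from
    \<open>a\<close> on to 0 makes the box compact by Tychonoff.\<close>
  have "compactin (product_topology (\<lambda>i. euclidean) UNIV) (PiE UNIV S)"
    unfolding compactin_PiE by (auto simp: S_def)
  then have "compact (PiE UNIV S)" by (simp add: euclidean_product_topology)
  \<comment> \<open>A closed condition that keeps the unit vectors and removes the zero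
    vector.\<close>
  moreover have "closed {p :: nat \<Rightarrow> real. 1 \<le> (\<Sum>j<a. (p j)\<^sup>2)}"
    by (intro closed_Collect_le continuous_intros coord)
  ultimately have compact: "compact (PiE UNIV S \<inter> {p. 1 \<le> (\<Sum>j<a. (p j)\<^sup>2)})" (is "compact ?K")
    by (rule compact_Int_closed)
  have mem: "p \<in> ?K" if "(\<Sum>j<a. (p j)\<^sup>2) = 1" "\<And>j. j \<ge> a \<Longrightarrow> p j = 0" for p
  proof -
    have "\<bar>p j\<bar> \<le> 1" if "j < a" for j
    proof -
      have "(p j)\<^sup>2 \<le> (\<Sum>j<a. (p j)\<^sup>2)" using that by (intro member_le_sum) auto
      then show ?thesis using \<open>(\<Sum>j<a. (p j)\<^sup>2) = 1\<close> by (simp add: abs_square_le_1)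
    qed
    then show ?thesis using that by (auto simp: S_def abs_le_iff)
  qed
  have "(\<lambda>j. if j = 0 then 1 else 0) \<in> ?K"
  proof (rule mem)
    have "(\<Sum>j<a. (if j = 0 then 1 else 0 :: real)\<^sup>2) = (\<Sum>j<a. if j = 0 then 1 else 0)"
      by (intro sum.cong) auto
    also have "\<dots> = 1" using False by simp
    finally show "(\<Sum>j<a. (if j = 0 then 1 else 0 :: real)\<^sup>2) = 1" .
  qed (use False in auto)
  then have ne: "?K \<noteq> {}" by blast
  have cont: "continuous_on ?K (quad a e)"
    unfolding quad_def[abs_def] by (intro continuous_intros coord)
  obtain q where q: "q \<in> ?K" "\<forall>p\<in>?K. quad a e q \<le> quad a e p"
    using continuous_attains_inf[OF compact ne cont] by (elim bexE)
  define \<delta> where "\<delta> = quad a e q"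
  have "\<exists>j<a. q j \<noteq> 0"
  proof (rule ccontr)
    assume "\<not> ?thesis"
    then have "(\<Sum>j<a. (q j)\<^sup>2) = 0" by simp
    then show False using q(1) by simp
  qed
  then have \<delta>: "\<delta> > 0" unfolding \<delta>_def by (rule pos)
  have "(\<Sum>j<a. (p j)\<^sup>2) \<le> 1 / \<delta> * quad a e p" for p
  proof -
    define s where "s = (\<Sum>j<a. (p j)\<^sup>2)"
    have s0: "s \<ge> 0" unfolding s_def by (intro sum_nonneg) simp
    show ?thesis
    proof (cases "s = 0")
      case True
      then have "p j = 0" if "j < a" for j
        using that unfolding s_def by (subst (asm) sum_nonneg_eq_0_iff) auto
      then show ?thesis by (simp add: quad_def)
    next
      case False
      then have s: "s > 0" using s0 by simp
      define r where "r j = (if j < a then p j / sqrt s else 0)" for j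
      have "(\<Sum>j<a. (r j)\<^sup>2) = (\<Sum>j<a. (p j)\<^sup>2 / s)"
        using s by (intro sum.cong) (auto simp: r_def power_divide)
      also have "\<dots> = 1" using s by (simp add: sum_divide_distrib[symmetric] s_def[symmetric])
      finally have "r \<in> ?K" by (rule mem) (simp add: r_def)
      then have "\<delta> \<le> quad a e r" unfolding \<delta>_def by (rule bspec[OF q(2)])
      also have "quad a e r = quad a e p / s"
        unfolding quad_def sum_divide_distrib using s
        by (intro sum.cong refl) (simp add: r_def field_simps)
      finally show ?thesis using s \<delta> by (simp add: s_def[symmetric] field_simps)
    qed
  qed
  then show ?thesis using \<delta> by (intro exI[of _ "1 / \<delta>"]) auto
qed

text \<open>Differentiation lowers every degree by one, so induction kills all coefficients but that
  of the constant \<open>euler 0\<close>, which one evaluation settles. The open interval allows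
  differentiation at each point.\<close>

lemma euler_combination_zero:
  assumes "\<And>u. u \<in> {0<..<1} \<Longrightarrow> (\<Sum>j<a. p j * euler j u) = 0" "j < a"
  shows "p j = 0"
  using assms
proof (induction a arbitrary: p j)
  case (Suc a)
  let ?f = "\<lambda>u. \<Sum>j<Suc a. p j * euler j u"
  have "(\<Sum>j<a. p (Suc j) * euler j u) = 0" if u: "u \<in> {0<..<1}" for u
  proof -
    have e0: "((\<lambda>u. p 0 * euler 0 u) has_field_derivative 0) (at u)"
      by (simp add: euler_0[abs_def])
    have "(?f has_field_derivative 0 + (\<Sum>j<a. p (Suc j) * euler j u)) (at u)"
      unfolding sum.lessThan_Suc_shift
      by (intro DERIV_add DERIV_sum DERIV_cmult euler_has_field_derivative e0)
    moreover have "(?f has_field_derivative 0) (at u)"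
      by (rule has_field_derivative_transform_within_open[OF DERIV_const[of 0], where S = "{0<..<1}"])
         (use u Suc.prems(1) in auto)
    ultimately show ?thesis using DERIV_unique by fastforce
  qed
  then have tail: "p (Suc j) = 0" if "j < a" for j using Suc.IH[of "\<lambda>j. p (Suc j)"] that by simp
  have "?f (1 / 2) = 0" by (rule Suc.prems(1)) simp
  then have "p 0 = 0" unfolding sum.lessThan_Suc_shift by (simp add: tail euler_0)
  then show ?case using tail Suc.prems(2) by (cases j) auto
qed simp

lemma continuous_on_euler [continuous_intros]:
  assumes "continuous_on S f"
  shows "continuous_on S (\<lambda>x. euler n (f x))"
  unfolding euler_def by (intro continuous_intros assms) auto

definition euler_gram :: "nat \<Rightarrow> nat \<Rightarrow> real" where
  "euler_gram i j = integral {0..1} (\<lambda>t. euler i (1 - t) * euler j (1 - t))"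

lemma has_integral_euler_combination:
  "((\<lambda>t. (\<Sum>j<a. p j * euler j (1 - t))\<^sup>2) has_integral quad a euler_gram p) {0..1}"
proof -
  have gram: "((\<lambda>t. euler i (1 - t) * euler j (1 - t)) has_integral euler_gram i j) {0..1}" for i j
    unfolding euler_gram_def
    by (intro integrable_integral integrable_continuous_interval continuous_intros)
  have "((\<lambda>t. \<Sum>i<a. \<Sum>j<a. p i * p j * (euler i (1 - t) * euler j (1 - t))) has_integral quad a euler_gram p) {0..1}"
    unfolding quad_def by (intro has_integral_sum has_integral_mult_right gram) auto
  moreover have "(\<Sum>i<a. \<Sum>j<a. p i * p j * (euler i (1 - t) * euler j (1 - t))) = (\<Sum>j<a. p j * euler j (1 - t))\<^sup>2" for t
    unfolding power2_eq_square sum_product by (intro sum.cong refl) (simp add: mult_ac)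
  ultimately show ?thesis by simp
qed

text \<open>Otherwise a continuous square would have integral 0 and vanish identically, against the
  independence of the Euler polynomials.\<close>

lemma quad_euler_gram_pos:
  assumes "\<exists>j<a. p j \<noteq> 0"
  shows "0 < quad a euler_gram p"
proof (rule ccontr)
  let ?P = "\<lambda>t. \<Sum>j<a. p j * euler j (1 - t)"
  assume "\<not> ?thesis"
  moreover have "0 \<le> quad a euler_gram p"
    by (rule has_integral_nonneg[OF has_integral_euler_combination]) simp
  ultimately have 0: "((\<lambda>t. (?P t)\<^sup>2) has_integral 0) (cbox 0 1)"
    using has_integral_euler_combination[where a = a and p = p] by (simp add: cbox_interval)
  have P: "?P t = 0" if t: "t \<in> {0..1}" for t
  proof -
    have "(?P t)\<^sup>2 = 0"
      by (rule has_integral_0_cbox_imp_0[OF _ _ 0])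
         (use t in \<open>auto intro!: continuous_intros simp: cbox_interval box_real\<close>)
    then show ?thesis by simp
  qed
  have "(\<Sum>j<a. p j * euler j u) = 0" if "u \<in> {0<..<1}" for u
    using P[of "1 - u"] that by simp
  then show False using euler_combination_zero[where a = a and p = p] assms by blast
qed

text \<open>The coefficients of \<open>odd_part_expansion\<close> integrated against
  \<open>l\<close>, indexed by Euler degree. By \<open>bern_reflect\<close> the entry is 0 when a -
  j is even and 4 times a Bernoulli moment when it is odd, hence the 16 below.\<close>

definition odd_moments :: "nat \<Rightarrow> (real \<times> real) list \<Rightarrow> nat \<Rightarrow> real" where
  "odd_moments a l j = pair l (\<lambda>x. 2 * (bern (a - j) x - bern (a - j) (1 - x)))"

lemma sum_odd_moments_square:
  "(\<Sum>j<a. (odd_moments a l j)\<^sup>2) = 16 * (\<Sum>\<tau>\<in>{\<tau>\<in>{1..a}. odd \<tau>}. (pair l (bern \<tau>))\<^sup>2)"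
proof -
  have "(\<Sum>j<a. (odd_moments a l j)\<^sup>2) = (\<Sum>\<tau>\<in>{1..a}. (pair l (\<lambda>x. 2 * (bern \<tau> x - bern \<tau> (1 - x))))\<^sup>2)"
    unfolding odd_moments_def
    by (rule sum.reindex_bij_witness[of _ "\<lambda>\<tau>. a - \<tau>" "\<lambda>j. a - j"]) auto
  also have "\<dots> = (\<Sum>\<tau>\<in>{1..a}. if odd \<tau> then 16 * (pair l (bern \<tau>))\<^sup>2 else 0)"
  proof (intro sum.cong refl)
    fix \<tau>
    have "(\<lambda>x. 2 * (bern \<tau> x - bern \<tau> (1 - x))) = (\<lambda>x. (if odd \<tau> then 4 else 0) * bern \<tau> x)"
      by (rule ext) (simp add: bern_reflect)
    then show "(pair l (\<lambda>x. 2 * (bern \<tau> x - bern \<tau> (1 - x))))\<^sup>2 = (if odd \<tau> then 16 * (pair l (bern \<tau>))\<^sup>2 else 0)"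
      by (simp only: pair_cmult) (simp add: power_mult_distrib)
  qed
  also have "\<dots> = 16 * (\<Sum>\<tau>\<in>{\<tau>\<in>{1..a}. odd \<tau>}. (pair l (bern \<tau>))\<^sup>2)"
    by (subst sum.inter_filter[symmetric]) (simp_all add: sum_distrib_left)
  finally show ?thesis .
qed

lemma square_diff_le: "(x - y)\<^sup>2 \<le> 2 * x\<^sup>2 + 2 * (y :: real)\<^sup>2"
  using zero_le_power2[of "x + y"] unfolding power2_sum power2_diff by linarith

text \<open>\<open>4 * S\<close>, \<open>16 * T\<close> and \<open>Q\<close> are the squared \<open>L\<^sup>2\<close> norms of the odd parts of the periodic spline, of the
  antiperiodic spline, and of the polynomial by which they differ.\<close>

lemma spline_comparison:
  fixes n :: nat
  assumes l: "points l \<subseteq> {0..1}"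
  defines "S \<equiv> qf (power_kernel (Suc n) sin_full) l l / conv_scale (Suc n)"
    and "T \<equiv> qf (power_kernel (Suc n) cos_half_odd) l l / conv_scale (Suc n)"
    and "Q \<equiv> quad (Suc n) euler_gram (odd_moments (Suc n) l)"
  shows "16 * 4 ^ n * T \<le> 8 * S + 2 * Q" and "Q \<le> 8 * S + 32 * 4 ^ n * T"
proof -
  let ?a = "Suc n"
  have integral: "((\<lambda>t. (pair (bind_points l L) (\<lambda>x. shifted_bern ?a x t))\<^sup>2) has_integral
      qf (power_kernel ?a cos_full) (bind_points l L) (bind_points l L) / conv_scale ?a
      + qf (power_kernel ?a sin_full) (bind_points l L) (bind_points l L) / conv_scale ?a) {0..1}"
    if L: "\<And>x. x \<in> {0..1} \<Longrightarrow> points (L x) \<subseteq> {0..1}" for L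
  proof -
    have m: "points (bind_points l L) \<subseteq> {0..1}" unfolding points_bind_points using l L by blast
    have "((\<lambda>t. (pair (bind_points l L) (\<lambda>x. shifted_bern ?a x t))\<^sup>2) has_integral
      qf (conv_kernel ?a) (bind_points l L) (bind_points l L)) {0..1}"
      by (rule has_integral_pair_square, rule shifted_bern_square_convolution) (use m in auto)
    moreover have "qf (conv_kernel ?a) (bind_points l L) (bind_points l L) =
      (qf (power_kernel ?a cos_full) (bind_points l L) (bind_points l L)
      + qf (power_kernel ?a sin_full) (bind_points l L) (bind_points l L)) / conv_scale ?a"
      using qf_conv_kernel[OF _ m, of ?a] conv_scale_pos[of ?a] by (simp add: field_simps)
    ultimately show ?thesis by (simp add: add_divide_distrib)
  qed
  define G where "G t = pair l (\<lambda>x. shifted_bern ?a x t - shifted_bern ?a (1 - x) t)" for t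
  define H where "H t = pair l (\<lambda>x. half_shifted_bern ?a x t - half_shifted_bern ?a (1 - x) t)" for t
  define P where "P t = (\<Sum>j<?a. odd_moments ?a l j * euler j (1 - t))" for t
  \<comment> \<open>\<open>reflect_diff\<close> kills the cosines and doubles the sines, whence the
    4; in \<open>H_full\<close> only four times the odd cosines survive, whence the 16.\<close>
  have G: "((\<lambda>t. (G t)\<^sup>2) has_integral 4 * S) {0..1}"
  proof -
    have "qf (power_kernel ?a cos_full) (bind_points l reflect_diff) (bind_points l reflect_diff)
        = 0\<^sup>2 * qf (power_kernel ?a cos_full) l l"
      by (rule qf_power_kernel_scale) (simp_all add: pair_bind_points pair_reflect_diff_cos pair_cmult[of l 0, simplified])
    moreover have "qf (power_kernel ?a sin_full) (bind_points l reflect_diff) (bind_points l reflect_diff)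
        = 2\<^sup>2 * qf (power_kernel ?a sin_full) l l"
      by (rule qf_power_kernel_scale) (simp_all add: pair_bind_points pair_reflect_diff_sin pair_cmult)
    moreover have "pair (bind_points l reflect_diff) (\<lambda>x. shifted_bern ?a x t) = G t" for t
      by (simp add: pair_bind_points reflect_diff_def G_def)
    ultimately show ?thesis using integral[of reflect_diff] by (simp add: S_def reflect_diff_def)
  qed
  have H_full: "((\<lambda>t. (H t)\<^sup>2) has_integral 16 * T) {0..1}"
  proof -
    have "qf (power_kernel ?a cos_full) (bind_points l half_reflect_diff) (bind_points l half_reflect_diff)
        = 4\<^sup>2 * qf (power_kernel ?a cos_half_odd) l l"
      by (rule qf_power_kernel_scale) (simp_all add: pair_bind_points pair_half_reflect_diff_cos pair_cmult)
    moreover have "qf (power_kernel ?a sin_full) (bind_points l half_reflect_diff) (bind_points l half_reflect_diff)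
        = 0\<^sup>2 * qf (power_kernel ?a sin_full) l l"
      by (rule qf_power_kernel_scale) (simp_all add: pair_bind_points pair_half_reflect_diff_sin pair_cmult[of l 0, simplified])
    moreover have "pair (bind_points l half_reflect_diff) (\<lambda>x. shifted_bern ?a x t) = H t" for t
      by (simp add: pair_bind_points half_reflect_diff_def H_def half_shifted_bern_def algebra_simps)
    ultimately show ?thesis using integral[of half_reflect_diff] by (simp add: T_def half_reflect_diff_def)
  qed
  \<comment> \<open>Squaring turns antiperiodicity into period 1/2, so passing from t to t/2 leaves
    the integral unchanged.\<close>
  have H: "((\<lambda>t. (H (t / 2))\<^sup>2) has_integral 16 * T) {0..1}"
  proof (rule has_integral_rescale_halves[OF H_full])
    fix t :: real assume t: "0 < t" "t \<le> 1"
    have "H ((t + 1) / 2) = pair l (\<lambda>x. (- 1) * (half_shifted_bern ?a x (t / 2) - half_shifted_bern ?a (1 - x) (t / 2)))"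
      unfolding H_def
    proof (rule pair_cong)
      fix x assume "x \<in> points l"
      then have "x \<in> {0..1}" "1 - x \<in> {0..1}" using l by auto
      then show "half_shifted_bern ?a x ((t + 1) / 2) - half_shifted_bern ?a (1 - x) ((t + 1) / 2)
        = (- 1) * (half_shifted_bern ?a x (t / 2) - half_shifted_bern ?a (1 - x) (t / 2))"
        using t by (simp only: half_shifted_bern_antiperiodic) simp
    qed
    also have "\<dots> = - H (t / 2)" unfolding pair_cmult H_def by simp
    finally show "(H ((t + 1) / 2))\<^sup>2 = (H (t / 2))\<^sup>2" by simp
  qed
  have P: "((\<lambda>t. (P t)\<^sup>2) has_integral Q) {0..1}"
    unfolding P_def Q_def by (rule has_integral_euler_combination)
  have GHP: "G t - 2 ^ n * H (t / 2) = P t" if t: "t \<in> {0..1}" for t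
  proof -
    have "G t - 2 ^ n * H (t / 2) = pair l (\<lambda>x. (shifted_bern ?a x t - shifted_bern ?a (1 - x) t)
        - 2 ^ n * (half_shifted_bern ?a x (t / 2) - half_shifted_bern ?a (1 - x) (t / 2)))"
      unfolding G_def H_def by (simp only: pair_diff pair_cmult)
    also have "\<dots> = pair l (\<lambda>x. \<Sum>j<?a. 2 * (bern (?a - j) x - bern (?a - j) (1 - x)) * euler j (1 - t))"
      by (rule pair_cong, rule odd_part_expansion) (use l t in auto)
    also have "\<dots> = P t" unfolding P_def odd_moments_def pair_sum pair_multc ..
    finally show ?thesis .
  qed
  have pow: "(2 ^ n * h)\<^sup>2 = 4 ^ n * h\<^sup>2" for h :: real
  proof -
    have "(2 ^ n)\<^sup>2 = (4 :: real) ^ n" by (simp add: power2_eq_square flip: power_mult_distrib)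
    then show ?thesis by (simp add: power_mult_distrib)
  qed
  \<comment> \<open>By \<open>GHP\<close> each of the three functions is a combination of the other
    two; this and the next bound integrate the resulting pointwise inequality
    \<open>square_diff_le\<close>.\<close>
  have "4 ^ n * (16 * T) \<le> 2 * (4 * S) + 2 * Q"
  proof (rule has_integral_le)
    show "((\<lambda>t. 4 ^ n * (H (t / 2))\<^sup>2) has_integral 4 ^ n * (16 * T)) {0..1}"
      by (rule has_integral_mult_right[OF H])
    show "((\<lambda>t. 2 * (G t)\<^sup>2 + 2 * (P t)\<^sup>2) has_integral 2 * (4 * S) + 2 * Q) {0..1}"
      by (intro has_integral_add has_integral_mult_right G P)
    fix t :: real assume "t \<in> {0..1}"
    then have "2 ^ n * H (t / 2) = G t - P t" using GHP[of t] by simp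
    then show "4 ^ n * (H (t / 2))\<^sup>2 \<le> 2 * (G t)\<^sup>2 + 2 * (P t)\<^sup>2"
      using square_diff_le[of "G t" "P t"] pow[of "H (t / 2)"] by simp
  qed
  then show "16 * 4 ^ n * T \<le> 8 * S + 2 * Q" by simp
  have "Q \<le> 2 * (4 * S) + 2 * (4 ^ n * (16 * T))"
  proof (rule has_integral_le[OF P])
    show "((\<lambda>t. 2 * (G t)\<^sup>2 + 2 * (4 ^ n * (H (t / 2))\<^sup>2)) has_integral 2 * (4 * S) + 2 * (4 ^ n * (16 * T))) {0..1}"
      by (intro has_integral_add has_integral_mult_right G H)
    fix t :: real assume "t \<in> {0..1}"
    then show "(P t)\<^sup>2 \<le> 2 * (G t)\<^sup>2 + 2 * (4 ^ n * (H (t / 2))\<^sup>2)"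
      using square_diff_le[of "G t" "2 ^ n * H (t / 2)"] pow[of "H (t / 2)"] GHP[of t] by simp
  qed
  then show "Q \<le> 8 * S + 32 * 4 ^ n * T" by simp
qed

section \<open>Equivalence of the two one-dimensional kernels\<close>

lemma K_sob_odd_1_eq:
  "- 1 + K_sob_odd_1 a x y = (\<Sum>\<tau>\<in>{\<tau>\<in>{1..a}. odd \<tau>}. bern \<tau> x * bern \<tau> y) + conv_kernel a x y"
  by (simp add: K_sob_odd_1_def conv_kernel_def bern_def power2_eq_square)

lemma qf_K_sob_odd_1:
  assumes "a \<ge> 1" "points l \<subseteq> {0..1}"
  shows "qf (\<lambda>x y. - 1 + K_sob_odd_1 a x y) l l = (\<Sum>\<tau>\<in>{\<tau>\<in>{1..a}. odd \<tau>}. (pair l (bern \<tau>))\<^sup>2)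
    + qf (power_kernel a cos_full) l l / conv_scale a + qf (power_kernel a sin_full) l l / conv_scale a"
proof -
  have "qf (conv_kernel a) l l = (qf (power_kernel a cos_full) l l + qf (power_kernel a sin_full) l l) / conv_scale a"
    using qf_conv_kernel[OF assms] conv_scale_pos[of a] by (simp add: field_simps)
  then show ?thesis
    unfolding K_sob_odd_1_eq qf_add qf_sum qf_rank_one by (simp add: add_divide_distrib)
qed

lemma qf_K_kor_cos_1:
  assumes "a \<ge> 1"
  shows "qf (\<lambda>x y. - 1 + K_kor_cos_1 a x y) l l = qf (power_kernel a cos_full) l l
    + qf (power_kernel a sin_full) l l + qf (power_kernel a cos_half) l l"
  unfolding K_kor_cos_1_eq[OF assms] qf_add ..

text \<open>The part \<open>E\<close> occurs in both forms, so only \<open>T\<close> and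
  \<open>W\<close> have to be exchanged, in the presence of \<open>S\<close>: splines link
  \<open>T\<close>, \<open>S\<close> and \<open>Q\<close>, and the Gram bounds \<open>B\<close> and
  \<open>D\<close> link \<open>Q\<close> to \<open>W\<close>.\<close>

lemma one_dimensional_comparison:
  assumes a: "a \<ge> 1"
  shows "\<exists>C\<ge>1. psd {0..1} (\<lambda>x y. C * (- 1 + K_sob_odd_1 a x y) - (- 1 + K_kor_cos_1 a x y))
    \<and> psd {0..1} (\<lambda>x y. C * (- 1 + K_kor_cos_1 a x y) - (- 1 + K_sob_odd_1 a x y))"
proof -
  obtain n where n: "a = Suc n" using a by (cases a) auto
  obtain B where B: "B > 0" "\<And>p. quad a euler_gram p \<le> B * (\<Sum>j<a. (p j)\<^sup>2)"
    using quad_upper_bound by blast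
  obtain D where D: "D > 0" "\<And>p. (\<Sum>j<a. (p j)\<^sup>2) \<le> D * quad a euler_gram p"
    using quad_lower_bound[of a euler_gram, OF quad_euler_gram_pos] by blast
  define c where "c = conv_scale a"
  have c: "c > 0" by (simp add: c_def conv_scale_pos)
  \<comment> \<open>\<open>C1\<close> absorbs the bound 2E + 2S + 2cBW for the Korobov plus cosine
    form; \<open>C2\<close> absorbs W <= (D/2) S/c + 2 D 4^n T/c together with (E + S)/c.\<close>
  define C1 where "C1 = 2 * c + 2 * c * B"
  define C2 where "C2 = (D / 2 + 2 * D * 4 ^ n + 1) / c"
  define C where "C = 1 + C1 + C2"
  have C12: "C1 \<ge> 0" "C2 \<ge> 0" using B(1) D(1) c by (auto simp: C1_def C2_def)
  have both: "qf (\<lambda>x y. - 1 + K_kor_cos_1 a x y) l l \<le> C * qf (\<lambda>x y. - 1 + K_sob_odd_1 a x y) l l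
     \<and> qf (\<lambda>x y. - 1 + K_sob_odd_1 a x y) l l \<le> C * qf (\<lambda>x y. - 1 + K_kor_cos_1 a x y) l l"
    if l: "points l \<subseteq> {0..1}" for l
  proof -
    define W where "W = (\<Sum>\<tau>\<in>{\<tau>\<in>{1..a}. odd \<tau>}. (pair l (bern \<tau>))\<^sup>2)"
    define E where "E = qf (power_kernel a cos_full) l l"
    define S where "S = qf (power_kernel a sin_full) l l"
    define T where "T = qf (power_kernel a cos_half_odd) l l"
    define F where "F = qf (power_kernel a cos_half) l l"
    define Q where "Q = quad a euler_gram (odd_moments a l)"
    have nonneg: "0 \<le> W" "0 \<le> E" "0 \<le> S" "0 \<le> T" "0 \<le> F"
      unfolding W_def E_def S_def T_def F_def
      by (auto intro!: sum_nonneg qf_power_kernel_nonneg a)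
    have F: "F = T + 1 / 4 ^ a * E" unfolding F_def T_def E_def by (rule qf_power_kernel_cos_half[OF a])
    have "1 / 4 ^ a * E \<le> 1 * E" using nonneg by (intro mult_right_mono) (auto simp: field_simps)
    then have F_le: "F \<le> T + E" using F by simp
    have T_le: "T \<le> F" using F nonneg by simp
    have Q: "Q \<le> B * (16 * W)" "16 * W \<le> D * Q"
      using B(2)[of "odd_moments a l"] D(2)[of "odd_moments a l"]
      unfolding sum_odd_moments_square Q_def W_def by auto
    have spline: "16 * 4 ^ n * (T / c) \<le> 8 * (S / c) + 2 * Q" "Q \<le> 8 * (S / c) + 32 * 4 ^ n * (T / c)"
      using spline_comparison[OF l, of n] unfolding n c_def S_def T_def Q_def by auto
    have k1: "qf (\<lambda>x y. - 1 + K_kor_cos_1 a x y) l l = E + S + F"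
      unfolding E_def S_def F_def by (rule qf_K_kor_cos_1[OF a])
    have k2: "qf (\<lambda>x y. - 1 + K_sob_odd_1 a x y) l l = W + E / c + S / c"
      unfolding E_def S_def W_def c_def by (rule qf_K_sob_odd_1[OF a l])
    have "16 * T \<le> 8 * S + 2 * c * Q"
    proof -
      have "16 * 1 * (T / c) \<le> 16 * 4 ^ n * (T / c)"
        using nonneg c by (intro mult_right_mono) auto
      then show ?thesis using spline(1) c by (simp add: field_simps)
    qed
    moreover have "2 * c * Q \<le> 2 * c * (B * (16 * W))" using Q(1) c by (intro mult_left_mono) auto
    moreover have "2 * c * (B * (16 * W)) = 16 * (2 * c * B * W)" by simp
    ultimately have "T \<le> S + 2 * c * B * W" using nonneg by linarith
    then have "E + S + F \<le> 2 * E + 2 * S + 2 * c * B * W" using F_le by simp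
    also have "\<dots> \<le> C1 * (W + E / c + S / c)"
    proof -
      have "C1 * (W + E / c + S / c) = 2 * c * W + 2 * c * B * W + 2 * E + 2 * S + 2 * B * E + 2 * B * S"
        using c by (simp add: C1_def field_simps)
      moreover have "0 \<le> 2 * c * W" "0 \<le> 2 * B * E" "0 \<le> 2 * B * S" using c B nonneg by auto
      ultimately show ?thesis by linarith
    qed
    also have "\<dots> \<le> C * (W + E / c + S / c)"
      using C12 nonneg c by (intro mult_right_mono) (auto simp: C_def)
    finally have 1: "E + S + F \<le> C * (W + E / c + S / c)" .
    have "D * Q \<le> D * (8 * (S / c) + 32 * 4 ^ n * (T / c))" using spline(2) D by (intro mult_left_mono) auto
    also have "\<dots> = 16 * (D / 2 * (S / c) + 2 * D * 4 ^ n * (T / c))" by (simp add: algebra_simps)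
    finally have "16 * W \<le> 16 * (D / 2 * (S / c) + 2 * D * 4 ^ n * (T / c))" by (rule order_trans[OF Q(2)])
    then have "W \<le> D / 2 * (S / c) + 2 * D * 4 ^ n * (T / c)" by (simp only: mult_le_cancel_left_pos zero_less_numeral)
    also have "\<dots> \<le> D / 2 * (S / c) + 2 * D * 4 ^ n * (F / c)"
      using T_le D c by (intro add_left_mono mult_left_mono divide_right_mono) auto
    finally have "W + E / c + S / c \<le> D / 2 * (S / c) + 2 * D * 4 ^ n * (F / c) + E / c + S / c" by simp
    also have "\<dots> \<le> C2 * (E + S + F)"
    proof -
      have "C2 * (E + S + F) = D / 2 * (S / c) + 2 * D * 4 ^ n * (F / c) + E / c + S / c
        + (D / 2 * (E / c) + D / 2 * (F / c) + 2 * D * 4 ^ n * (E / c) + 2 * D * 4 ^ n * (S / c) + F / c)"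
        using c by (simp add: C2_def field_simps)
      moreover have "0 \<le> D / 2 * (E / c) + D / 2 * (F / c) + 2 * D * 4 ^ n * (E / c) + 2 * D * 4 ^ n * (S / c) + F / c"
        using D c nonneg by auto
      ultimately show ?thesis by linarith
    qed
    also have "\<dots> \<le> C * (E + S + F)"
      using C12 nonneg by (intro mult_right_mono) (auto simp: C_def)
    finally show ?thesis using 1 unfolding k1 k2 by simp
  qed
  have "C \<ge> 1" using C12 by (simp add: C_def)
  then show ?thesis unfolding psd_cmult_diff_iff using both by blast
qed

lemma schur_K_kor_cos_1:
  assumes "a \<ge> 1"
  shows "schur X (\<lambda>x y. - 1 + K_kor_cos_1 a (p x) (p y))"
  unfolding K_kor_cos_1_eq[OF assms] by (intro schur_add schur_power_kernel assms) simp_all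

lemma schur_cong:
  assumes "\<And>x y. x \<in> X \<Longrightarrow> y \<in> X \<Longrightarrow> k x y = k' x y" "schur X k"
  shows "schur X k'"
  unfolding schur_def
proof (intro allI impI)
  fix P assume "psd X P"
  then have "psd X (\<lambda>x y. P x y * k x y)" using assms(2) by (simp add: schur_def)
  then show "psd X (\<lambda>x y. P x y * k' x y)" by (rule psd_cong[rotated]) (simp add: assms(1))
qed

text \<open>The Bernoulli term in |x - y| shows no positivity by itself; on [0,1] its Fourier
  expansion makes it a sum of trigonometric power kernels.\<close>

lemma schur_K_sob_odd_1:
  assumes a: "a \<ge> 1" and p: "p ` X \<subseteq> {0..1}"
  shows "schur X (\<lambda>x y. - 1 + K_sob_odd_1 a (p x) (p y))"
proof (rule schur_cong)
  show "schur X (\<lambda>x y. (\<Sum>\<tau>\<in>{\<tau>\<in>{1..a}. odd \<tau>}. bern \<tau> (p x) * bern \<tau> (p y))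
      + 1 / conv_scale a * (power_kernel a cos_full (p x) (p y) + power_kernel a sin_full (p x) (p y)))"
    using conv_scale_pos[of a]
    by (intro schur_add schur_cmult schur_power_kernel schur_sum_rank_one a) simp_all
  fix x y assume "x \<in> X" "y \<in> X"
  then have "p x \<in> {0..1}" "p y \<in> {0..1}" using p by auto
  from conv_kernel_eq[OF a this]
  show "(\<Sum>\<tau>\<in>{\<tau>\<in>{1..a}. odd \<tau>}. bern \<tau> (p x) * bern \<tau> (p y))
      + 1 / conv_scale a * (power_kernel a cos_full (p x) (p y) + power_kernel a sin_full (p x) (p y))
    = - 1 + K_sob_odd_1 a (p x) (p y)"
    unfolding K_sob_odd_1_eq using conv_scale_pos[of a] by (simp add: field_simps)
qed

theorem lemma2:
  fixes \<alpha> s :: nat and \<gamma> :: "nat set \<Rightarrow> real"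
  assumes "\<alpha> \<ge> 1" and "s \<ge> 1"
    and "\<forall>u\<subseteq>{1..s}. \<gamma> u \<ge> 0"
  shows "norm_equivalent (unit_cube s) (K_kor_cos \<alpha> \<gamma> s) (K_sob_odd \<alpha> \<gamma> s)"
proof -
  obtain C where C: "C \<ge> 1"
    "psd {0..1} (\<lambda>x y. C * (- 1 + K_sob_odd_1 \<alpha> x y) - (- 1 + K_kor_cos_1 \<alpha> x y))"
    "psd {0..1} (\<lambda>x y. C * (- 1 + K_kor_cos_1 \<alpha> x y) - (- 1 + K_sob_odd_1 \<alpha> x y))"
    using one_dimensional_comparison[OF assms(1)] by blast
  have kor: "schur (unit_cube s) (\<lambda>x y. - 1 + K_kor_cos_1 \<alpha> (x j) (y j))" for j
    by (rule schur_K_kor_cos_1[OF assms(1)])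
  have sob: "schur (unit_cube s) (\<lambda>x y. - 1 + K_sob_odd_1 \<alpha> (x j) (y j))" if "j \<in> {1..s}" for j
    by (rule schur_K_sob_odd_1[OF assms(1)]) (use that in \<open>force simp: unit_cube_def PiE_def\<close>)
  have kor_sym: "K_kor_cos_1 \<alpha> x y = K_kor_cos_1 \<alpha> y x" for x y
    using K_kor_cos_1_eq[OF assms(1), of x y] K_kor_cos_1_eq[OF assms(1), of y x]
    by (simp add: power_kernel_def mult.commute)
  have sob_sym: "K_sob_odd_1 \<alpha> x y = K_sob_odd_1 \<alpha> y x" for x y
    by (simp add: K_sob_odd_1_def mult.commute abs_minus_commute)
  show ?thesis
    unfolding norm_equivalent_def K_kor_cos_def K_sob_odd_def
    using weighted_continuously_embedded[OF kor kor_sym sob sob_sym assms(3) C(1,2)]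
      weighted_continuously_embedded[OF sob sob_sym kor kor_sym assms(3) C(1,3)]
    by blast
qed

end
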